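(* Let $d\ge1$, $q_1,\dots,q_d\in\mathbb{Z}_{>0}$ and $\Lambda=q_1\mathbb{Z}\oplus\cdots\oplus q_d\mathbb{Z}$. If at least one of the periods $q_j$ is greater than $3$, then there exists a nonzero $\Lambda$-periodic potential $V:\mathbb{Z}^d\to\mathbb{C}$ that is Floquet isospectral to the zero potential $\mathbf{0}$. If all $q_j\le 3$ and at most two of the $q_j$ are equal to $3$, then the only $\Lambda$-periodic potential Floquet isospectral to $\mathbf{0}$ is $V\equiv\mathbf{0}$.
   Context: The discrete Laplacian on $\mathbb{Z}^d$ is $(\Delta u)(n)=\sum_{n'\in\mathbb{Z}^d,\ |n'-n|_1=1}u(n')$, where $|x|_1=\sum_i|x_i|$. A potential $V:\mathbb{Z}^d\to\mathbb{C}$ is $\Lambda$-periodic if $V(n+m)=V(n)$ for all $n\in\mathbb{Z}^d$, $m\in\Lambda$; it acts as a multiplication operator. Let $\delta_1,\dots,\delta_d$ be the standard basis vectors and $\mathbb{T}$ the complex unit circle. For $z=(z_1,\dots,z_d)\in\mathbb{T}^d$, the operator $\Delta+V$ preserves the $q=q_1\cdots q_d$-dimensional space of functions $u:\mathbb{Z}^d\to\mathbb{C}$ satisfying $u(n+q_j\delta_j)=z_ju(n)$ for all $n$ and $j$ (such $u$ are determined by their values on $\{0\le n_i<q_i\}$); let $L_V(z)$ be the $q\times q$ matrix of this restriction and $\sigma_V(z)$ its multiset of eigenvalues with algebraic multiplicity. Two $\Lambda$-periodic potentials $V,V'$ are Floquet isospectral if $\sigma_V(z)=\sigma_{V'}(z)$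 for all $z\in\mathbb{T}^d$. *)

theory Defs
  imports "HOL-Analysis.Analysis" "HOL-Computational_Algebra.Polynomial"
    "Jordan_Normal_Form.Char_Poly"
begin

definition lattice_pts :: "nat \<Rightarrow> (nat \<Rightarrow> int) set" where
  "lattice_pts d = {n. \<forall>i\<ge>d. n i = 0}"

definition unit_vec :: "nat \<Rightarrow> nat \<Rightarrow> int" where
  "unit_vec i = (\<lambda>j. if j = i then 1 else 0)"

definition period_lattice :: "nat \<Rightarrow> (nat \<Rightarrow> nat) \<Rightarrow> (nat \<Rightarrow> int) set" where
  "period_lattice d q = {m \<in> lattice_pts d. \<forall>i<d. int (q i) dvd m i}"

definition is_periodic :: "nat \<Rightarrow> (nat \<Rightarrow> nat) \<Rightarrow> ((nat \<Rightarrow> int) \<Rightarrow> complex) \<Rightarrow> bool" where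
  "is_periodic d q V \<longleftrightarrow>
     (\<forall>n \<in> lattice_pts d. \<forall>m \<in> period_lattice d q. V (\<lambda>i. n i + m i) = V n)"

definition disc_laplacian :: "nat \<Rightarrow> ((nat \<Rightarrow> int) \<Rightarrow> complex) \<Rightarrow> (nat \<Rightarrow> int) \<Rightarrow> complex" where
  "disc_laplacian d u n = (\<Sum>i<d. u (\<lambda>j. n j + unit_vec i j) + u (\<lambda>j. n j - unit_vec i j))"

definition num_pts :: "nat \<Rightarrow> (nat \<Rightarrow> nat) \<Rightarrow> nat" where
  "num_pts d q = (\<Prod>i<d. q i)"

text \<open>Enumeration (mixed radix) of the fundamental domain {0 <= n_i < q_i} by 0..<q.\<close>
definition box_pt :: "nat \<Rightarrow> (nat \<Rightarrow> nat) \<Rightarrow> nat \<Rightarrow> nat \<Rightarrow> int" where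
  "box_pt d q k = (\<lambda>i. if i < d then int ((k div (\<Prod>j<i. q j)) mod q i) else 0)"

text \<open>The unique function with u(n + q_j delta_j) = z_j u(n) extending u from the fundamental domain.\<close>
definition floquet_ext :: "nat \<Rightarrow> (nat \<Rightarrow> nat) \<Rightarrow> (nat \<Rightarrow> complex)
    \<Rightarrow> ((nat \<Rightarrow> int) \<Rightarrow> complex) \<Rightarrow> (nat \<Rightarrow> int) \<Rightarrow> complex" where
  "floquet_ext d q z u m =
     (\<Prod>i<d. z i powi (m i div int (q i))) *
       u (\<lambda>i. if i < d then m i mod int (q i) else 0)"

text \<open>Matrix L_V(z) of Delta + V restricted to Floquet functions, in the basis of
  Floquet extensions of indicator functions of the points of the fundamental domain.\<close>
definition floquet_matrix :: "nat \<Rightarrow> (nat \<Rightarrow> nat) \<Rightarrow> ((nat \<Rightarrow> int) \<Rightarrow> complex)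
    \<Rightarrow> (nat \<Rightarrow> complex) \<Rightarrow> complex mat" where
  "floquet_matrix d q V z = mat (num_pts d q) (num_pts d q) (\<lambda>(a, b).
     (let w = floquet_ext d q z (\<lambda>c. if c = box_pt d q b then 1 else 0)
      in disc_laplacian d w (box_pt d q a) + V (box_pt d q a) * w (box_pt d q a)))"

definition floquet_spectrum :: "nat \<Rightarrow> (nat \<Rightarrow> nat) \<Rightarrow> ((nat \<Rightarrow> int) \<Rightarrow> complex)
    \<Rightarrow> (nat \<Rightarrow> complex) \<Rightarrow> complex multiset" where
  "floquet_spectrum d q V z = proots (char_poly (floquet_matrix d q V z))"

definition floquet_isospectral :: "nat \<Rightarrow> (nat \<Rightarrow> nat) \<Rightarrow> ((nat \<Rightarrow> int) \<Rightarrow> complex)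
    \<Rightarrow> ((nat \<Rightarrow> int) \<Rightarrow> complex) \<Rightarrow> bool" where
  "floquet_isospectral d q V V' \<longleftrightarrow>
     (\<forall>z :: nat \<Rightarrow> complex. (\<forall>i<d. cmod (z i) = 1) \<longrightarrow>
        floquet_spectrum d q V z = floquet_spectrum d q V' z)"

end

theory Submission
  imports Defs "HOL-Library.Poly_Mapping" "Jordan_Normal_Form.Schur_Decomposition"
    "HOL-Computational_Algebra.Polynomial_FPS"
begin

text \<open>The spectra of two potentials agree for all quasi-momenta iff the traces of all powers of the Floquet
  matrices agree; after a gauge transformation these are traces of powers of the hopping operator with
  direction weights \<open>w i\<close>, acting on periodic functions.

  If some period \<open>q\<close> exceeds \<open>3\<close>, it suffices to find a potential depending on that coordinate only. In one
  dimension and for odd potentials, only \<open>m = \<lfloor>q/2\<rfloor>\<close> trace equations in \<open>m\<close> unknowns remain. Their leading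
  forms at infinity are the power sums of the squares of the unknowns, so that by a residue argument a certain
  monomial of degree \<open>m^2\<close> is not in the ideal of the equations. Their quadratic parts at the origin are
  combinations of squares of \<open>m\<close> linear coordinates, so if the origin were the only zero, all monomials of
  degree \<open>m + 1\<close> would be in the ideal. Hence there is another zero.

  If all periods are at most \<open>3\<close>, letting a weight tend to infinity shows by induction that the average of
  \<open>V\<close> over each direction vanishes. Directions of period \<open>2\<close> can be switched off by the weight \<open>\<i>\<close>, and
  \<open>V\<close> splits into at most four eigenfunctions of the shifts in the directions of period \<open>3\<close>. The traces of
  degree two in \<open>V\<close> leave only one eigenvalue in some direction, and the traces of the words with six
  factors \<open>V\<close> and at most two hops then force \<open>V = 0\<close>.\<close>


section \<open>Polynomials and ideals\<close>

text \<open>The bound on the period enters through m^2 \<ge> m + 1, that is m \<ge> 2: only then is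
  the monomial excluded by the residue among those that the local argument puts into the ideal.
  Counting zeros would express the same fact, since the origin accounts for 2^m of 2^m m! zeros;
  working with monomials and ideals avoids multiplicities. Power sums have no pure powers as leading
  monomials. Complete homogeneous polynomials in fewer and fewer variables generate the same ideal,
  and slightly unequal weights of the variables give them such leading terms. For periods at most 3
  the degree six is the least common multiple of the orders 2 and 3 of the shift eigenvalues: the
  sixth power of a joint eigenfunction is shift invariant, so it vanishes pointwise as soon as its
  sum does. Smaller even degrees only yield bilinear relations between different
  eigenfunctions.\<close>

type_synonym mpoly = "(nat \<Rightarrow>\<^sub>0 nat) \<Rightarrow>\<^sub>0 complex"

abbreviation mon :: "(nat \<Rightarrow>\<^sub>0 nat) \<Rightarrow> mpoly" where
  "mon a \<equiv> Poly_Mapping.single a 1"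

definition Const :: "complex \<Rightarrow> mpoly" where
  "Const c = Poly_Mapping.single 0 c"

definition Var :: "nat \<Rightarrow> mpoly" where
  "Var i = mon (Poly_Mapping.single i 1)"

lemma Const_simps [simp]:
  "Const 0 = 0" "Const 1 = 1"
  "Const (a + b) = Const a + Const b" "Const (a * b) = Const a * Const b"
  "Const (- a) = - Const a" "Const (a - b) = Const a - Const b"
  "Const (of_nat n) = of_nat n"
  by (simp_all add: Const_def single_add mult_single single_uminus single_diff)

interpretation Const: comm_ring_hom Const
  by unfold_locales simp_all

interpretation Const_poly: map_poly_comm_ring_hom Const ..

lemma Var_power: "Var i ^ n = mon (Poly_Mapping.single i n)"
proof (induction n)
  case 0
  then show ?case by (simp add: single_one)
next
  case (Suc n)
  then show ?case
    by (simp add: Var_def mult_single single_add[symmetric])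
qed

lemma mpoly_decomp:
  fixes f :: mpoly
  assumes "finite S" "Poly_Mapping.keys f \<subseteq> S"
  shows "f = (\<Sum>a\<in>S. Const (Poly_Mapping.lookup f a) * mon a)"
proof (rule poly_mapping_eqI)
  fix k
  have "Poly_Mapping.lookup (\<Sum>a\<in>S. Const (Poly_Mapping.lookup f a) * mon a) k
      = (\<Sum>a\<in>S. Poly_Mapping.lookup f a * (if a = k then 1 else 0))"
    unfolding lookup_sum by (intro sum.cong) (auto simp: Const_def mult_single lookup_single when_def)
  also have "\<dots> = (\<Sum>a\<in>S. if a = k then Poly_Mapping.lookup f a else 0)"
    by (intro sum.cong) auto
  also have "\<dots> = Poly_Mapping.lookup f k"
    using assms by (auto simp: sum.delta in_keys_iff)
  finally show "Poly_Mapping.lookup f k = Poly_Mapping.lookup (\<Sum>a\<in>S. Const (Poly_Mapping.lookup f a) * mon a) k"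
    by simp
qed

lemma lookup_mono_mult: "Poly_Mapping.lookup (mon e * f) (e + a) = Poly_Mapping.lookup (f :: mpoly) a"
proof -
  have "Poly_Mapping.lookup (mon e * f) (e + a)
     = Poly_Mapping.lookup (\<Sum>b\<in>Poly_Mapping.keys f. Const (Poly_Mapping.lookup f b) * mon (e + b)) (e + a)"
    by (subst mpoly_decomp[of "Poly_Mapping.keys f" f])
       (simp_all add: sum_distrib_left mult.left_commute[of "mon e"] mult_single)
  also have "\<dots> = (\<Sum>b\<in>Poly_Mapping.keys f. if b = a then Poly_Mapping.lookup f b else 0)"
    unfolding lookup_sum by (intro sum.cong) (auto simp: Const_def mult_single lookup_single when_def)
  finally show ?thesis by (auto simp: sum.delta in_keys_iff)
qed

lemma lookup_mono_mult_0:
  assumes "\<And>b. k \<noteq> e + b"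
  shows "Poly_Mapping.lookup (mon e * f) k = 0"
proof -
  have "Poly_Mapping.lookup (mon e * f) k
     = Poly_Mapping.lookup (\<Sum>b\<in>Poly_Mapping.keys f. Const (Poly_Mapping.lookup f b) * mon (e + b)) k"
    by (subst mpoly_decomp[of "Poly_Mapping.keys f" f])
       (simp_all add: sum_distrib_left mult.left_commute[of "mon e"] mult_single)
  also have "\<dots> = 0"
    unfolding lookup_sum using assms
    by (intro sum.neutral) (auto simp: Const_def mult_single lookup_single when_def)
  finally show ?thesis .
qed

definition wt :: "(nat \<Rightarrow> nat) \<Rightarrow> (nat \<Rightarrow>\<^sub>0 nat) \<Rightarrow> nat" where
  "wt \<omega> a = (\<Sum>i\<in>Poly_Mapping.keys a. Poly_Mapping.lookup a i * \<omega> i)"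

lemma wt_eq: "finite S \<Longrightarrow> Poly_Mapping.keys a \<subseteq> S \<Longrightarrow>
    wt \<omega> a = (\<Sum>i\<in>S. Poly_Mapping.lookup a i * \<omega> i)"
  unfolding wt_def by (rule sum.mono_neutral_left) (auto simp: in_keys_iff)

lemma wt_add: "wt \<omega> (a + b) = wt \<omega> a + wt \<omega> b"
proof -
  define S where "S = Poly_Mapping.keys a \<union> Poly_Mapping.keys b \<union> Poly_Mapping.keys (a + b)"
  have "finite S" by (simp add: S_def)
  then show ?thesis
    by (subst (1 2 3) wt_eq[of S]) (auto simp: S_def lookup_add sum.distrib algebra_simps)
qed

lemma wt_single [simp]: "wt \<omega> (Poly_Mapping.single i n) = n * \<omega> i"
  by (cases "n = 0") (auto simp: wt_def)

lemma wt_0 [simp]: "wt \<omega> 0 = 0"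
  by (simp add: wt_def)

text \<open>Weighted degree at most \<open>n\<close>; the zero polynomial qualifies for every
  \<open>n\<close>. Strict inequalities are written with a bound reduced by 1, which is why side
  conditions such as \<open>d i * \<omega> i \<ge> 1\<close> appear later.\<close>

definition wle :: "(nat \<Rightarrow> nat) \<Rightarrow> nat \<Rightarrow> mpoly \<Rightarrow> bool" where
  "wle \<omega> n f \<longleftrightarrow> (\<forall>a\<in>Poly_Mapping.keys f. wt \<omega> a \<le> n)"

lemma wle_mono: "wle \<omega> n f \<Longrightarrow> n \<le> k \<Longrightarrow> wle \<omega> k f"
  by (force simp: wle_def)

lemma wle_add: "wle \<omega> n f \<Longrightarrow> wle \<omega> n g \<Longrightarrow> wle \<omega> n (f + g)"
  using keys_add[of f g] by (auto simp: wle_def)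

lemma wle_0 [simp]: "wle \<omega> n 0"
  by (simp add: wle_def)

lemma wle_uminus: "wle \<omega> n f \<Longrightarrow> wle \<omega> n (- f)"
  by (auto simp: wle_def in_keys_iff)

lemma wle_diff: "wle \<omega> n f \<Longrightarrow> wle \<omega> n g \<Longrightarrow> wle \<omega> n (f - g)"
  using wle_add[of \<omega> n f "- g"] wle_uminus by auto

lemma wle_mult: "wle \<omega> n f \<Longrightarrow> wle \<omega> k g \<Longrightarrow> wle \<omega> (n + k) (f * g)"
  using keys_mult[of f g] by (fastforce simp: wle_def wt_add intro: add_mono)

lemma wle_sum: "(\<And>i. i \<in> S \<Longrightarrow> wle \<omega> n (f i)) \<Longrightarrow> wle \<omega> n (sum f S)"
  by (induction S rule: infinite_finite_induct) (auto intro: wle_add)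

lemma wle_Const [simp]: "wle \<omega> n (Const c)"
  by (cases "c = 0") (auto simp: wle_def Const_def)

lemma wle_1 [simp]: "wle \<omega> n 1"
  using wle_Const[of \<omega> n 1] by simp

lemma wle_mono_single: "wt \<omega> a \<le> n \<Longrightarrow> wle \<omega> n (mon a)"
  by (auto simp: wle_def)

lemma wle_Var: "\<omega> i \<le> n \<Longrightarrow> wle \<omega> n (Var i)"
  by (auto simp: wle_def Var_def)

lemma wle_power: "wle \<omega> n f \<Longrightarrow> wle \<omega> (k * n) (f ^ k)"
  by (induction k) (auto intro: wle_mult)

lemma wle_prod: "(\<And>i. i \<in> S \<Longrightarrow> wle \<omega> (n i) (f i)) \<Longrightarrow> wle \<omega> (sum n S) (prod f S)"
  by (induction S rule: infinite_finite_induct) (auto intro: wle_mult)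

lemma lookup_wle: "wle \<omega> n f \<Longrightarrow> n < wt \<omega> a \<Longrightarrow> Poly_Mapping.lookup f a = 0"
  by (force simp: wle_def in_keys_iff)

section \<open>Ideals, their sums and their powers\<close>

definition is_ideal :: "'a::comm_ring_1 set \<Rightarrow> bool" where
  "is_ideal J \<longleftrightarrow> 0 \<in> J \<and> (\<forall>x\<in>J. \<forall>y\<in>J. x + y \<in> J) \<and> (\<forall>x\<in>J. \<forall>r. r * x \<in> J)"

lemma is_idealD:
  assumes "is_ideal J"
  shows "0 \<in> J" "x \<in> J \<Longrightarrow> y \<in> J \<Longrightarrow> x + y \<in> J" "x \<in> J \<Longrightarrow> r * x \<in> J" "x \<in> J \<Longrightarrow> x * r \<in> J"
    "x \<in> J \<Longrightarrow> - x \<in> J" "x \<in> J \<Longrightarrow> y \<in> J \<Longrightarrow> x - y \<in> J"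
proof -
  show g: "0 \<in> J" "x \<in> J \<Longrightarrow> y \<in> J \<Longrightarrow> x + y \<in> J" and m: "x \<in> J \<Longrightarrow> r * x \<in> J"
    for x y r using assms by (auto simp: is_ideal_def)
  show "x \<in> J \<Longrightarrow> x * r \<in> J" using m[of x r] by (simp add: mult.commute)
  show n: "x \<in> J \<Longrightarrow> - x \<in> J" for x using m[of x "-1"] by simp
  show "x \<in> J \<Longrightarrow> y \<in> J \<Longrightarrow> x - y \<in> J" using g(2)[of x "-y"] n by simp
qed

lemma is_ideal_sum: "is_ideal J \<Longrightarrow> (\<And>i. i \<in> S \<Longrightarrow> f i \<in> J) \<Longrightarrow> sum f S \<in> J"
  by (induction S rule: infinite_finite_induct) (auto simp: is_idealD)

lemma is_ideal_UNIV [simp]: "is_ideal UNIV"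
  by (simp add: is_ideal_def)

definition gen_ideal :: "nat \<Rightarrow> (nat \<Rightarrow> 'a::comm_ring_1) \<Rightarrow> 'a set" where
  "gen_ideal m g = {f. \<exists>h. f = (\<Sum>i<m. h i * g i)}"

lemma is_ideal_gen [simp]: "is_ideal (gen_ideal m g)"
  unfolding is_ideal_def
proof (intro conjI ballI allI)
  show "0 \<in> gen_ideal m g" by (auto simp: gen_ideal_def intro!: exI[of _ "\<lambda>_. 0"])
next
  fix x y assume "x \<in> gen_ideal m g" "y \<in> gen_ideal m g"
  then obtain h k where "x = (\<Sum>i<m. h i * g i)" "y = (\<Sum>i<m. k i * g i)"
    by (auto simp: gen_ideal_def)
  then have "x + y = (\<Sum>i<m. (h i + k i) * g i)" by (simp add: sum.distrib distrib_right)
  then show "x + y \<in> gen_ideal m g" by (auto simp: gen_ideal_def intro!: exI[of _ "\<lambda>i. h i + k i"])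
next
  fix x r assume "x \<in> gen_ideal m g"
  then obtain h where "x = (\<Sum>i<m. h i * g i)" by (auto simp: gen_ideal_def)
  then have "r * x = (\<Sum>i<m. (r * h i) * g i)" by (simp add: sum_distrib_left mult.assoc)
  then show "r * x \<in> gen_ideal m g" by (auto simp: gen_ideal_def intro!: exI[of _ "\<lambda>i. r * h i"])
qed

lemma gen_ideal_base: "i < m \<Longrightarrow> g i \<in> gen_ideal m g"
  unfolding gen_ideal_def
  by (auto intro!: exI[of _ "\<lambda>j. if j = i then 1 else 0"] simp: if_distrib[of "\<lambda>x. x * _"] cong: if_cong)

lemma gen_ideal_least: "is_ideal J \<Longrightarrow> (\<And>i. i < m \<Longrightarrow> g i \<in> J) \<Longrightarrow> gen_ideal m g \<subseteq> J"
  unfolding gen_ideal_def by (auto intro!: is_ideal_sum is_idealD(3))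

definition ideal_plus :: "'a::comm_ring_1 set \<Rightarrow> 'a set \<Rightarrow> 'a set" where
  "ideal_plus I J = {x + y | x y. x \<in> I \<and> y \<in> J}"

lemma is_ideal_plus [intro]:
  assumes "is_ideal I" "is_ideal J"
  shows "is_ideal (ideal_plus I J)"
  unfolding is_ideal_def
proof (intro conjI ballI allI)
  show "0 \<in> ideal_plus I J"
    using is_idealD(1)[OF assms(1)] is_idealD(1)[OF assms(2)] by (force simp: ideal_plus_def)
next
  fix x y assume "x \<in> ideal_plus I J" "y \<in> ideal_plus I J"
  then obtain a b c d where *: "x = a + b" "y = c + d" "a \<in> I" "c \<in> I" "b \<in> J" "d \<in> J"
    by (auto simp: ideal_plus_def)
  have "x + y = (a + c) + (b + d)" using * by simp
  then show "x + y \<in> ideal_plus I J"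
    using * is_idealD(2)[OF assms(1)] is_idealD(2)[OF assms(2)] unfolding ideal_plus_def by blast
next
  fix x r assume "x \<in> ideal_plus I J"
  then obtain a b where *: "x = a + b" "a \<in> I" "b \<in> J" by (auto simp: ideal_plus_def)
  then have "r * x = r * a + r * b" "r * a \<in> I" "r * b \<in> J"
    using is_idealD(3)[OF assms(1)] is_idealD(3)[OF assms(2)] by (auto simp: distrib_left)
  then show "r * x \<in> ideal_plus I J" unfolding ideal_plus_def by blast
qed

lemma ideal_plus_left: "is_ideal J \<Longrightarrow> x \<in> I \<Longrightarrow> x \<in> ideal_plus I J"
  unfolding ideal_plus_def using is_idealD(1) by force

lemma ideal_plus_right: "is_ideal I \<Longrightarrow> x \<in> J \<Longrightarrow> x \<in> ideal_plus I J"
  unfolding ideal_plus_def using is_idealD(1) by force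

lemma ideal_plus_least: "is_ideal K \<Longrightarrow> I \<subseteq> K \<Longrightarrow> J \<subseteq> K \<Longrightarrow> ideal_plus I J \<subseteq> K"
  unfolding ideal_plus_def by (auto intro!: is_idealD(2))

lemma is_ideal_vimage: "is_ideal Q \<Longrightarrow> is_ideal {g. l * g \<in> Q}"
  by (auto simp: is_ideal_def distrib_left mult.left_commute)

text \<open>The \<open>d\<close>-th power of the ideal generated by \<open>g 0\<close>, ...,
  \<open>g (m - 1)\<close>, with one generator split off per step. For \<open>g = Var\<close> it
  consists of the polynomials all of whose monomials have degree at least \<open>d\<close> in the
  first \<open>m\<close> variables.\<close>

fun ideal_pow :: "nat \<Rightarrow> (nat \<Rightarrow> 'a::comm_ring_1) \<Rightarrow> nat \<Rightarrow> 'a set" where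
  "ideal_pow m g 0 = UNIV"
| "ideal_pow m g (Suc d) = {f. \<exists>h. (\<forall>i<m. h i \<in> ideal_pow m g d) \<and> f = (\<Sum>i<m. g i * h i)}"

lemma is_ideal_pow [simp]: "is_ideal (ideal_pow m g d)"
proof (induction d)
  case (Suc d)
  note D = is_idealD[OF Suc.IH]
  show ?case unfolding is_ideal_def
  proof (intro conjI ballI allI)
    show "0 \<in> ideal_pow m g (Suc d)" using D(1) by (auto intro!: exI[of _ "\<lambda>_. 0"])
  next
    fix x y assume "x \<in> ideal_pow m g (Suc d)" "y \<in> ideal_pow m g (Suc d)"
    then obtain h k where "\<forall>i<m. h i \<in> ideal_pow m g d" "\<forall>i<m. k i \<in> ideal_pow m g d"
      "x = (\<Sum>i<m. g i * h i)" "y = (\<Sum>i<m. g i * k i)" by auto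
    then show "x + y \<in> ideal_pow m g (Suc d)"
      using D(2) by (auto intro!: exI[of _ "\<lambda>i. h i + k i"] simp: sum.distrib distrib_left)
  next
    fix x r assume "x \<in> ideal_pow m g (Suc d)"
    then obtain h where "\<forall>i<m. h i \<in> ideal_pow m g d" "x = (\<Sum>i<m. g i * h i)" by auto
    then show "r * x \<in> ideal_pow m g (Suc d)"
      using D(3) by (auto intro!: exI[of _ "\<lambda>i. r * h i"] simp: sum_distrib_left mult.left_commute)
  qed
qed simp

lemma ideal_pow_SucI: "i < m \<Longrightarrow> f \<in> ideal_pow m g d \<Longrightarrow> g i * f \<in> ideal_pow m g (Suc d)"
  using is_idealD(1)[OF is_ideal_pow]
  by (auto intro!: exI[of _ "\<lambda>j. if j = i then f else 0"] simp: if_distrib cong: if_cong)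

text \<open>The induction varies \<open>Q\<close>: splitting off a generator \<open>g i\<close>
  replaces \<open>Q\<close> by the colon ideal of all \<open>x\<close> with
  \<open>g i * x \<in> Q\<close>, which is again an ideal.\<close>

lemma ideal_pow_least:
  "is_ideal Q \<Longrightarrow> (\<And>xs. length xs = d \<Longrightarrow> set xs \<subseteq> {..<m} \<Longrightarrow> prod_list (map g xs) \<in> Q)
    \<Longrightarrow> ideal_pow m g d \<subseteq> Q"
proof (induction d arbitrary: Q)
  case 0
  have "prod_list (map g []) \<in> Q" using 0(2)[of "[]"] by simp
  then have "1 \<in> Q" by simp
  then show ?case using is_idealD(3)[OF 0(1), of 1] by auto
next
  case (Suc d)
  show ?case
  proof
    fix f assume "f \<in> ideal_pow m g (Suc d)"
    then obtain h where h: "\<forall>i<m. h i \<in> ideal_pow m g d" "f = (\<Sum>i<m. g i * h i)" by auto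
    have "g i * h i \<in> Q" if "i < m" for i
    proof -
      have "ideal_pow m g d \<subseteq> {x. g i * x \<in> Q}"
      proof (rule Suc.IH)
        show "is_ideal {x. g i * x \<in> Q}" by (rule is_ideal_vimage) fact
        fix xs :: "nat list" assume "length xs = d" "set xs \<subseteq> {..<m}"
        then show "prod_list (map g xs) \<in> {x. g i * x \<in> Q}"
          using Suc.prems(2)[of "i # xs"] that by simp
      qed
      then show ?thesis using h that by auto
    qed
    then show "f \<in> Q" unfolding h by (intro is_ideal_sum Suc.prems) auto
  qed
qed

lemma prod_list_ideal_pow:
  "(\<And>x. x \<in> set xs \<Longrightarrow> x \<in> ideal_pow m g 1) \<Longrightarrow> prod_list xs \<in> ideal_pow m g (length xs)"
proof (induction xs)
  case (Cons x xs)
  obtain h where h: "x = (\<Sum>i<m. g i * h i)" using Cons.prems[of x] by auto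
  have "x * prod_list xs = (\<Sum>i<m. h i * (g i * prod_list xs))"
    by (simp add: h sum_distrib_right) (simp add: mult_ac)
  also have "\<dots> \<in> ideal_pow m g (Suc (length xs))"
    using Cons by (intro is_ideal_sum is_idealD(3) ideal_pow_SucI is_ideal_pow) auto
  finally show ?case by simp
qed simp

lemma ideal_pow_subset:
  assumes "\<And>i. i < m \<Longrightarrow> g i \<in> ideal_pow n h 1"
  shows "ideal_pow m g d \<subseteq> ideal_pow n h d"
proof (rule ideal_pow_least)
  fix xs assume "length xs = d" "set xs \<subseteq> {..<m}"
  then show "prod_list (map g xs) \<in> ideal_pow n h d"
    using prod_list_ideal_pow[of "map g xs" n h] assms by force
qed simp

lemma ideal_pow_Suc_subset: "ideal_pow m g (Suc d) \<subseteq> ideal_pow m g d"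
  by (auto intro!: is_ideal_sum is_idealD(3))

lemma ideal_pow_antimono: "d \<le> e \<Longrightarrow> ideal_pow m g e \<subseteq> ideal_pow m g d"
  by (induction e rule: dec_induct) (use ideal_pow_Suc_subset in blast)+

lemma ideal_pow_mult:
  "x \<in> ideal_pow m g a \<Longrightarrow> y \<in> ideal_pow m g b \<Longrightarrow> x * y \<in> ideal_pow m g (a + b)"
proof (induction a arbitrary: x)
  case 0
  then show ?case by (simp add: is_idealD(3)[OF is_ideal_pow])
next
  case (Suc a)
  then obtain h where h: "\<forall>i<m. h i \<in> ideal_pow m g a" "x = (\<Sum>i<m. g i * h i)" by auto
  have "x * y = (\<Sum>i<m. g i * (h i * y))" by (simp add: h sum_distrib_right) (simp add: mult_ac)
  also have "\<dots> \<in> ideal_pow m g (Suc (a + b))"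
    using h Suc by (intro is_ideal_sum ideal_pow_SucI is_ideal_pow) auto
  finally show ?case by simp
qed

text \<open>Pigeonhole: a product of \<open>m * N\<close> generators contains one of the
  \<open>m\<close> generators at least \<open>N\<close> times.\<close>

lemma ideal_pow_nilpotent:
  assumes I: "is_ideal I" and nil: "\<And>i. i < m \<Longrightarrow> g i ^ N \<in> I" "N \<ge> 1" "m > 0"
  shows "ideal_pow m g (m * N) \<subseteq> I"
proof (rule ideal_pow_least[OF I])
  fix xs assume xs: "length xs = m * N" "set xs \<subseteq> {..<m}"
  show "prod_list (map g xs) \<in> I"
  proof -
    have False: "m \<noteq> 0" using nil by simp
    have "\<exists>i<m. count_list xs i \<ge> N"
    proof (rule ccontr)
      assume "\<not> ?thesis"
      then have "(\<Sum>i<m. count_list xs i) < (\<Sum>i<m. N)"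
        using False by (intro sum_strict_mono) auto
      moreover have "(\<Sum>i<m. count_list xs i) = length xs"
        using xs(2) by (subst sum_count_set) auto
      ultimately show False using xs by simp
    qed
    then obtain i where i: "i < m" "count_list xs i \<ge> N" by blast
    have dec: "prod_list (map g ys) = g i ^ count_list ys i * prod_list (map g (filter (\<lambda>j. j \<noteq> i) ys))" for ys
      by (induction ys) (auto simp: algebra_simps)
    have "g i ^ count_list xs i = g i ^ (count_list xs i - N) * g i ^ N"
      using i by (simp flip: power_add)
    then have "prod_list (map g xs)
        = (g i ^ (count_list xs i - N) * prod_list (map g (filter (\<lambda>j. j \<noteq> i) xs))) * g i ^ N"
      using dec[of xs] by (simp add: mult_ac)
    then show ?thesis using nil(1)[OF i(1)] is_idealD(3)[OF I] by metis
  qed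
qed

text \<open>A product of more than \<open>m\<close> of the \<open>l i\<close> repeats a factor, and
  modulo \<open>I\<close> the square of that factor can be traded for terms of order 3. So each
  order above \<open>m\<close> is contained in the next one modulo \<open>I\<close>, and this can be
  iterated to any order \<open>e\<close>.\<close>

lemma ideal_pow_collapse:
  assumes I: "is_ideal I" and sq: "\<And>i. i < m \<Longrightarrow> l i * l i \<in> ideal_plus I (ideal_pow m l 3)"
    and "d > m" "e \<ge> d"
  shows "ideal_pow m l d \<subseteq> ideal_plus I (ideal_pow m l e)"
proof -
  have base: "ideal_pow m l (Suc m) \<subseteq> ideal_plus I (ideal_pow m l (Suc (Suc m)))" (is "_ \<subseteq> ?Q")
  proof (rule ideal_pow_least)
    show Q: "is_ideal ?Q" using I by (intro is_ideal_plus is_ideal_pow)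
    fix xs assume xs: "length xs = Suc m" "set xs \<subseteq> {..<m}"
    have "\<not> distinct xs"
    proof
      assume "distinct xs"
      then have "card (set xs) = Suc m" using xs by (simp add: distinct_card)
      moreover have "card (set xs) \<le> card {..<m}" using xs by (intro card_mono) auto
      ultimately show False by simp
    qed
    then obtain as bs cs i where dec: "xs = as @ [i] @ bs @ [i] @ cs" using not_distinct_decomp by blast
    define r where "r = prod_list (map l (as @ bs @ cs))"
    have im: "i < m" using xs dec by auto
    have r: "r \<in> ideal_pow m l (length (map l (as @ bs @ cs)))" unfolding r_def
    proof (rule prod_list_ideal_pow)
      fix x assume "x \<in> set (map l (as @ bs @ cs))"
      then obtain j where "j < m" "x = l j" using xs dec by auto
      then show "x \<in> ideal_pow m l 1" using ideal_pow_SucI[of j m 1 l 0] by simp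
    qed
    have e: "prod_list (map l xs) = r * (l i * l i)" by (simp add: dec r_def mult_ac)
    obtain u v where uv: "l i * l i = u + v" "u \<in> I" "v \<in> ideal_pow m l 3"
      using sq[OF im] by (auto simp: ideal_plus_def)
    have "r * v \<in> ideal_pow m l (length (map l (as @ bs @ cs)) + 3)"
      using r uv(3) by (rule ideal_pow_mult)
    moreover have "length (map l (as @ bs @ cs)) + 3 = Suc (Suc m)" using xs dec by simp
    ultimately have "r * v \<in> ideal_pow m l (Suc (Suc m))" by (simp only:)
    moreover have "r * u \<in> I" using uv I is_idealD(3) by blast
    ultimately show "prod_list (map l xs) \<in> ?Q"
      unfolding e uv(1) distrib_left by (auto simp: ideal_plus_def)
  qed
  have one: "ideal_pow m l d \<subseteq> ideal_plus I (ideal_pow m l (Suc d))" if "d > m" for d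
  proof -
    from that have "Suc m \<le> d" by simp
    then show ?thesis
    proof (induction d rule: dec_induct)
      case base
      then show ?case using \<open>ideal_pow m l (Suc m) \<subseteq> _\<close> by simp
    next
      case (step d)
      show ?case
      proof
        fix f assume "f \<in> ideal_pow m l (Suc d)"
        then obtain h where h: "\<forall>i<m. h i \<in> ideal_pow m l d" "f = (\<Sum>i<m. l i * h i)" by auto
        have "l i * h i \<in> ideal_plus I (ideal_pow m l (Suc (Suc d)))" if im: "i < m" for i
        proof -
          have "h i \<in> ideal_plus I (ideal_pow m l (Suc d))" using h(1) step.IH im by blast
          then obtain u v where uv: "h i = u + v" "u \<in> I" "v \<in> ideal_pow m l (Suc d)"
            unfolding ideal_plus_def by blast
          have "l i * v \<in> ideal_pow m l (Suc (Suc d))" using im uv(3) by (rule ideal_pow_SucI)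
          moreover have "l i * u \<in> I" using uv I is_idealD(3) by blast
          ultimately show ?thesis unfolding uv(1) distrib_left by (auto simp: ideal_plus_def)
        qed
        then show "f \<in> ideal_plus I (ideal_pow m l (Suc (Suc d)))"
          unfolding h using I by (intro is_ideal_sum is_ideal_plus is_ideal_pow) auto
      qed
    qed
  qed
  from \<open>e \<ge> d\<close> show ?thesis
  proof (induction e rule: dec_induct)
    case base
    then show ?case using I by (auto intro: ideal_plus_right)
  next
    case (step e)
    have "ideal_plus I (ideal_pow m l e) \<subseteq> ideal_plus I (ideal_pow m l (Suc e))"
    proof (rule ideal_plus_least)
      show "is_ideal (ideal_plus I (ideal_pow m l (Suc e)))" using I by (rule is_ideal_plus) (rule is_ideal_pow)
      show "I \<subseteq> ideal_plus I (ideal_pow m l (Suc e))" by (intro subsetI ideal_plus_left is_ideal_pow)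
      show "ideal_pow m l e \<subseteq> ideal_plus I (ideal_pow m l (Suc e))"
        using \<open>d > m\<close> step by (intro one) simp
    qed
    then show ?case using step by blast
  qed
qed

section \<open>A residue and the zeros of a polynomial system\<close>

text \<open>Expanding \<open>1 / (Var i ^ d i + \<rho> i)\<close> gives the terms
  \<open>(- \<rho> i) ^ j / Var i ^ (d i * (j + 1))\<close>. The coefficient of
  \<open>Var i ^ -1\<close> after multiplication by a polynomial is therefore read off at the
  exponent \<open>d i * (j + 1) - 1\<close>.\<close>

definition target :: "nat \<Rightarrow> (nat \<Rightarrow> nat) \<Rightarrow> (nat \<Rightarrow> nat) \<Rightarrow> (nat \<Rightarrow>\<^sub>0 nat)" where
  "target m d j = (\<Sum>i<m. Poly_Mapping.single i (d i * Suc (j i) - 1))"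

lemma lookup_target: "Poly_Mapping.lookup (target m d j) i = (if i < m then d i * Suc (j i) - 1 else 0)"
proof -
  have "Poly_Mapping.lookup (target m d j) i = (\<Sum>k<m. if k = i then d i * Suc (j i) - 1 else 0)"
    unfolding target_def lookup_sum by (intro sum.cong) (auto simp: lookup_single when_def)
  then show ?thesis by simp
qed

lemma wt_sum: "wt \<omega> (\<Sum>i\<in>S. f i) = (\<Sum>i\<in>S. wt \<omega> (f i))"
  by (induction S rule: infinite_finite_induct) (simp_all add: wt_add)

lemma target_shift:
  assumes "i < m" "d i \<ge> 1"
  shows "target m d (j(i := Suc (j i))) = Poly_Mapping.single i (d i) + target m d j"
  using assms by (intro poly_mapping_eqI) (auto simp: lookup_target lookup_add lookup_single when_def)

text \<open>If \<open>g i = Var i ^ d i + \<rho> i\<close> has leading term \<open>Var i ^ d i\<close>, then \<open>\<phi>\<close> below is the coefficient of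
  \<open>\<Prod>Var i ^ -1\<close> in the Laurent expansion of \<open>f / \<Prod>g i\<close> in which each \<open>1 / g i\<close> is expanded around its
  leading term (truncated at order \<open>N\<close>). On \<open>f = h * g i\<close> the factor \<open>g i\<close> cancels, and no negative
  power of \<open>Var i\<close> is left.\<close>

lemma top_monomial_notin_gen_ideal:
  fixes \<rho> :: "nat \<Rightarrow> mpoly"
  assumes d: "\<And>i. i < m \<Longrightarrow> d i \<ge> 1" and \<omega>: "\<And>i. i < m \<Longrightarrow> \<omega> i \<ge> 1"
    and \<rho>: "\<And>i. i < m \<Longrightarrow> wle \<omega> (d i * \<omega> i - 1) (\<rho> i)"
  shows "mon (\<Sum>i<m. Poly_Mapping.single i (d i - 1)) \<notin> gen_ideal m (\<lambda>i. Var i ^ d i + \<rho> i)"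
proof
  define top where "top = (\<Sum>i<m. Poly_Mapping.single i (d i - 1))"
  assume "mon (\<Sum>i<m. Poly_Mapping.single i (d i - 1)) \<in> gen_ideal m (\<lambda>i. Var i ^ d i + \<rho> i)"
  then obtain h where h: "mon top = (\<Sum>i<m. h i * (Var i ^ d i + \<rho> i))"
    by (auto simp: gen_ideal_def top_def)
  have "\<exists>w. \<forall>i<m. wle \<omega> w (h i)"
  proof -
    have "\<exists>w. wle \<omega> w (h i)" for i
      by (intro exI[of _ "\<Sum>a\<in>Poly_Mapping.keys (h i). wt \<omega> a"])
         (auto simp: wle_def intro: member_le_sum)
    then obtain w where "\<And>i. wle \<omega> (w i) (h i)" by metis
    then have "\<forall>i<m. wle \<omega> (sum w {..<m}) (h i)"
      by (auto intro: wle_mono member_le_sum)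
    then show ?thesis ..
  qed
  then obtain w where w: "\<And>i. i < m \<Longrightarrow> wle \<omega> w (h i)" by blast
  \<comment> \<open>Truncation order: each factor \<open>- \<rho> i\<close> loses at least 1 in
    weight against the target, so with more than \<open>W\<close> such factors the product with
    \<open>h i * Var i ^ d i\<close> can no longer reach it.\<close>
  define W where "W = w + (\<Sum>i<m. d i * \<omega> i)"
  define N where "N = W"
  define R where "R j = (\<Prod>i<m. (- \<rho> i) ^ j i)" for j
  define S where "S = {j. (\<forall>i<m. j i \<le> N) \<and> (\<forall>i\<ge>m. j i = 0)}"
  define \<phi> where "\<phi> f = (\<Sum>j\<in>S. Poly_Mapping.lookup (f * R j) (target m d j))" for f
  have "S \<subseteq> (\<lambda>f i. if i < m then f i else 0) ` (PiE {..<m} (\<lambda>_. {..N}))"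
  proof
    fix j assume "j \<in> S"
    then show "j \<in> (\<lambda>f i. if i < m then f i else 0) ` (PiE {..<m} (\<lambda>_. {..N}))"
      by (intro image_eqI[of _ _ "restrict j {..<m}"]) (auto simp: S_def)
  qed
  then have finS: "finite S" by (rule finite_subset) (auto intro!: finite_imageI finite_PiE)
  have wR: "wle \<omega> (\<Sum>i<m. j i * (d i * \<omega> i - 1)) (R j)" for j
    unfolding R_def using \<rho> by (intro wle_prod wle_power wle_uminus) auto
  have wt_target: "wt \<omega> (target m d j) = (\<Sum>i<m. (d i - 1) * \<omega> i) + (\<Sum>i<m. j i * (d i * \<omega> i))" for j
  proof -
    have "wt \<omega> (target m d j) = (\<Sum>i<m. (d i - 1) * \<omega> i + j i * (d i * \<omega> i))"
      unfolding target_def wt_sum wt_single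
    proof (intro sum.cong refl)
      fix i assume "i \<in> {..<m}"
      then obtain e where "d i = Suc e" using d[of i] by (cases "d i") auto
      then show "(d i * Suc (j i) - 1) * \<omega> i = (d i - 1) * \<omega> i + j i * (d i * \<omega> i)"
        by (simp add: algebra_simps)
    qed
    then show ?thesis by (simp add: sum.distrib)
  qed
  have split: "(\<Sum>i<m. j i * (d i * \<omega> i)) = (\<Sum>i<m. j i * (d i * \<omega> i - 1)) + (\<Sum>i<m. j i)" for j
  proof -
    have "j i * (d i * \<omega> i) = j i * (d i * \<omega> i - 1) + j i" if "i < m" for i
    proof -
      have "d i * \<omega> i \<ge> 1" using d[OF that] \<omega>[OF that] by (simp add: Suc_le_eq)
      then obtain e where "d i * \<omega> i = Suc e" by (cases "d i * \<omega> i") auto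
      then show ?thesis by simp
    qed
    then have "(\<Sum>i<m. j i * (d i * \<omega> i)) = (\<Sum>i<m. j i * (d i * \<omega> i - 1) + j i)"
      by (intro sum.cong) auto
    then show ?thesis by (simp only: sum.distrib)
  qed
  have phi_sum: "\<phi> (sum f A) = (\<Sum>x\<in>A. \<phi> (f x))" for f and A :: "nat set"
    unfolding \<phi>_def sum_distrib_right lookup_sum by (rule sum.swap)
  \<comment> \<open>Only the zero index contributes: for every other \<open>j\<close> the weight of
    \<open>mon top * R j\<close> stays below that of the target.\<close>
  have "\<phi> (mon top) = (\<Sum>j\<in>S. if j = (\<lambda>_. 0) then 1 else 0)"
    unfolding \<phi>_def
  proof (intro sum.cong refl)
    fix j assume j: "j \<in> S"
    show "Poly_Mapping.lookup (mon top * R j) (target m d j) = (if j = (\<lambda>_. 0) then 1 else 0)"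
    proof (cases "j = (\<lambda>_. 0)")
      case True
      have "target m d j = top" by (simp add: True target_def top_def)
      then show ?thesis using True by (simp add: R_def)
    next
      case False
      then obtain i where "j i \<noteq> 0" by auto
      then have "i < m" using j by (cases "i < m") (auto simp: S_def)
      then have "(\<Sum>i<m. j i) > 0" using \<open>j i \<noteq> 0\<close> by (simp add: sum_pos2)
      moreover have "wt \<omega> top = (\<Sum>i<m. (d i - 1) * \<omega> i)"
        unfolding top_def wt_sum by simp
      ultimately show ?thesis
        using False wle_mult[OF wle_mono_single[of \<omega> top "wt \<omega> top"] wR[of j]]
        by (auto intro!: lookup_wle simp: wt_target split)
    qed
  qed
  also have "\<dots> = 1"
    using finS by (simp add: S_def)
  finally have one: "\<phi> (mon top) = 1" .
  have zero: "\<phi> (h i * (Var i ^ d i + \<rho> i)) = 0" if i: "i < m" for i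
  proof -
    define A where "A j = Poly_Mapping.lookup (h i * Var i ^ d i * R j) (target m d j)" for j
    define up where "up j = j(i := Suc (j i))" for j :: "nat \<Rightarrow> nat"
    have inj: "inj up"
    proof (rule injI)
      fix j k assume eq: "up j = up k"
      show "j = k"
      proof
        fix x show "j x = k x" using fun_cong[OF eq, of x] by (auto simp: up_def split: if_splits)
      qed
    qed
    have Rup: "R (up j) = - \<rho> i * R j" for j
    proof -
      have "R (up j) = (- \<rho> i) ^ Suc (j i) * (\<Prod>k\<in>{..<m}-{i}. (- \<rho> k) ^ j k)"
        unfolding R_def up_def using i by (subst prod.remove[of _ i]) (auto intro!: prod.cong arg_cong2[of _ _ _ _ "(*)"])
      moreover have "R j = (- \<rho> i) ^ j i * (\<Prod>k\<in>{..<m}-{i}. (- \<rho> k) ^ j k)"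
        unfolding R_def using i by (subst prod.remove[of _ i]) auto
      ultimately show ?thesis by simp
    qed
    have tup: "target m d (up j) = Poly_Mapping.single i (d i) + target m d j" for j
      unfolding up_def by (rule target_shift) (use i d in auto)
    have Aup: "Poly_Mapping.lookup (h i * \<rho> i * R j) (target m d j) = - A (up j)" for j
    proof -
      have "h i * Var i ^ d i * R (up j) = mon (Poly_Mapping.single i (d i)) * (- (h i * \<rho> i * R j))"
        by (simp add: Rup Var_power mult_ac)
      then show ?thesis unfolding A_def by (simp add: tup lookup_mono_mult)
    qed
    have A0: "A j = 0" if "j i = 0" for j
    proof -
      have "A j = Poly_Mapping.lookup (mon (Poly_Mapping.single i (d i)) * (h i * R j)) (target m d j)"
        by (simp add: A_def Var_power mult_ac)
      also have "\<dots> = 0"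
      proof (rule lookup_mono_mult_0)
        fix b show "target m d j \<noteq> Poly_Mapping.single i (d i) + b"
        proof
          assume "target m d j = Poly_Mapping.single i (d i) + b"
          then have "Poly_Mapping.lookup (target m d j) i = Poly_Mapping.lookup (Poly_Mapping.single i (d i) + b) i"
            by simp
          then have "d i - 1 = d i + Poly_Mapping.lookup b i"
            using i \<open>j i = 0\<close> by (simp add: lookup_target lookup_add)
          then show False using d[OF i] by simp
        qed
      qed
      finally show ?thesis .
    qed
    have AN: "A j = 0" if "j i = Suc N" for j
      unfolding A_def
    proof (rule lookup_wle)
      have "wle \<omega> (d i * \<omega> i) (Var i ^ d i)" by (intro wle_power wle_Var) simp
      then have "wle \<omega> (w + d i * \<omega> i + (\<Sum>i<m. j i * (d i * \<omega> i - 1))) (h i * Var i ^ d i * R j)"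
        using w[OF i] wR by (intro wle_mult)
      then show "wle \<omega> (W + (\<Sum>i<m. j i * (d i * \<omega> i - 1))) (h i * Var i ^ d i * R j)"
        by (rule wle_mono) (use i in \<open>auto simp: W_def intro: member_le_sum\<close>)
      have "j i \<le> (\<Sum>i<m. j i)" using i by (intro member_le_sum) auto
      then show "W + (\<Sum>i<m. j i * (d i * \<omega> i - 1)) < wt \<omega> (target m d j)"
        using that by (simp add: wt_target split N_def)
    qed
    \<comment> \<open>The sum telescopes in \<open>j i\<close>. Its lower end \<open>j i = 0\<close>
      vanishes because \<open>Var i ^ d i\<close> does not divide the target monomial, and its upper
      end \<open>j i = N + 1\<close> vanishes by weight.\<close>
    have "\<phi> (h i * (Var i ^ d i + \<rho> i)) = (\<Sum>j\<in>S. A j) - (\<Sum>j\<in>S. A (up j))"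
      unfolding \<phi>_def by (simp add: distrib_left distrib_right lookup_add Aup A_def sum.distrib sum_negf sum_subtractf)
    also have "(\<Sum>j\<in>S. A (up j)) = (\<Sum>j\<in>up ` S. A j)"
      using inj by (subst sum.reindex) (auto intro: inj_on_subset)
    also have "\<dots> = (\<Sum>j\<in>S \<inter> up ` S. A j)"
    proof (rule sum.mono_neutral_right)
      show "\<forall>j\<in>up ` S - S \<inter> up ` S. A j = 0"
      proof
        fix j assume "j \<in> up ` S - S \<inter> up ` S"
        then obtain k where "k \<in> S" "j = up k" "up k \<notin> S" by auto
        then have "k i \<le> N" "\<not> Suc (k i) \<le> N" using i by (auto simp: S_def up_def split: if_splits)
        then have "j i = Suc N" using \<open>j = up k\<close> by (simp add: up_def)
        then show "A j = 0" by (rule AN)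
      qed
    qed (use finS in auto)
    also have "\<dots> = (\<Sum>j\<in>S. A j)"
    proof (rule sum.mono_neutral_left)
      show "\<forall>j\<in>S - S \<inter> up ` S. A j = 0"
      proof
        fix j assume j: "j \<in> S - S \<inter> up ` S"
        show "A j = 0"
        proof (cases "j i")
          case 0
          then show ?thesis by (rule A0)
        next
          case (Suc x)
          have "j = up (j(i := x))" using Suc by (auto simp: up_def)
          moreover have "j(i := x) \<in> S" using j Suc i by (auto simp: S_def)
          ultimately show ?thesis using j by blast
        qed
      qed
    qed (use finS in auto)
    finally show ?thesis by simp
  qed
  have "\<phi> (mon top) = 0" unfolding h phi_sum using zero by simp
  then show False using one by simp
qed

text \<open>Encoded as weighted degree 0 for the weight that charges only the variables with index
  at least \<open>m\<close>, so that the closure properties are inherited from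
  \<open>wle\<close>.\<close>

definition vars_below :: "nat \<Rightarrow> mpoly \<Rightarrow> bool" where
  "vars_below m = wle (\<lambda>i. if i < m then 0 else 1) 0"

lemma vars_below_keys:
  assumes "vars_below m f" "a \<in> Poly_Mapping.keys f"
  shows "Poly_Mapping.keys a \<subseteq> {..<m}"
proof
  fix i assume "i \<in> Poly_Mapping.keys a"
  moreover have "wt (\<lambda>i. if i < m then 0 else 1) a = 0" using assms by (auto simp: vars_below_def wle_def)
  ultimately show "i \<in> {..<m}" by (auto simp: wt_def in_keys_iff split: if_splits)
qed

text \<open>Replacing \<open>Var i ^ d i\<close> by \<open>- \<rho> i\<close> strictly lowers the
  weight, so the reduction terminates, and it stops only at monomials whose exponents are all below
  \<open>d i\<close>. The quotient by \<open>I\<close> is thus spanned by finitely many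
  monomials.\<close>

lemma normal_form_exists:
  fixes \<rho> :: "nat \<Rightarrow> mpoly"
  assumes I: "is_ideal I" and g: "\<And>i. i < m \<Longrightarrow> Var i ^ d i + \<rho> i \<in> I"
    and d: "\<And>i. i < m \<Longrightarrow> d i * \<omega> i \<ge> 1"
    and \<rho>: "\<And>i. i < m \<Longrightarrow> wle \<omega> (d i * \<omega> i - 1) (\<rho> i)" "\<And>i. i < m \<Longrightarrow> vars_below m (\<rho> i)"
    and f: "vars_below m f"
  shows "\<exists>b. f - b \<in> I \<and> Poly_Mapping.keys b \<subseteq>
    {a. Poly_Mapping.keys a \<subseteq> {..<m} \<and> (\<forall>i<m. Poly_Mapping.lookup a i < d i)}"
proof -
  define B where "B = {a. Poly_Mapping.keys a \<subseteq> {..<m} \<and> (\<forall>i<m. Poly_Mapping.lookup a i < d i)}"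
  define red where "red f \<longleftrightarrow> (\<exists>b. f - b \<in> I \<and> Poly_Mapping.keys b \<subseteq> B)" for f
  have red_sum: "red (sum f S)" if "finite S" "\<And>a. a \<in> S \<Longrightarrow> red (f a)" for f :: "_ \<Rightarrow> mpoly" and S :: "(nat \<Rightarrow>\<^sub>0 nat) set"
  proof -
    have "\<forall>a\<in>S. \<exists>b. f a - b \<in> I \<and> Poly_Mapping.keys b \<subseteq> B"
      using that by (simp add: red_def)
    then obtain b where b: "\<And>a. a \<in> S \<Longrightarrow> f a - b a \<in> I \<and> Poly_Mapping.keys (b a) \<subseteq> B"
      using bchoice by metis
    have "sum f S - sum b S \<in> I"
      unfolding sum_subtractf[symmetric] using b by (intro is_ideal_sum[OF I]) auto
    moreover have "Poly_Mapping.keys (sum b S) \<subseteq> B"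
      using b keys_sum[of b S] by blast
    ultimately show ?thesis unfolding red_def by blast
  qed
  have red_smult: "red (Const c * f)" if f: "red f" for f c
  proof -
    obtain b where b: "f - b \<in> I" "Poly_Mapping.keys b \<subseteq> B" using f by (auto simp: red_def)
    have "Const c * f - Const c * b \<in> I"
      unfolding right_diff_distrib[symmetric] by (rule is_idealD(3)[OF I b(1)])
    moreover have "Poly_Mapping.keys (Const c * b) \<subseteq> B"
      using b(2) keys_mult[of "Const c" b] by (cases "c = 0") (auto simp: Const_def)
    ultimately show ?thesis unfolding red_def by blast
  qed
  have red_mon: "red (mon a)" if "Poly_Mapping.keys a \<subseteq> {..<m}" for a
    using that
  proof (induction "wt \<omega> a" arbitrary: a rule: less_induct)
    case less
    show ?case
    proof (cases "a \<in> B")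
      case True
      then show ?thesis unfolding red_def using is_idealD(1)[OF I] by (intro exI[of _ "mon a"]) auto
    next
      case False
      then obtain i where i: "i < m" "d i \<le> Poly_Mapping.lookup a i"
        using less.prems by (auto simp: B_def not_less)
      define c where "c = a - Poly_Mapping.single i (d i)"
      have ac: "a = Poly_Mapping.single i (d i) + c"
        using i by (intro poly_mapping_eqI) (auto simp: c_def lookup_add lookup_minus lookup_single when_def)
      have wa: "wt \<omega> a = d i * \<omega> i + wt \<omega> c" by (simp add: ac wt_add)
      have kc: "Poly_Mapping.keys c \<subseteq> {..<m}"
      proof
        fix x assume "x \<in> Poly_Mapping.keys c"
        then have "x \<in> Poly_Mapping.keys a" by (auto simp: c_def in_keys_iff lookup_minus)
        then show "x \<in> {..<m}" using less.prems by blast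
      qed
      define F where "F = mon c * - \<rho> i"
      have kF: "Poly_Mapping.keys F \<subseteq> {c + e | e. e \<in> Poly_Mapping.keys (\<rho> i)}"
        using keys_mult[of "mon c" "- \<rho> i"] by (auto simp: F_def in_keys_iff)
      have "red (\<Sum>e\<in>Poly_Mapping.keys F. Const (Poly_Mapping.lookup F e) * mon e)"
      proof (intro red_sum red_smult)
        fix e assume "e \<in> Poly_Mapping.keys F"
        then obtain e' where e: "e = c + e'" "e' \<in> Poly_Mapping.keys (\<rho> i)" using kF by auto
        have "wt \<omega> e' \<le> d i * \<omega> i - 1" using \<rho>(1)[OF i(1)] e by (auto simp: wle_def)
        moreover obtain k where "d i * \<omega> i = Suc k" using d[OF i(1)] by (cases "d i * \<omega> i") auto
        ultimately have lt: "wt \<omega> e < wt \<omega> a" by (simp add: wa e wt_add)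
        have "Poly_Mapping.keys e \<subseteq> {..<m}"
          using kc vars_below_keys[OF \<rho>(2)[OF i(1)] e(2)] keys_add[of c e'] e(1) by auto
        then show "red (mon e)" using less.hyps[OF lt] by simp
      qed simp
      then have "red F" using mpoly_decomp[of "Poly_Mapping.keys F" F] by simp
      then obtain b where b: "F - b \<in> I" "Poly_Mapping.keys b \<subseteq> B" by (auto simp: red_def)
      have "mon a = mon c * (Var i ^ d i + \<rho> i) + F"
        by (simp add: F_def ac Var_power mult_single distrib_left add.commute)
      then have "mon a - b = mon c * (Var i ^ d i + \<rho> i) + (F - b)" by simp
      also have "\<dots> \<in> I" by (rule is_idealD(2)[OF I is_idealD(3)[OF I g[OF i(1)]] b(1)])
      finally show ?thesis using b(2) unfolding red_def by blast
    qed
  qed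
  have "red (\<Sum>e\<in>Poly_Mapping.keys f. Const (Poly_Mapping.lookup f e) * mon e)"
    using vars_below_keys[OF f] by (intro red_sum red_smult red_mon) auto
  then have "red f" using mpoly_decomp[of "Poly_Mapping.keys f" f] by simp
  then show ?thesis by (simp add: red_def B_def)
qed

section \<open>Finite quotients and points of an ideal\<close>

lemma finite_exponents:
  "finite {a :: nat \<Rightarrow>\<^sub>0 nat. Poly_Mapping.keys a \<subseteq> {..<m} \<and> (\<forall>i<m. Poly_Mapping.lookup a i < d i)}" (is "finite ?B")
proof (rule finite_imageD)
  have "(\<lambda>a. restrict (Poly_Mapping.lookup a) {..<m}) ` ?B \<subseteq> PiE {..<m} (\<lambda>i. {..<d i})"
    by (auto simp: restrict_def split: if_splits)
  then show "finite ((\<lambda>a. restrict (Poly_Mapping.lookup a) {..<m}) ` ?B)"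
    by (rule finite_subset) (intro finite_PiE, auto)
  show "inj_on (\<lambda>a. restrict (Poly_Mapping.lookup a) {..<m}) ?B"
  proof (intro inj_onI poly_mapping_eqI)
    fix a b k assume *: "a \<in> ?B" "b \<in> ?B"
      "restrict (Poly_Mapping.lookup a) {..<m} = restrict (Poly_Mapping.lookup b) {..<m}"
    show "Poly_Mapping.lookup a k = Poly_Mapping.lookup b k"
    proof (cases "k < m")
      case True
      then show ?thesis using fun_cong[OF *(3), of k] by simp
    next
      case False
      then have "k \<notin> Poly_Mapping.keys a" "k \<notin> Poly_Mapping.keys b" using * by auto
      then show ?thesis by (simp add: in_keys_iff)
    qed
  qed
qed

text \<open>Gaussian elimination: an equation \<open>b\<close> with a nonzero coefficient at
  \<open>k\<close> is solved for the unknown \<open>k\<close>, and the solution is substituted into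
  the other equations.\<close>

lemma homogeneous_system_nontrivial:
  fixes c :: "nat \<Rightarrow> 'b \<Rightarrow> 'a::field"
  assumes "finite B"
  shows "\<exists>x. (\<exists>n\<le>card B. x n \<noteq> 0) \<and> (\<forall>a\<in>B. (\<Sum>n\<le>card B. x n * c n a) = 0)"
proof -
  have "\<exists>x. (\<exists>n\<in>A. x n \<noteq> 0) \<and> (\<forall>a\<in>B. (\<Sum>n\<in>A. x n * c n a) = 0)"
    if "finite A" "card A > card B" for A :: "nat set"
    using assms that
  proof (induction B arbitrary: A c rule: finite_induct)
    case empty
    then obtain n where "n \<in> A" by (metis all_not_in_conv card.empty less_irrefl)
    then show ?case by (intro exI[of _ "\<lambda>_. 1"]) auto
  next
    case (insert b B)
    show ?case
    proof (cases "\<forall>n\<in>A. c n b = 0")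
      case True
      have "card B < card A" using insert by simp
      then show ?thesis using insert.IH[OF insert.prems(1), of c] True by auto
    next
      case False
      then obtain k where k: "k \<in> A" "c k b \<noteq> 0" by blast
      define c' where "c' n a = c n a - c n b / c k b * c k a" for n a
      have "card B < card (A - {k})" using insert k by simp
      then obtain x where x: "\<exists>n\<in>A-{k}. x n \<noteq> 0" "\<forall>a\<in>B. (\<Sum>n\<in>A-{k}. x n * c' n a) = 0"
        using insert.IH[of "A - {k}" c'] insert.prems by auto
      define y where "y = x(k := - (\<Sum>n\<in>A-{k}. x n * c n b) / c k b)"
      have y: "(\<Sum>n\<in>A. y n * c n a) = (\<Sum>n\<in>A-{k}. x n * c' n a)" for a
      proof -
        have "(\<Sum>n\<in>A. y n * c n a) = y k * c k a + (\<Sum>n\<in>A-{k}. y n * c n a)"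
          using insert.prems k by (subst sum.remove[of A k]) auto
        also have "(\<Sum>n\<in>A-{k}. y n * c n a) = (\<Sum>n\<in>A-{k}. x n * c n a)"
          by (intro sum.cong) (auto simp: y_def)
        also have "y k * c k a = (\<Sum>n\<in>A-{k}. - (x n * (c n b / c k b * c k a)))"
          by (simp add: y_def sum_divide_distrib sum_distrib_right sum_negf) (simp add: mult_ac)
        finally show ?thesis
          by (simp add: c'_def algebra_simps flip: sum.distrib)
      qed
      have "(\<Sum>n\<in>A-{k}. x n * c' n b) = 0" using k by (simp add: c'_def)
      then have "\<forall>a\<in>insert b B. (\<Sum>n\<in>A. y n * c n a) = 0" using x(2) y by simp
      moreover have "\<exists>n\<in>A. y n \<noteq> 0" using x(1) by (auto simp: y_def)
      ultimately show ?thesis by blast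
    qed
  qed
  from this[of "{..card B}"] show ?thesis by (auto simp: Bex_def)
qed

abbreviation ev :: "complex poly \<Rightarrow> mpoly \<Rightarrow> mpoly" where
  "ev p x \<equiv> poly (map_poly Const p) x"

text \<open>Takes the place of a maximal ideal. Write \<open>p\<close> as \<open>X - \<mu>\<close>
  times \<open>s\<close>. If adjoining \<open>x - Const \<mu>\<close> yields the unit ideal, then
  \<open>1 = j + r * (x - Const \<mu>)\<close> with \<open>j \<in> J\<close>; multiplying by
  \<open>ev s x\<close> shows \<open>ev s x \<in> J\<close>, and the degree has dropped.\<close>

lemma proper_ideal_root:
  assumes "is_ideal J" "1 \<notin> J" "p \<noteq> 0" "ev p x \<in> J"
  shows "\<exists>\<mu> J'. poly p \<mu> = 0 \<and> is_ideal J' \<and> J \<subseteq> J' \<and> 1 \<notin> J' \<and> x - Const \<mu> \<in> J'"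
  using assms(3,4)
proof (induction "degree p" arbitrary: p rule: less_induct)
  case less
  show ?case
  proof (cases "degree p = 0")
    case True
    then obtain c where c: "p = [:c:]" by (rule degree_eq_zeroE)
    then have "Const (inverse c) * Const c \<in> J" "c \<noteq> 0"
      using less.prems assms(1) is_idealD(3) by auto
    then have "1 \<in> J" by (simp flip: Const_simps)
    then show ?thesis using assms by simp
  next
    case False
    then obtain \<mu> where \<mu>: "poly p \<mu> = 0"
      using fundamental_theorem_of_algebra[of p] by (auto simp: constant_degree)
    then obtain s where s: "p = [:- \<mu>, 1:] * s" by (auto simp: poly_eq_0_iff_dvd dvd_def)
    have evp: "ev p x = (x - Const \<mu>) * ev s x" unfolding s Const_poly.hom_mult poly_mult by simp
    define J' where "J' = ideal_plus J {r * (x - Const \<mu>) | r. True}"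
    have id1: "is_ideal {r * (x - Const \<mu>) | r. True}"
      unfolding is_ideal_def
    proof (intro conjI ballI allI)
      show "0 \<in> {r * (x - Const \<mu>) | r. True}" by (auto intro!: exI[of _ 0])
    next
      fix a b assume "a \<in> {r * (x - Const \<mu>) | r. True}" "b \<in> {r * (x - Const \<mu>) | r. True}"
      then show "a + b \<in> {r * (x - Const \<mu>) | r. True}" by (auto simp flip: distrib_right)
    next
      fix a r assume "a \<in> {r * (x - Const \<mu>) | r. True}"
      then show "r * a \<in> {r * (x - Const \<mu>) | r. True}" by (auto simp flip: mult.assoc)
    qed
    show ?thesis
    proof (cases "1 \<in> J'")
      case True
      then obtain j r where jr: "1 = j + r * (x - Const \<mu>)" "j \<in> J" by (auto simp: J'_def ideal_plus_def)
      have "ev s x = ev s x * 1" by simp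
      also have "\<dots> = ev s x * j + r * ev p x" unfolding jr(1) evp by (simp add: algebra_simps)
      also have "\<dots> \<in> J" using jr less.prems assms(1) by (intro is_idealD(2,3))
      finally have "ev s x \<in> J" .
      moreover have "s \<noteq> 0" using less.prems s by auto
      moreover have "degree s < degree p" using \<open>s \<noteq> 0\<close> unfolding s by (subst degree_mult_eq) auto
      ultimately obtain \<nu> J2 where "poly s \<nu> = 0 \<and> is_ideal J2 \<and> J \<subseteq> J2 \<and> 1 \<notin> J2 \<and> x - Const \<nu> \<in> J2"
        using less.hyps[of s] by blast
      then show ?thesis by (intro exI[of _ \<nu>] exI[of _ J2]) (simp add: s)
    next
      case False
      have "x - Const \<mu> \<in> {r * (x - Const \<mu>) | r. True}" by (auto intro!: exI[of _ 1])
      then show ?thesis using \<mu> False assms(1) id1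
        by (intro exI[of _ \<mu>] exI[of _ J'])
           (auto simp: J'_def intro: ideal_plus_left ideal_plus_right)
    qed
  qed
qed

text \<open>Among the powers of \<open>x\<close> with exponents up to \<open>card B\<close> there is
  a linear dependence between the normal forms; its coefficients are those of
  \<open>p\<close>.\<close>

lemma integral_mod_ideal:
  assumes I: "is_ideal I" and "finite B"
    and nf: "\<And>n. \<exists>b. x ^ n - b \<in> I \<and> Poly_Mapping.keys b \<subseteq> B"
  shows "\<exists>p. p \<noteq> 0 \<and> ev p x \<in> I"
proof -
  from nf obtain b where b: "\<And>n. x ^ n - b n \<in> I" "\<And>n. Poly_Mapping.keys (b n) \<subseteq> B" by metis
  define N where "N = card B"
  obtain c where c: "\<exists>n\<le>N. c n \<noteq> 0" "\<forall>a\<in>B. (\<Sum>n\<le>N. c n * Poly_Mapping.lookup (b n) a) = 0"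
    using homogeneous_system_nontrivial[OF assms(2), of "\<lambda>n. Poly_Mapping.lookup (b n)"] by (auto simp: N_def)
  define p where "p = (\<Sum>n\<le>N. monom (c n) n)"
  have cp: "coeff p n = (if n \<le> N then c n else 0)" for n
    by (simp add: p_def coeff_sum)
  have "p \<noteq> 0" using c(1) cp by (metis coeff_0)
  moreover have "ev p x \<in> I"
  proof -
    have "ev p x = (\<Sum>n\<le>N. Const (c n) * x ^ n)"
      by (simp add: p_def Const_poly.hom_sum poly_sum poly_monom)
    also have "\<dots> = (\<Sum>n\<le>N. Const (c n) * (x ^ n - b n)) + (\<Sum>n\<le>N. Const (c n) * b n)"
      by (simp add: right_diff_distrib sum_subtractf)
    also have "(\<Sum>n\<le>N. Const (c n) * b n) = 0"
    proof -
      have "(\<Sum>n\<le>N. Const (c n) * b n) = (\<Sum>n\<le>N. Const (c n) * (\<Sum>a\<in>B. Const (Poly_Mapping.lookup (b n) a) * mon a))"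
        using mpoly_decomp[OF assms(2) b(2)] by simp
      also have "\<dots> = (\<Sum>a\<in>B. Const (\<Sum>n\<le>N. c n * Poly_Mapping.lookup (b n) a) * mon a)"
        unfolding sum_distrib_left Const.hom_sum sum_distrib_right
        by (subst sum.swap) (simp add: mult.assoc)
      also have "\<dots> = 0" using c(2) by simp
      finally show ?thesis .
    qed
    finally show ?thesis by (auto intro!: is_ideal_sum[OF I] is_idealD(3)[OF I] b(1))
  qed
  ultimately show ?thesis by blast
qed

text \<open>If no power of \<open>x i\<close> lies in \<open>I\<close>, the saturation of
  \<open>I\<close> by \<open>x i\<close> is proper. In it the polynomial relation for
  \<open>x i\<close> can be divided by all powers of the unknown; what is left has a nonzero
  constant term, so it can only assign a nonzero value to \<open>x i\<close>. The values of all
  coordinates are adjoined afterwards one by one.\<close>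

lemma nilpotent_or_point:
  fixes x :: "nat \<Rightarrow> mpoly"
  assumes I: "is_ideal I" and int: "\<And>i. i < m \<Longrightarrow> \<exists>p. p \<noteq> 0 \<and> ev p (x i) \<in> I" and i: "i < m"
  shows "(\<exists>N. x i ^ N \<in> I) \<or>
    (\<exists>\<mu> J. is_ideal J \<and> I \<subseteq> J \<and> 1 \<notin> J \<and> (\<forall>j<m. x j - Const (\<mu> j) \<in> J) \<and> \<mu> i \<noteq> 0)"
proof (cases "\<exists>N. x i ^ N \<in> I")
  case False
  define J0 where "J0 = {f. \<exists>N. x i ^ N * f \<in> I}"
  have J0: "is_ideal J0" unfolding is_ideal_def
  proof (intro conjI ballI allI)
    show "0 \<in> J0" using is_idealD(1)[OF I] by (simp add: J0_def)
  next
    fix a b assume "a \<in> J0" "b \<in> J0"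
    then obtain N M where *: "x i ^ N * a \<in> I" "x i ^ M * b \<in> I" by (auto simp: J0_def)
    have "x i ^ M * (x i ^ N * a) + x i ^ N * (x i ^ M * b) \<in> I"
      by (rule is_idealD(2)[OF I is_idealD(3)[OF I *(1)] is_idealD(3)[OF I *(2)]])
    then have "x i ^ (N + M) * (a + b) \<in> I" by (simp add: power_add algebra_simps)
    then show "a + b \<in> J0" by (auto simp: J0_def)
  next
    fix a r assume "a \<in> J0"
    then obtain N where *: "x i ^ N * a \<in> I" by (auto simp: J0_def)
    then have "x i ^ N * (r * a) \<in> I" using is_idealD(3)[OF I *, of r] by (simp add: mult_ac)
    then show "r * a \<in> J0" by (auto simp: J0_def)
  qed
  have J01: "1 \<notin> J0" using False by (auto simp: J0_def)
  have IJ0: "I \<subseteq> J0" by (auto simp: J0_def intro!: exI[of _ 0])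
  obtain p where p: "p \<noteq> 0" "ev p (x i) \<in> I" using int[OF i] by blast
  obtain r where r: "p = [:-0, 1:] ^ Polynomial.order 0 p * r" "\<not> [:-0, 1:] dvd r" using order_decomp[OF p(1)] by blast
  have "ev p (x i) = x i ^ Polynomial.order 0 p * ev r (x i)"
    by (subst r(1)) (simp add: Const_poly.hom_mult Const_poly.hom_power)
  then have "ev r (x i) \<in> J0" using p(2) by (auto simp: J0_def)
  moreover have r0: "poly r 0 \<noteq> 0" using r(2) by (simp add: poly_eq_0_iff_dvd)
  moreover have "r \<noteq> 0" using r0 by auto
  ultimately obtain \<nu> J1 where J1: "poly r \<nu> = 0" "is_ideal J1" "J0 \<subseteq> J1" "1 \<notin> J1" "x i - Const \<nu> \<in> J1"
    using proper_ideal_root[OF J0 J01, of r "x i"] by blast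
  have "\<exists>\<mu> J. is_ideal J \<and> J1 \<subseteq> J \<and> 1 \<notin> J \<and> (\<forall>j<n. x j - Const (\<mu> j) \<in> J)" if "n \<le> m" for n
    using that
  proof (induction n)
    case 0
    then show ?case using J1 by blast
  next
    case (Suc n)
    then obtain \<mu> J where J: "is_ideal J" "J1 \<subseteq> J" "1 \<notin> J" "\<forall>j<n. x j - Const (\<mu> j) \<in> J" by auto
    obtain p where p: "p \<noteq> 0" "ev p (x n) \<in> I" using int[of n] Suc.prems by auto
    then have "ev p (x n) \<in> J" using IJ0 J1 J by blast
    then obtain \<nu> J' where J': "is_ideal J'" "J \<subseteq> J'" "1 \<notin> J'" "x n - Const \<nu> \<in> J'"
      using proper_ideal_root[OF J(1,3) p(1)] by blast
    then show ?case using J by (intro exI[of _ "\<mu>(n := \<nu>)"] exI[of _ J']) (auto simp: less_Suc_eq)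
  qed
  then obtain \<mu> J where J: "is_ideal J" "J1 \<subseteq> J" "1 \<notin> J" "\<forall>j<m. x j - Const (\<mu> j) \<in> J" by blast
  \<comment> \<open>The coordinate \<open>i\<close> was treated twice. Both values agree, since
    otherwise their difference, a nonzero constant, would lie in the proper ideal
    \<open>J\<close>.\<close>
  have "(x i - Const \<nu>) - (x i - Const (\<mu> i)) \<in> J"
    by (rule is_idealD(6)[OF J(1)]) (use J J1 i in auto)
  then have c: "Const (\<mu> i - \<nu>) \<in> J" by simp
  have "\<mu> i = \<nu>"
  proof (rule ccontr)
    assume "\<mu> i \<noteq> \<nu>"
    then have "Const (inverse (\<mu> i - \<nu>) * (\<mu> i - \<nu>)) = 1" by simp
    then have "1 = Const (inverse (\<mu> i - \<nu>)) * Const (\<mu> i - \<nu>)" by (simp only: Const_simps(4))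
    then show False using is_idealD(3)[OF J(1) c] J(3) by metis
  qed
  moreover have "\<nu> \<noteq> 0" using J1(1) r0 by auto
  ultimately show ?thesis using J J1 IJ0 by (intro disjI2 exI[of _ \<mu>] exI[of _ J]) auto
qed simp

section \<open>Complete homogeneous symmetric polynomials and Newton's identity\<close>

fun hsym :: "(nat \<Rightarrow> 'a::comm_ring_1) \<Rightarrow> nat \<Rightarrow> nat \<Rightarrow> 'a" where
  "hsym x n 0 = 1"
| "hsym x 0 (Suc r) = 0"
| "hsym x (Suc n) (Suc r) = hsym x n (Suc r) + x n * hsym x (Suc n) r"

text \<open>Induction on the number of variables and on the degree. In the sum for
  \<open>Suc n\<close> variables, \<open>A\<close> collects the old variables and \<open>E\<close>
  the new one; both obey one-step recursions that follow from
  \<open>h (Suc r) = hsym x n (Suc r) + x n * h r\<close>.\<close>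

lemma newton_hsym:
  fixes x :: "nat \<Rightarrow> 'a::comm_ring_1"
  shows "of_nat r * hsym x n r = (\<Sum>j=1..r. (\<Sum>i<n. x i ^ j) * hsym x n (r - j))"
proof (induction n arbitrary: r)
  case 0
  show ?case by (cases r) auto
next
  case (Suc n)
  define p where "p j = (\<Sum>i<n. x i ^ j)" for j
  define h where "h = hsym x (Suc n)"
  have rec: "hsym x n (Suc r) = h (Suc r) - x n * h r" for r by (simp add: h_def)
  note IHn = Suc.IH
  show ?case
  proof (induction r)
    case (Suc r)
    define A where "A r = (\<Sum>j=1..r. p j * h (r - j))" for r
    define E where "E r = (\<Sum>j=1..r. x n ^ j * h (r - j))" for r
    have "A (Suc r) - x n * A r = (\<Sum>j=1..r. p j * (h (Suc r - j) - x n * h (r - j))) + p (Suc r) * h 0"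
      by (simp add: A_def sum_subtractf algebra_simps sum_distrib_left)
    also have "(\<Sum>j=1..r. p j * (h (Suc r - j) - x n * h (r - j))) = (\<Sum>j=1..r. p j * hsym x n (Suc r - j))"
    proof (intro sum.cong refl)
      fix j assume "j \<in> {1..r}"
      then have "Suc r - j = Suc (r - j)" by auto
      then show "p j * (h (Suc r - j) - x n * h (r - j)) = p j * hsym x n (Suc r - j)"
        using rec[of "r - j"] by simp
    qed
    also have "\<dots> + p (Suc r) * h 0 = (\<Sum>j=1..Suc r. p j * hsym x n (Suc r - j))"
      by (simp add: h_def)
    also have "\<dots> = of_nat (Suc r) * hsym x n (Suc r)" unfolding p_def by (rule IHn[symmetric])
    finally have A: "A (Suc r) = of_nat (Suc r) * hsym x n (Suc r) + x n * A r" by (simp add: algebra_simps)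
    have "E (Suc r) = x n * h r + (\<Sum>j=Suc 1..Suc r. x n ^ j * h (Suc r - j))"
      unfolding E_def by (subst sum.atLeast_Suc_atMost) simp_all
    also have "(\<Sum>j=Suc 1..Suc r. x n ^ j * h (Suc r - j)) = x n * E r"
      unfolding E_def sum.shift_bounds_cl_Suc_ivl by (simp add: sum_distrib_left mult.assoc)
    finally have E: "E (Suc r) = x n * h r + x n * E r" .
    have AE: "(\<Sum>j=1..r. (\<Sum>i<Suc n. x i ^ j) * h (r - j)) = A r + E r" for r
      by (simp add: A_def E_def p_def distrib_right sum.distrib)
    have IH: "of_nat r * h r = A r + E r" using Suc AE[of r] by (simp add: h_def)
    have "A (Suc r) + E (Suc r) = of_nat (Suc r) * hsym x n (Suc r) + x n * h r + x n * (of_nat r * h r)"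
      unfolding A E IH by (simp add: algebra_simps)
    also have "\<dots> = of_nat (Suc r) * h (Suc r)" unfolding rec by (simp add: algebra_simps)
    finally show ?case using AE[of "Suc r"] by (simp add: h_def)
  qed simp
qed

text \<open>Deformation of the complete homogeneous symmetric polynomials: Newton's recursion applied to
  deformed power sums \<open>P 1\<close>, \<open>P 2\<close>, ...\<close>

fun hdef :: "(nat \<Rightarrow> mpoly) \<Rightarrow> nat \<Rightarrow> mpoly" where
  "hdef P 0 = 1"
| "hdef P (Suc r) = Const (1 / of_nat (Suc r)) * (\<Sum>j\<le>r. P (Suc j) * hdef P (r - j))"

text \<open>Deforms the complete homogeneous polynomial of degree \<open>r\<close> in the squares of
  the first \<open>m - t\<close> variables: the last variable is removed by reading the recursion of
  \<open>hsym\<close> backwards.\<close>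

fun kdef :: "nat \<Rightarrow> (nat \<Rightarrow> mpoly) \<Rightarrow> nat \<Rightarrow> nat \<Rightarrow> mpoly" where
  "kdef m P 0 r = hdef P r"
| "kdef m P (Suc t) r = kdef m P t r - Var (m - Suc t) ^ 2 * kdef m P t (r - 1)"

lemma newton_hsym': "hsym (x :: nat \<Rightarrow> mpoly) n (Suc r) =
    Const (1 / of_nat (Suc r)) * (\<Sum>j\<le>r. (\<Sum>i<n. x i ^ Suc j) * hsym x n (r - j))"
proof -
  have "(\<Sum>j\<le>r. (\<Sum>i<n. x i ^ Suc j) * hsym x n (r - j)) = (\<Sum>j=1..Suc r. (\<Sum>i<n. x i ^ j) * hsym x n (Suc r - j))"
    unfolding One_nat_def sum.shift_bounds_cl_Suc_ivl by (simp add: atLeast0AtMost)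
  also have "\<dots> = Const (of_nat (Suc r)) * hsym x n (Suc r)"
    unfolding newton_hsym[symmetric] by simp
  finally have "Const (1 / of_nat (Suc r)) * (\<Sum>j\<le>r. (\<Sum>i<n. x i ^ Suc j) * hsym x n (r - j))
      = Const (1 / of_nat (Suc r) * of_nat (Suc r)) * hsym x n (Suc r)"
    by (simp only: Const_simps mult.assoc)
  then show ?thesis by (simp del: of_nat_Suc)
qed

lemma hdef_mult: "of_nat (Suc r) * hdef P (Suc r) = (\<Sum>j\<le>r. P (Suc j) * hdef P (r - j))"
proof -
  have "of_nat (Suc r) * hdef P (Suc r)
      = Const (of_nat (Suc r) * (1 / of_nat (Suc r))) * (\<Sum>j\<le>r. P (Suc j) * hdef P (r - j))"
    by (simp only: Const_simps mult.assoc hdef.simps)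
  then show ?thesis by (simp del: of_nat_Suc hdef.simps)
qed

lemma wle_hsym:
  assumes "\<And>i. i < n \<Longrightarrow> wle \<omega> w (x i)"
  shows "wle \<omega> (r * w) (hsym x n r)"
  using assms
proof (induction x n r rule: hsym.induct)
  case (3 x n r)
  then have "wle \<omega> (w + r * w) (x n * hsym x (Suc n) r)" by (intro wle_mult) auto
  then show ?case using 3 by (auto intro!: wle_add)
qed auto

lemma vars_below_simps:
  "vars_below m f \<Longrightarrow> vars_below m g \<Longrightarrow> vars_below m (f + g)"
  "vars_below m f \<Longrightarrow> vars_below m g \<Longrightarrow> vars_below m (f - g)"
  "vars_below m f \<Longrightarrow> vars_below m g \<Longrightarrow> vars_below m (f * g)"
  "vars_below m f \<Longrightarrow> vars_below m (f ^ n)"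
  "vars_below m f \<Longrightarrow> vars_below m (- f)"
  "i < m \<Longrightarrow> vars_below m (Var i)"
  "vars_below m (Const c)" "vars_below m 0" "vars_below m 1"
  "(\<And>i. i \<in> S \<Longrightarrow> vars_below m (h i)) \<Longrightarrow> vars_below m (sum h S)"
  using wle_mult[of _ 0 f 0 g] wle_power[of _ 0 f n]
  by (auto simp: vars_below_def intro: wle_add wle_diff wle_uminus wle_Var wle_sum)

lemma add_mult_eqI: "a + b = c \<Longrightarrow> a * w + b * w = c * (w :: nat)"
  by (metis distrib_right)

text \<open>The zero is handed over as a proper ideal \<open>J\<close>, so that evaluating at
  \<open>\<mu>\<close> means computing modulo \<open>J\<close>. The hypothesis \<open>top\<close>
  holds for any difference of degree at most \<open>2 * k - 1\<close> in the first \<open>m\<close>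
  variables; it is stated for the weights that the proof needs. The \<open>l i\<close> are linear
  coordinates whose squares are of order 3 modulo the ideal.\<close>

lemma exists_nonzero_common_zero:
  fixes P :: "nat \<Rightarrow> mpoly"
  assumes m: "m \<ge> 2"
    and vars: "\<And>k. 1 \<le> k \<Longrightarrow> k \<le> m \<Longrightarrow> vars_below m (P k)"
    and top: "\<And>k. 1 \<le> k \<Longrightarrow> k \<le> m \<Longrightarrow>
      wle (\<lambda>i. 2 * m * m + i) ((2 * k - 1) * (2 * m * m + m)) (P k - (\<Sum>i<m. Var i ^ (2 * k)))"
    and l1: "\<And>i. i < m \<Longrightarrow> l i \<in> ideal_pow m Var 1"
    and l2: "\<And>i. i < m \<Longrightarrow> Var i \<in> ideal_pow m l 1"
    and sq: "\<And>i. i < m \<Longrightarrow> l i * l i \<in> ideal_plus (gen_ideal m (\<lambda>k. P (Suc k))) (ideal_pow m Var 3)"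
  shows "\<exists>\<mu> J. is_ideal J \<and> 1 \<notin> J \<and> (\<forall>k. 1 \<le> k \<longrightarrow> k \<le> m \<longrightarrow> P k \<in> J) \<and>
    (\<forall>j<m. Var j - Const (\<mu> j) \<in> J) \<and> (\<exists>j<m. \<mu> j \<noteq> 0)"
proof -
  \<comment> \<open>Nearly equal weights: the increments make \<open>Var i\<close> the heaviest
    among \<open>Var 0\<close>, ..., \<open>Var i\<close>, while the common part is so large that
    losing one degree outweighs all increments. \<open>W\<close> bounds every weight.\<close>
  define \<omega> where "\<omega> i = 2 * m * m + i" for i :: nat
  define W where "W = 2 * m * m + m"
  define x where "x i = Var i ^ 2" for i
  define I where "I = gen_ideal m (\<lambda>k. P (Suc k))"
  define d where "d i = 2 * (m - i)" for i :: nat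
  \<comment> \<open>Deforms the complete homogeneous polynomial of degree \<open>m - i\<close> in
    the squares of \<open>Var 0\<close>, ..., \<open>Var i\<close>. Its heaviest term is the pure
    power \<open>Var i ^ (2 * (m - i))\<close>, and these exponents lead to a top monomial of degree
    m^2.\<close>
  define g where "g i = kdef m P (m - Suc i) (m - i)" for i
  define \<rho> where "\<rho> i = g i - Var i ^ d i" for i
  have I: "is_ideal I" by (simp add: I_def)
  have PI: "P k \<in> I" if "1 \<le> k" "k \<le> m" for k
    using gen_ideal_base[of "k - 1" m "\<lambda>k. P (Suc k)"] that by (simp add: I_def)
  have xW: "wle \<omega> (2 * W) (x i)" if "i < m" for i
    unfolding x_def using that by (intro wle_power wle_Var) (simp add: \<omega>_def W_def)

  have H_I: "hdef P r \<in> I" if "1 \<le> r" "r \<le> m" for r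
    using that
  proof (cases r)
    case (Suc r')
    then have "(\<Sum>j\<le>r'. P (Suc j) * hdef P (r' - j)) \<in> I"
      using that by (intro is_ideal_sum[OF I] is_idealD(4)[OF I] PI) auto
    then show ?thesis by (simp add: Suc is_idealD(3)[OF I] del: Const_simps)
  qed auto
  have K_I: "kdef m P t r \<in> I" if "t + 1 \<le> r" "r \<le> m" for t r
    using that
  proof (induction t arbitrary: r)
    case 0
    then show ?case by (simp add: H_I)
  next
    case (Suc t)
    then have "kdef m P t r \<in> I" "kdef m P t (r - 1) \<in> I" by auto
    then show ?case by (simp add: is_idealD(3,6)[OF I])
  qed
  have g_I: "Var i ^ d i + \<rho> i \<in> I" if "i < m" for i
    using K_I[of "m - Suc i" "m - i"] that by (simp add: \<rho>_def g_def)

  have H_vars: "vars_below m (hdef P r)" if "r \<le> m" for r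
    using that
  proof (induction r rule: less_induct)
    case (less r)
    show ?case
    proof (cases r)
      case (Suc r')
      then show ?thesis using less
        by (auto simp del: Const_simps intro!: vars_below_simps vars)
    qed (simp add: vars_below_simps)
  qed
  have K_vars: "vars_below m (kdef m P t r)" if "r \<le> m" "t \<le> m" for t r
    using that
  proof (induction t arbitrary: r)
    case (Suc t)
    then show ?case by (auto intro!: vars_below_simps)
  qed (simp add: H_vars)
  have rho_vars: "vars_below m (\<rho> i)" if "i < m" for i
    unfolding \<rho>_def g_def using that by (intro vars_below_simps K_vars) auto

  have P_wt: "wle \<omega> (2 * k * W) (P k)" if "1 \<le> k" "k \<le> m" for k
  proof -
    have "wle \<omega> (2 * k * W) ((P k - (\<Sum>i<m. Var i ^ (2 * k))) + (\<Sum>i<m. Var i ^ (2 * k)))"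
    proof (intro wle_add wle_sum wle_power wle_Var)
      show "wle \<omega> (2 * k * W) (P k - (\<Sum>i<m. Var i ^ (2 * k)))"
        using top[OF that] unfolding \<omega>_def W_def by (rule wle_mono) simp
    qed (auto simp: \<omega>_def W_def)
    then show ?thesis by simp
  qed
  have top_x: "wle \<omega> ((2 * k - 1) * W) (P k - (\<Sum>i<m. x i ^ k))" if "1 \<le> k" "k \<le> m" for k
  proof -
    have "\<omega> = (\<lambda>i. 2 * m * m + i)" by (simp add: fun_eq_iff \<omega>_def)
    then show ?thesis using top[OF that] by (simp only: W_def x_def power_mult)
  qed
  have hs_wt: "wle \<omega> (2 * r * W) (hsym x n r)" if "n \<le> m" for n r
    using wle_hsym[of n \<omega> "2 * W" x r] xW that by (simp add: mult_ac)
  have H_top: "wle \<omega> ((2 * r - 1) * W) (hdef P r - hsym x m r)" if "r \<le> m" for r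
    using that
  proof (induction r rule: less_induct)
    case (less r)
    show ?case
    proof (cases r)
      case (Suc r')
      have eq: "hdef P r - hsym x m r = Const (1 / of_nat (Suc r')) *
        (\<Sum>j\<le>r'. P (Suc j) * (hdef P (r' - j) - hsym x m (r' - j))
          + (P (Suc j) - (\<Sum>i<m. x i ^ Suc j)) * hsym x m (r' - j))"
        unfolding Suc newton_hsym' hdef.simps
        by (simp only: right_diff_distrib[symmetric] sum_subtractf[symmetric])
           (intro arg_cong2[of _ _ _ _ "(*)"] sum.cong refl, simp add: algebra_simps)
      have t1: "wle \<omega> ((2 * r - 1) * W) (P (Suc j) * (hdef P (r' - j) - hsym x m (r' - j)))" if "j \<le> r'" for j
      proof (cases "j = r'")
        case False
        have "wle \<omega> (2 * Suc j * W + (2 * (r' - j) - 1) * W) (P (Suc j) * (hdef P (r' - j) - hsym x m (r' - j)))"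
          using that Suc less.prems by (intro wle_mult P_wt less.IH) auto
        moreover have "2 * Suc j * W + (2 * (r' - j) - 1) * W = (2 * r - 1) * W"
          by (rule add_mult_eqI) (use that False Suc in auto)
        ultimately show ?thesis by (simp only:)
      qed simp
      have t2: "wle \<omega> ((2 * r - 1) * W) ((P (Suc j) - (\<Sum>i<m. x i ^ Suc j)) * hsym x m (r' - j))" if "j \<le> r'" for j
      proof -
        have "wle \<omega> ((2 * Suc j - 1) * W + 2 * (r' - j) * W) ((P (Suc j) - (\<Sum>i<m. x i ^ Suc j)) * hsym x m (r' - j))"
          using that Suc less.prems by (intro wle_mult top_x hs_wt) auto
        moreover have "(2 * Suc j - 1) * W + 2 * (r' - j) * W = (2 * r - 1) * W"
          by (rule add_mult_eqI) (use that Suc in auto)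
        ultimately show ?thesis by (simp only:)
      qed
      have "wle \<omega> (0 + (2 * r - 1) * W) (hdef P r - hsym x m r)"
        unfolding eq by (intro wle_mult wle_Const wle_sum wle_add t1 t2) auto
      then show ?thesis by (simp only: add_0)
    qed simp
  qed
  have K_top: "wle \<omega> ((2 * r - 1) * W) (kdef m P t r - hsym x (m - t) r)"
    if "t + 1 \<le> r" "r \<le> m" for t r
    using that
  proof (induction t arbitrary: r)
    case 0
    then show ?case using H_top[of r] by simp
  next
    case (Suc t)
    obtain r' where r': "r = Suc r'" "r' \<ge> 1" using Suc.prems by (cases r) auto
    have mt: "m - t = Suc (m - Suc t)" using Suc.prems by simp
    have "hsym x (m - t) r = hsym x (m - Suc t) r + x (m - Suc t) * hsym x (m - t) r'"
      unfolding r' mt by simp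
    then have "kdef m P (Suc t) r - hsym x (m - Suc t) r
      = (kdef m P t r - hsym x (m - t) r) - x (m - Suc t) * (kdef m P t r' - hsym x (m - t) r')"
      by (simp add: r' x_def algebra_simps)
    moreover have "wle \<omega> ((2 * r - 1) * W) (kdef m P t r - hsym x (m - t) r)" using Suc by auto
    moreover have "wle \<omega> (2 * W + (2 * r' - 1) * W) (x (m - Suc t) * (kdef m P t r' - hsym x (m - t) r'))"
      using Suc r' xW[of "m - Suc t"] by (intro wle_mult Suc.IH) auto
    moreover have "2 * W + (2 * r' - 1) * W = (2 * r - 1) * W" by (rule add_mult_eqI) (use r' in auto)
    ultimately show ?case by (metis wle_diff)
  qed

  have hs_lead: "wle \<omega> (2 * r * \<omega> i - 1) (hsym x (Suc i) r - x i ^ r)" if "i < m" for i r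
  proof (induction r)
    case (Suc r)
    note IH = Suc.IH
    have xi: "wle \<omega> (2 * \<omega> i) (x i)" unfolding x_def by (intro wle_power wle_Var) simp
    have mw: "m > 0" "\<omega> i \<ge> 1" using m by (auto simp: \<omega>_def Suc_le_eq)
    have "wle \<omega> (2 * Suc r * \<omega> i - 1) (hsym x i (Suc r))"
    proof (cases i)
      case (Suc i')
      have "wle \<omega> (Suc r * (2 * \<omega> i')) (hsym x i (Suc r))"
        unfolding x_def using Suc by (intro wle_hsym wle_power wle_Var) (auto simp: \<omega>_def)
      then show ?thesis by (rule wle_mono) (simp add: Suc \<omega>_def algebra_simps)
    qed simp
    moreover have "wle \<omega> (2 * Suc r * \<omega> i - 1) (x i * (hsym x (Suc i) r - x i ^ r))"
    proof (cases r)
      case (Suc r')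
      have "wle \<omega> (2 * \<omega> i + (2 * r * \<omega> i - 1)) (x i * (hsym x (Suc i) r - x i ^ r))"
        by (intro wle_mult xi IH)
      then show ?thesis by (rule wle_mono) (use mw Suc in simp)
    qed simp
    ultimately have "wle \<omega> (2 * Suc r * \<omega> i - 1) (hsym x i (Suc r) + x i * (hsym x (Suc i) r - x i ^ r))"
      by (rule wle_add)
    then show ?case by (simp add: algebra_simps)
  qed simp
  have rho_wt: "wle \<omega> (d i * \<omega> i - 1) (\<rho> i)" if i: "i < m" for i
  proof -
    define r where "r = m - i"
    have r: "1 \<le> r" "r \<le> m" "m - (m - Suc i) = Suc i" using i by (auto simp: r_def)
    have "\<rho> i = (kdef m P (m - Suc i) r - hsym x (Suc i) r) + (hsym x (Suc i) r - x i ^ r)"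
      by (simp add: \<rho>_def g_def r_def d_def x_def power_mult)
    moreover have "wle \<omega> (d i * \<omega> i - 1) (kdef m P (m - Suc i) r - hsym x (Suc i) r)"
    proof (rule wle_mono)
      show "wle \<omega> ((2 * r - 1) * W) (kdef m P (m - Suc i) r - hsym x (Suc i) r)"
        using K_top[of "m - Suc i" r] i r by (simp add: r_def)
      obtain s where s: "r = Suc s" using r by (cases r) auto
      have "(2 * s + 1) * m + 1 \<le> 2 * m * m"
      proof -
        have "(2 * s + 1) * m + 1 \<le> (2 * s + 1) * m + m" using m by simp
        also have "\<dots> = 2 * Suc s * m" by (simp add: algebra_simps)
        also have "\<dots> \<le> 2 * m * m" using s r by (intro mult_le_mono1 mult_le_mono2) auto
        finally show ?thesis .
      qed
      then have "(2 * s + 1) * (2 * m * m + m) + 1 \<le> (2 * s + 1) * (2 * m * m) + 2 * m * m"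
        by (simp only: distrib_left)
      also have "\<dots> = 2 * Suc s * (2 * m * m)" by (simp add: algebra_simps)
      also have "\<dots> \<le> 2 * Suc s * \<omega> i" unfolding \<omega>_def by (intro mult_le_mono2) simp
      finally show "(2 * r - 1) * W \<le> d i * \<omega> i - 1"
        unfolding d_def r_def[symmetric] s W_def by simp
    qed
    moreover have "wle \<omega> (d i * \<omega> i - 1) (hsym x (Suc i) r - x i ^ r)"
      using hs_lead[OF i, of r] by (simp add: d_def r_def)
    ultimately show ?thesis using wle_add by metis
  qed
  have d1: "d i \<ge> 1" "\<omega> i \<ge> 1" "d i * \<omega> i \<ge> 1" if "i < m" for i
    using that m by (auto simp: d_def \<omega>_def Suc_le_eq)

  \<comment> \<open>The triangular generators give back the \<open>P k\<close>: a
    \<open>kdef\<close> at \<open>(t, r)\<close> is recovered from those at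
    \<open>(Suc t, r)\<close> and \<open>(t, r - 1)\<close>, for both of which \<open>r - t\<close>
    is smaller, and Newton's recursion is solved for its last summand.\<close>
  define I' where "I' = gen_ideal m (\<lambda>i. Var i ^ d i + \<rho> i)"
  have I': "is_ideal I'" by (simp add: I'_def)
  have g_I': "g i \<in> I'" if "i < m" for i
    using gen_ideal_base[OF that, of "\<lambda>i. Var i ^ d i + \<rho> i"] by (simp add: I'_def \<rho>_def)
  have K_I': "kdef m P t r \<in> I'" if "t + 1 \<le> r" "r \<le> m" for t r
    using that
  proof (induction "r - t" arbitrary: r t rule: less_induct)
    case less
    show ?case
    proof (cases "r = t + 1")
      case True
      then show ?thesis using g_I'[of "m - r"] less.prems by (simp add: g_def)
    next
      case False
      have "kdef m P (Suc t) r \<in> I'" "kdef m P t (r - 1) \<in> I'"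
        using less.prems False by (intro less.hyps; simp)+
      then have "kdef m P (Suc t) r + Var (m - Suc t) ^ 2 * kdef m P t (r - 1) \<in> I'"
        by (intro is_idealD(2,3)[OF I'])
      then show ?thesis by simp
    qed
  qed
  have P_I': "P k \<in> I'" if "1 \<le> k" "k \<le> m" for k
    using that
  proof (induction k rule: less_induct)
    case (less k)
    then obtain r where r: "k = Suc r" by (cases k) auto
    have "of_nat (Suc r) * hdef P (Suc r) = (\<Sum>j<r. P (Suc j) * hdef P (r - j)) + P k"
      unfolding hdef_mult by (simp add: r lessThan_Suc_atMost[symmetric])
    then have "P k = of_nat (Suc r) * hdef P (Suc r) - (\<Sum>j<r. P (Suc j) * hdef P (r - j))"
      by simp
    also have "\<dots> \<in> I'"
      using less r K_I'[of 0 "Suc r"]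
      by (intro is_idealD(6)[OF I' is_idealD(3)[OF I'] is_ideal_sum[OF I' is_idealD(4)[OF I' less.IH]]]) auto
    finally show ?case .
  qed
  have II': "I \<subseteq> I'" unfolding I_def using P_I' by (intro gen_ideal_least I') auto

  show ?thesis
  proof (rule ccontr)
    assume none: "\<not> ?thesis"
    have "\<exists>N. Var i ^ N \<in> I" if i: "i < m" for i
    proof -
      have "\<exists>p. p \<noteq> 0 \<and> ev p (Var j) \<in> I" if "j < m" for j
        using that
        by (intro integral_mod_ideal[OF I finite_exponents[of m d]]
                  normal_form_exists[OF I g_I d1(3) rho_wt rho_vars] vars_below_simps) auto
      from nilpotent_or_point[OF I this i] show ?thesis
      proof
        assume "\<exists>\<mu> J. is_ideal J \<and> I \<subseteq> J \<and> 1 \<notin> J \<and> (\<forall>j<m. Var j - Const (\<mu> j) \<in> J) \<and> \<mu> i \<noteq> 0"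
        then obtain \<mu> J where "is_ideal J" "I \<subseteq> J" "1 \<notin> J" "\<forall>j<m. Var j - Const (\<mu> j) \<in> J" "\<mu> i \<noteq> 0"
          by blast
        then have "is_ideal J \<and> 1 \<notin> J \<and> (\<forall>k. 1 \<le> k \<longrightarrow> k \<le> m \<longrightarrow> P k \<in> J) \<and>
            (\<forall>j<m. Var j - Const (\<mu> j) \<in> J) \<and> (\<exists>j<m. \<mu> j \<noteq> 0)"
          using PI i by blast
        then show ?thesis using none by blast
      qed
    qed
    then obtain N where N: "\<And>i. i < m \<Longrightarrow> Var i ^ N i \<in> I" by metis
    define M where "M = Suc (\<Sum>i<m. N i)"
    have "Var i ^ M \<in> I" if "i < m" for i
    proof -
      have "N i \<le> M" using that member_le_sum[of i "{..<m}" N] by (simp add: M_def)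
      then have "Var i ^ M = Var i ^ (M - N i) * Var i ^ N i" by (simp flip: power_add)
      then show ?thesis using N[OF that] is_idealD(3)[OF I] by simp
    qed
    then have nil: "ideal_pow m Var (m * M) \<subseteq> I" using m by (intro ideal_pow_nilpotent I) (auto simp: M_def)
    have lV: "ideal_pow m l e \<subseteq> ideal_pow m Var e" and Vl: "ideal_pow m Var e \<subseteq> ideal_pow m l e" for e
      using l1 l2 by (auto intro!: ideal_pow_subset del: subsetI)
    have "ideal_pow m Var (m + 1) \<subseteq> ideal_pow m l (m + 1)" by (rule Vl)
    also have "\<dots> \<subseteq> ideal_plus I (ideal_pow m l (m * M + m + 1))"
    proof (rule ideal_pow_collapse[OF I])
      fix i assume "i < m"
      have "ideal_plus I (ideal_pow m Var 3) \<subseteq> ideal_plus I (ideal_pow m l 3)"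
        using Vl[of 3] by (auto simp: ideal_plus_def)
      then show "l i * l i \<in> ideal_plus I (ideal_pow m l 3)" using sq[OF \<open>i < m\<close>] by (auto simp: I_def)
    qed auto
    also have "\<dots> \<subseteq> I"
    proof (rule ideal_plus_least[OF I order.refl])
      have "ideal_pow m l (m * M + m + 1) \<subseteq> ideal_pow m Var (m * M + m + 1)" by (rule lV)
      also have "\<dots> \<subseteq> ideal_pow m Var (m * M)" by (rule ideal_pow_antimono) simp
      finally show "ideal_pow m l (m * M + m + 1) \<subseteq> I" using nil by blast
    qed
    finally have small: "ideal_pow m Var (m + 1) \<subseteq> I" .
    define top where "top = (\<Sum>i<m. Poly_Mapping.single i (d i - 1))"
    have "mon top = (\<Prod>i<m. Var i ^ (d i - 1))"
    proof -
      have "mon (\<Sum>i<n. Poly_Mapping.single i (d i - 1)) = (\<Prod>i<n. Var i ^ (d i - 1))" for n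
      proof (induction n)
        case (Suc n)
        have "mon (a + b) = mon a * mon b" for a b by (simp add: mult_single)
        then show ?case by (simp only: sum.lessThan_Suc prod.lessThan_Suc Suc.IH Var_power)
      qed simp
      then show ?thesis by (simp add: top_def)
    qed
    also have "\<dots> \<in> ideal_pow m Var (\<Sum>i<m. d i - 1)"
    proof -
      have "(\<Prod>i<n. Var i ^ (d i - 1)) \<in> ideal_pow m Var (\<Sum>i<n. d i - 1)" if "n \<le> m" for n
        using that
      proof (induction n)
        case (Suc n)
        have "Var n ^ k \<in> ideal_pow m Var k" for k
          using Suc.prems by (induction k) (auto intro!: ideal_pow_SucI simp del: ideal_pow.simps(2))
        then show ?case using Suc by (auto intro!: ideal_pow_mult)
      qed simp
      then show ?thesis by simp
    qed
    also have "\<dots> \<subseteq> ideal_pow m Var (m + 1)"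
    proof (rule ideal_pow_antimono)
      \<comment> \<open>The degree equals m^2, but the bound \<open>(2 * m - 1) + (m - 1)\<close>
        suffices; it exceeds \<open>m\<close> because \<open>m \<ge> 2\<close>.\<close>
      have "(\<Sum>i<m. d i - 1) \<ge> (\<Sum>i\<in>{0,1}. d i - 1)" using m by (intro sum_mono2) auto
      moreover have "(\<Sum>i<m. d i - 1) = (d 0 - 1) + (\<Sum>i=1..<m. d i - 1)"
        using m by (simp add: sum.atLeast_Suc_lessThan flip: atLeast0LessThan)
      moreover have "(\<Sum>i=1..<m. d i - 1) \<ge> (\<Sum>i=1..<m. 1)" 
        using d1(1) by (intro sum_mono) (auto simp: d_def)
      ultimately show "m + 1 \<le> (\<Sum>i<m. d i - 1)" using m by (simp add: d_def)
    qed
    also note small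
    also note II'
    finally have "mon top \<in> I'" .
    then show False
      using top_monomial_notin_gen_ideal[of m d \<omega> \<rho>] d1 rho_wt by (auto simp: I'_def top_def)
  qed
qed

section \<open>Potentials in one dimension\<close>

text \<open>Words in the hopping operator \<open>u \<mapsto> a u(n+1) + b u(n-1)\<close> and the potential \<open>v\<close>:
  \<open>words a b v k j\<close> is the sum over all words of length \<open>k\<close> with exactly \<open>j\<close> factors \<open>v\<close>.\<close>

fun words :: "'a::comm_ring_1 \<Rightarrow> 'a \<Rightarrow> (int \<Rightarrow> 'a) \<Rightarrow> nat \<Rightarrow> nat \<Rightarrow> (int \<Rightarrow> 'a) \<Rightarrow> int \<Rightarrow> 'a" where
  "words a b v 0 j u n = (if j = 0 then u n else 0)"
| "words a b v (Suc k) j u n = a * words a b v k j u (n + 1) + b * words a b v k j u (n - 1)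
     + (case j of 0 \<Rightarrow> 0 | Suc i \<Rightarrow> v n * words a b v k i u n)"

definition schr :: "'a::comm_ring_1 \<Rightarrow> 'a \<Rightarrow> (int \<Rightarrow> 'a) \<Rightarrow> (int \<Rightarrow> 'a) \<Rightarrow> int \<Rightarrow> 'a" where
  "schr a b v u n = a * u (n + 1) + b * u (n - 1) + v n * u n"

definition delta :: "int \<Rightarrow> int \<Rightarrow> 'a::comm_ring_1" where
  "delta r n = (if n = r then 1 else 0)"

lemma words_eq_0: "k < j \<Longrightarrow> words a b v k j u n = 0"
proof (induction k arbitrary: j n)
  case (Suc k)
  then show ?case by (cases j) auto
qed auto

lemma schr_pow: "(schr a b v ^^ k) u n = (\<Sum>j\<le>k. words a b v k j u n)"
proof (induction k arbitrary: n)
  case (Suc k)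
  have "(\<Sum>j\<le>Suc k. words a b v (Suc k) j u n)
     = (\<Sum>j\<le>Suc k. a * words a b v k j u (n + 1) + b * words a b v k j u (n - 1))
       + (\<Sum>j\<le>Suc k. case j of 0 \<Rightarrow> 0 | Suc i \<Rightarrow> v n * words a b v k i u n)"
    by (simp only: words.simps sum.distrib)
  also have "(\<Sum>j\<le>Suc k. case j of 0 \<Rightarrow> 0 | Suc i \<Rightarrow> v n * words a b v k i u n)
      = (\<Sum>j\<le>k. v n * words a b v k j u n)"
    by (subst sum.atMost_Suc_shift) simp
  also have "(\<Sum>j\<le>Suc k. a * words a b v k j u (n + 1) + b * words a b v k j u (n - 1))
     = (\<Sum>j\<le>k. a * words a b v k j u (n + 1) + b * words a b v k j u (n - 1))"
    by (simp add: words_eq_0)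
  finally have "(\<Sum>j\<le>Suc k. words a b v (Suc k) j u n)
      = (\<Sum>j\<le>k. a * words a b v k j u (n + 1) + b * words a b v k j u (n - 1)) + (\<Sum>j\<le>k. v n * words a b v k j u n)" .
  then show ?case
    by (simp add: schr_def[of a b v "(schr a b v ^^ k) u" n] Suc.IH sum_distrib_left sum.distrib del: words.simps)
qed simp

text \<open>Only the \<open>k - j\<close> hops move the argument, so the word sees \<open>u\<close>
  no further away than that.\<close>

lemma words_cong:
  assumes "\<And>x. \<bar>x - n\<bar> \<le> int k - int j \<Longrightarrow> u x = u' x"
  shows "words a b v k j u n = words a b v k j u' n"
  using assms
proof (induction k arbitrary: j n)
  case (Suc k)
  have "words a b v k j u (n + 1) = words a b v k j u' (n + 1)"
    by (rule Suc.IH) (rule Suc.prems, auto)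
  moreover have "words a b v k j u (n - 1) = words a b v k j u' (n - 1)"
    by (rule Suc.IH) (rule Suc.prems, auto)
  moreover have "words a b v k i u n = words a b v k i u' n" if "j = Suc i" for i
    by (rule Suc.IH) (rule Suc.prems, use that in auto)
  ultimately show ?case by (cases j) auto
qed auto

text \<open>Conjugation with \<open>n \<mapsto> w ^ n\<close>: the total weight of a walk depends
  only on its net displacement. For closed walks on the integers the weight is therefore
  invisible.\<close>

lemma words_gauge:
  fixes w :: "'a::field"
  assumes "w \<noteq> 0"
  shows "words w (inverse w) v k j (delta r) n = w powi (r - n) * words 1 1 v k j (delta r) n"
proof (induction k arbitrary: j n)
  case (Suc k)
  have e: "w * w powi (r - (n + 1)) = w powi (r - n)" "inverse w * w powi (r - (n - 1)) = w powi (r - n)"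
    using power_int_add_1'[of w "r - (n + 1)"] power_int_add_1'[of w "r - n"] assms
    by (auto simp: algebra_simps)
  have "words w (inverse w) v (Suc k) j (delta r) n
    = (w * w powi (r - (n + 1))) * words 1 1 v k j (delta r) (n + 1)
      + (inverse w * w powi (r - (n - 1))) * words 1 1 v k j (delta r) (n - 1)
      + (case j of 0 \<Rightarrow> 0 | Suc i \<Rightarrow> v n * words w (inverse w) v k i (delta r) n)"
    by (simp only: words.simps Suc.IH mult.assoc)
  then show ?case unfolding e by (cases j) (simp_all add: Suc.IH algebra_simps)
qed (auto simp: delta_def)

text \<open>Walk counts: \<open>cnt1\<close> and \<open>cnt2\<close> are the coefficients of \<open>v (r+s)\<close> and \<open>v (r+s) * v (r+t)\<close> in
  the words with one and two factors \<open>v\<close>.\<close>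

fun cnt0 :: "nat \<Rightarrow> int \<Rightarrow> nat" where
  "cnt0 0 x = (if x = 0 then 1 else 0)"
| "cnt0 (Suc k) x = cnt0 k (x + 1) + cnt0 k (x - 1)"

fun cnt1 :: "nat \<Rightarrow> int \<Rightarrow> int \<Rightarrow> nat" where
  "cnt1 0 x s = 0"
| "cnt1 (Suc k) x s = cnt1 k (x + 1) s + cnt1 k (x - 1) s + (if x = s then cnt0 k x else 0)"

fun cnt2 :: "nat \<Rightarrow> int \<Rightarrow> int \<Rightarrow> int \<Rightarrow> nat" where
  "cnt2 0 x s t = 0"
| "cnt2 (Suc k) x s t = cnt2 k (x + 1) s t + cnt2 k (x - 1) s t + (if x = t then cnt1 k x s else 0)"

lemma cnt0_support: "cnt0 k x > 0 \<Longrightarrow> \<bar>x\<bar> \<le> int k"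
proof (induction k arbitrary: x)
  case (Suc k)
  from Suc.prems have "cnt0 k (x + 1) > 0 \<or> cnt0 k (x - 1) > 0" by auto
  then show ?case by (elim disjE) (drule Suc.IH, linarith)+
qed (auto split: if_splits)

lemma cnt1_support: "cnt1 k x s > 0 \<Longrightarrow> \<bar>s\<bar> + \<bar>x - s\<bar> + 1 \<le> int k"
proof (induction k arbitrary: x)
  case (Suc k)
  from Suc.prems have "cnt1 k (x + 1) s > 0 \<or> cnt1 k (x - 1) s > 0 \<or> (x = s \<and> cnt0 k x > 0)"
    by (auto split: if_splits)
  then show ?case
  proof (elim disjE conjE)
    assume "x = s" "cnt0 k x > 0"
    then show ?thesis using cnt0_support[of k x] by linarith
  qed (drule Suc.IH, linarith)+
qed auto

lemma cnt2_support: "cnt2 k x s t > 0 \<Longrightarrow> \<bar>s\<bar> + \<bar>t - s\<bar> + \<bar>x - t\<bar> + 2 \<le> int k"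
proof (induction k arbitrary: x)
  case (Suc k)
  from Suc.prems have "cnt2 k (x + 1) s t > 0 \<or> cnt2 k (x - 1) s t > 0 \<or> (x = t \<and> cnt1 k x s > 0)"
    by (auto split: if_splits)
  then show ?case
  proof (elim disjE conjE)
    assume "x = t" "cnt1 k x s > 0"
    then show ?thesis using cnt1_support[of k x s] by linarith
  qed (drule Suc.IH, linarith)+
qed auto

text \<open>The walk that takes up the potential at 0, goes straight to \<open>\<rho>\<close>, takes
  it up there and returns has \<open>2 * \<rho>\<close> hops and two factors.\<close>

lemma cnt2_pos: "cnt2 (2 * \<rho> + 2) 0 0 (int \<rho>) > 0"
proof -
  have 1: "cnt1 (Suc i) (int i) 0 > 0" for i
    by (induction i) auto
  have 2: "cnt2 (Suc (Suc (\<rho> + i))) (int \<rho> - int i) 0 (int \<rho>) > 0" for i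
  proof (induction i)
    case 0
    then show ?case using 1[of \<rho>] by simp
  next
    case (Suc i)
    have e: "int \<rho> - int (Suc i) + 1 = int \<rho> - int i" by simp
    show ?case using Suc.IH unfolding add_Suc_right cnt2.simps(2)[of "Suc (Suc (\<rho> + i))"] e by simp
  qed
  from 2[of \<rho>] show ?thesis by (simp add: mult_2)
qed

lemma words_0: "words 1 1 v k 0 (delta r) (r + x) = of_nat (cnt0 k x)"
proof (induction k arbitrary: x)
  case (Suc k)
  show ?case using Suc.IH[of "x + 1"] Suc.IH[of "x - 1"] by (simp add: algebra_simps)
qed (auto simp: delta_def)

lemma words_1:
  assumes "k \<le> N"
  shows "words 1 1 v k (Suc 0) (delta r) (r + x) = (\<Sum>s\<in>{-int N..int N}. of_nat (cnt1 k x s) * v (r + s))"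
  using assms
proof (induction k arbitrary: x)
  case (Suc k)
  have "v (r + x) * of_nat (cnt0 k x) = (\<Sum>s\<in>{-int N..int N}. if x = s then of_nat (cnt0 k x) * v (r + s) else 0)"
    using cnt0_support[of k x] Suc.prems by (cases "cnt0 k x = 0") (auto simp: mult.commute)
  then have e: "v (r + x) * words 1 1 v k 0 (delta r) (r + x) = \<dots>" by (simp only: words_0)
  have "words 1 1 v (Suc k) (Suc 0) (delta r) (r + x)
     = words 1 1 v k (Suc 0) (delta r) (r + (x + 1)) + words 1 1 v k (Suc 0) (delta r) (r + (x - 1))
       + v (r + x) * words 1 1 v k 0 (delta r) (r + x)"
    by (simp add: algebra_simps)
  also have "\<dots> = (\<Sum>s\<in>{-int N..int N}.
      of_nat (cnt1 k (x + 1) s) * v (r + s) + of_nat (cnt1 k (x - 1) s) * v (r + s)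
      + (if x = s then of_nat (cnt0 k x) * v (r + s) else 0))"
    unfolding e using Suc.prems by (simp only: Suc.IH Suc_leD sum.distrib)
  also have "\<dots> = (\<Sum>s\<in>{-int N..int N}. of_nat (cnt1 (Suc k) x s) * v (r + s))"
    by (intro sum.cong refl) (simp add: algebra_simps)
  finally show ?case .
qed auto

lemma words_2:
  assumes "k \<le> N"
  shows "words 1 1 v k (Suc (Suc 0)) (delta r) (r + x) =
    (\<Sum>s\<in>{-int N..int N}. \<Sum>t\<in>{-int N..int N}. of_nat (cnt2 k x s t) * (v (r + s) * v (r + t)))"
  using assms
proof (induction k arbitrary: x)
  case (Suc k)
  have "v (r + x) * words 1 1 v k (Suc 0) (delta r) (r + x)
     = (\<Sum>s\<in>{-int N..int N}. v (r + x) * (of_nat (cnt1 k x s) * v (r + s)))"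
    using words_1[of k N v r x] Suc.prems by (simp only: sum_distrib_left Suc_leD)
  also have "\<dots> = (\<Sum>s\<in>{-int N..int N}. \<Sum>t\<in>{-int N..int N}.
      if x = t then of_nat (cnt1 k x s) * (v (r + s) * v (r + t)) else 0)"
  proof (intro sum.cong refl)
    fix s
    show "v (r + x) * (of_nat (cnt1 k x s) * v (r + s)) = (\<Sum>t\<in>{-int N..int N}.
      if x = t then of_nat (cnt1 k x s) * (v (r + s) * v (r + t)) else 0)"
      using cnt1_support[of k x s] Suc.prems by (cases "cnt1 k x s = 0") (auto simp: mult_ac)
  qed
  finally have e: "v (r + x) * words 1 1 v k (Suc 0) (delta r) (r + x) = \<dots>" .
  have "words 1 1 v (Suc k) (Suc (Suc 0)) (delta r) (r + x)
     = words 1 1 v k (Suc (Suc 0)) (delta r) (r + (x + 1)) + words 1 1 v k (Suc (Suc 0)) (delta r) (r + (x - 1))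
       + v (r + x) * words 1 1 v k (Suc 0) (delta r) (r + x)"
    by (simp add: algebra_simps)
  also have "\<dots> = (\<Sum>s\<in>{-int N..int N}. \<Sum>t\<in>{-int N..int N}.
      of_nat (cnt2 k (x + 1) s t) * (v (r + s) * v (r + t)) + of_nat (cnt2 k (x - 1) s t) * (v (r + s) * v (r + t))
      + (if x = t then of_nat (cnt1 k x s) * (v (r + s) * v (r + t)) else 0))"
    unfolding e using Suc.prems by (simp only: Suc.IH Suc_leD sum.distrib)
  also have "\<dots> = (\<Sum>s\<in>{-int N..int N}. \<Sum>t\<in>{-int N..int N}. of_nat (cnt2 (Suc k) x s t) * (v (r + s) * v (r + t)))"
    by (intro sum.cong refl) (simp add: algebra_simps)
  finally show ?case .
qed auto

lemma words_full: "words a b v k k u n = v n ^ k * u n"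
proof (induction k)
  case (Suc k)
  then show ?case by (simp add: words_eq_0 mult.assoc)
qed auto

lemma words_wle:
  assumes "\<And>n. wle \<omega> W (v n)" "\<And>n. wle \<omega> 0 (u n)"
  shows "wle \<omega> (j * W) (words 1 1 v k j u n)"
proof (induction k arbitrary: j n)
  case 0
  show ?case using assms(2)[of n] by auto
next
  case (Suc k)
  show ?case
  proof (cases j)
    case 0
    then show ?thesis using Suc.IH[of 0] by (auto intro: wle_add)
  next
    case (Suc i)
    have "wle \<omega> (W + i * W) (v n * words 1 1 v k i u n)"
      by (intro wle_mult assms Suc.IH \<open>\<And>j n. wle \<omega> (j * W) (words 1 1 v k j u n)\<close>)
    then show ?thesis using \<open>\<And>j n. wle \<omega> (j * W) (words 1 1 v k j u n)\<close>[of j] Suc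
      by (auto intro!: wle_add)
  qed
qed

lemma words_ideal_pow:
  assumes "\<And>n. v n \<in> ideal_pow m g 1"
  shows "words 1 1 v k j u n \<in> ideal_pow m g j"
proof (induction k arbitrary: j n)
  case 0
  show ?case by (auto simp: is_idealD(1)[OF is_ideal_pow] simp del: ideal_pow.simps(2))
next
  case (Suc k)
  note IH = Suc.IH
  have "words 1 1 v k j u (n + 1) + words 1 1 v k j u (n - 1) \<in> ideal_pow m g j"
    by (rule is_idealD(2)[OF is_ideal_pow IH IH])
  moreover have "v n * words 1 1 v k i u n \<in> ideal_pow m g j" if "j = Suc i" for i
    using ideal_pow_mult[OF assms IH, of n i n] that by (simp del: ideal_pow.simps(2))
  ultimately show ?case
    using is_idealD(2)[OF is_ideal_pow] by (cases j) (auto simp del: ideal_pow.simps(2))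
qed

lemma schr_pow_cong_mod:
  assumes J: "is_ideal J" and v: "\<And>n. v n - v' n \<in> J"
  shows "(schr 1 1 v ^^ k) u n - (schr 1 1 v' ^^ k) u n \<in> J"
proof (induction k arbitrary: n)
  case 0
  show ?case using is_idealD(1)[OF J] by simp
next
  case (Suc k)
  define x where "x = (schr 1 1 v ^^ k) u"
  define y where "y = (schr 1 1 v' ^^ k) u"
  have IH: "x n - y n \<in> J" for n using Suc.IH by (simp add: x_def y_def)
  have "(schr 1 1 v ^^ Suc k) u n - (schr 1 1 v' ^^ Suc k) u n
    = (x (n + 1) - y (n + 1)) + (x (n - 1) - y (n - 1)) + (v n * (x n - y n) + y n * (v n - v' n))"
    by (simp add: schr_def x_def y_def algebra_simps)
  also have "\<dots> \<in> J"
    by (rule is_idealD(2)[OF J is_idealD(2)[OF J IH IH]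
          is_idealD(2)[OF J is_idealD(3)[OF J IH] is_idealD(3)[OF J v]]])
  finally show ?case .
qed

lemma schr_pow_Const:
  "(schr 1 1 (\<lambda>n. Const (v n)) ^^ k) (\<lambda>n. Const (u n)) n = Const ((schr 1 1 v ^^ k) u n)"
  by (induction k arbitrary: n) (auto simp: schr_def)

lemma period_mod:
  assumes "\<And>n. f (n + int q) = f n"
  shows "f (n mod int q) = f n"
proof -
  have pos: "f (n + int q * int k) = f n" for n k
  proof (induction k)
    case (Suc k)
    have "f (n + int q * int (Suc k)) = f ((n + int q * int k) + int q)" by (simp add: algebra_simps)
    then show ?case using assms Suc by simp
  qed simp
  have "f (n + int q * k) = f n" for n k
  proof (cases "k \<ge> 0")
    case True
    then show ?thesis using pos[of n "nat k"] by simp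
  next
    case False
    then show ?thesis using pos[of "n + int q * k" "nat (- k)"] by simp
  qed
  from this[of "n mod int q" "n div int q"] show ?thesis by simp
qed

lemma period_sum_shift:
  assumes "\<And>n. f (n + int q) = f n" "q > 0"
  shows "(\<Sum>r\<in>{0..<int q}. f (r + s)) = (\<Sum>r\<in>{0..<int q}. f r)"
proof (rule sum.reindex_bij_witness[of _ "\<lambda>r. (r - s) mod int q" "\<lambda>r. (r + s) mod int q"])
  fix r assume "r \<in> {0..<int q}"
  then show "f ((r + s) mod int q) = f (r + s)" "((r + s) mod int q - s) mod int q = r"
    "((r - s) mod int q + s) mod int q = r"
    by (simp_all add: period_mod[of f, OF assms(1)] mod_diff_left_eq mod_add_left_eq)
qed (use assms in auto)

lemma period_sum_reflect:
  assumes "\<And>n. f (n + int q) = f n" "q > 0"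
  shows "(\<Sum>r\<in>{0..<int q}. f (- 1 - r)) = (\<Sum>r\<in>{0..<int q}. f r)"
proof (rule sum.reindex_bij_witness[of _ "\<lambda>r. (- 1 - r) mod int q" "\<lambda>r. (- 1 - r) mod int q"])
  fix r assume "r \<in> {0..<int q}"
  then show "f ((- 1 - r) mod int q) = f (- 1 - r)"
    "(- 1 - (- 1 - r) mod int q) mod int q = r" "(- 1 - (- 1 - r) mod int q) mod int q = r"
    by (simp_all add: period_mod[of f, OF assms(1)] mod_diff_right_eq)
qed (use assms in auto)

section \<open>Traces per period: walks closed on the integers, without winding\<close>

definition trq :: "nat \<Rightarrow> (int \<Rightarrow> 'a::comm_ring_1) \<Rightarrow> nat \<Rightarrow> 'a" where
  "trq q v k = (\<Sum>r\<in>{0..<int q}. (schr 1 1 v ^^ k) (delta r) r)"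

definition trw :: "nat \<Rightarrow> (int \<Rightarrow> 'a::comm_ring_1) \<Rightarrow> nat \<Rightarrow> nat \<Rightarrow> 'a" where
  "trw q v k j = (\<Sum>r\<in>{0..<int q}. words 1 1 v k j (delta r) r)"

definition corr :: "nat \<Rightarrow> (int \<Rightarrow> 'a::comm_ring_1) \<Rightarrow> int \<Rightarrow> 'a" where
  "corr q v x = (\<Sum>r\<in>{0..<int q}. v r * v (r + x))"

lemma trq_eq: "trq q v k = (\<Sum>j\<le>k. trw q v k j)"
  unfolding trq_def trw_def schr_pow by (rule sum.swap)

lemma trw_0: "trw q v k 0 = trq q (\<lambda>_. 0) k"
proof -
  have z: "words 1 1 (\<lambda>_. 0 :: 'a) k (Suc j) u n = 0" for k j u n
    by (induction k arbitrary: j n) auto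
  have "trq q (\<lambda>_. 0 :: 'a) k = (\<Sum>j\<in>{0}. trw q (\<lambda>_. 0) k j)"
    unfolding trq_eq
  proof (rule sum.mono_neutral_right)
    show "\<forall>j\<in>{..k} - {0}. trw q (\<lambda>_. 0 :: 'a) k j = 0"
    proof
      fix j assume "j \<in> {..k} - {0}"
      then show "trw q (\<lambda>_. 0 :: 'a) k j = 0" using z[of k "j - 1"] by (cases j) (auto simp: trw_def)
    qed
  qed auto
  also have "\<dots> = trw q v k 0"
    using words_0[of "\<lambda>_. 0 :: 'a" k _ 0] words_0[of v k _ 0] by (simp add: trw_def)
  finally show ?thesis by simp
qed

lemma trq_diff: "trq q v k - trq q (\<lambda>_. 0) k = (\<Sum>j=1..k. trw q v k j)"
proof -
  have "(\<Sum>j\<le>k. trw q v k j) = trw q v k 0 + (\<Sum>j=1..k. trw q v k j)"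
    by (simp add: atMost_atLeast0 sum.atLeast_Suc_atMost)
  then show ?thesis by (simp add: trq_eq[of q v] trw_0)
qed

context
  fixes q :: nat and v :: "int \<Rightarrow> 'a::comm_ring_1"
  assumes q: "q > 0" and per: "\<And>n. v (n + int q) = v n"
begin

lemma trw_1: "trw q v k 1 = of_nat (\<Sum>s\<in>{-int k..int k}. cnt1 k 0 s) * (\<Sum>r\<in>{0..<int q}. v r)"
proof -
  have "trw q v k 1 = (\<Sum>r\<in>{0..<int q}. \<Sum>s\<in>{-int k..int k}. of_nat (cnt1 k 0 s) * v (r + s))"
    using words_1[of k k v _ 0] by (simp add: trw_def)
  also have "\<dots> = (\<Sum>s\<in>{-int k..int k}. of_nat (cnt1 k 0 s) * (\<Sum>r\<in>{0..<int q}. v (r + s)))"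
    by (subst sum.swap) (simp add: sum_distrib_left)
  also have "\<dots> = (\<Sum>s\<in>{-int k..int k}. of_nat (cnt1 k 0 s) * (\<Sum>r\<in>{0..<int q}. v r))"
    using period_sum_shift[of v q] per q by simp
  finally show ?thesis by (simp add: sum_distrib_right)
qed

lemma corr_shift: "(\<Sum>r\<in>{0..<int q}. v (r + s) * v (r + t)) = corr q v (t - s)"
proof -
  have "(\<Sum>r\<in>{0..<int q}. v (r + s) * v ((r + s) + (t - s))) = corr q v (t - s)"
    unfolding corr_def
  proof (rule period_sum_shift[of "\<lambda>r. v r * v (r + (t - s))"])
    fix n
    have "v (n + int q + (t - s)) = v (n + (t - s))" using per[of "n + (t - s)"] by (simp add: algebra_simps)
    then show "v (n + int q) * v (n + int q + (t - s)) = v n * v (n + (t - s))" by (simp add: per)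
  qed (rule q)
  then show ?thesis by simp
qed

lemma corr_minus: "corr q v (- x) = corr q v x"
  using corr_shift[of x 0] by (simp add: corr_def mult.commute)

lemma corr_period: "corr q v (x + int q) = corr q v x"
  using per by (simp add: corr_def add.assoc[symmetric])

lemma trw_2:
  "trw q v k 2 = (\<Sum>s\<in>{-int k..int k}. \<Sum>t\<in>{-int k..int k}. of_nat (cnt2 k 0 s t) * corr q v (t - s))"
proof -
  have "trw q v k 2 = (\<Sum>r\<in>{0..<int q}. \<Sum>s\<in>{-int k..int k}. \<Sum>t\<in>{-int k..int k}.
      of_nat (cnt2 k 0 s t) * (v (r + s) * v (r + t)))"
    using words_2[of k k v _ 0] by (simp add: trw_def numeral_2_eq_2)
  also have "\<dots> = (\<Sum>s\<in>{-int k..int k}. \<Sum>t\<in>{-int k..int k}.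
      \<Sum>r\<in>{0..<int q}. of_nat (cnt2 k 0 s t) * (v (r + s) * v (r + t)))"
    by (subst sum.swap) (intro sum.cong refl sum.swap)
  finally show ?thesis by (simp add: corr_shift flip: sum_distrib_left)
qed

text \<open>Supplies the one linear relation between the autocorrelations that the traces of degree
  two do not provide.\<close>

lemma sum_corr: "(\<Sum>x\<in>{0..<int q}. corr q v x) = (\<Sum>r\<in>{0..<int q}. v r) ^ 2"
proof -
  have "(\<Sum>x\<in>{0..<int q}. corr q v x) = (\<Sum>r\<in>{0..<int q}. v r * (\<Sum>x\<in>{0..<int q}. v (x + r)))"
    unfolding corr_def sum_distrib_left by (subst sum.swap) (simp add: add.commute)
  then show ?thesis
    using period_sum_shift[of v q] per q by (simp add: power2_eq_square sum_distrib_right)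
qed

end

text \<open>The potential that is odd under the reflection \<open>n \<mapsto> - 1 - n\<close>, with
  \<open>q div 2\<close> free values. For odd \<open>q\<close> the middle site is its own mirror
  image modulo \<open>q\<close>, hence the value 0.\<close>

definition refl_pot :: "nat \<Rightarrow> (nat \<Rightarrow> 'a::comm_ring_1) \<Rightarrow> int \<Rightarrow> 'a" where
  "refl_pot q Z n = (let i = nat (n mod int q) in
     if i < q div 2 then Z i else if q - q div 2 \<le> i then - Z (q - 1 - i) else 0)"

lemma refl_pot_period: "refl_pot q Z (n + int q) = refl_pot q Z n"
  by (simp add: refl_pot_def)

lemma refl_pot_reflect:
  assumes "q > 0"
  shows "refl_pot q Z (- 1 - n) = - refl_pot q Z n"
proof -
  define i where "i = nat (n mod int q)"
  have i: "i < q" using assms by (simp add: i_def nat_less_iff)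
  have "(- 1 - n) mod int q = (- 1 - int i) mod int q"
    using assms by (simp add: i_def mod_diff_right_eq)
  also have "\<dots> = (- 1 - int i + int q) mod int q" by simp
  also have "\<dots> = int (q - 1 - i)"
  proof -
    have "- 1 - int i + int q = int (q - 1 - i)" using i by (simp add: of_nat_diff)
    then show ?thesis using i by (simp del: of_nat_diff)
  qed
  finally have "nat ((- 1 - n) mod int q) = q - 1 - i" by simp
  then show ?thesis using i unfolding refl_pot_def i_def[symmetric] Let_def by auto
qed

lemma refl_pot_small: "i < q div 2 \<Longrightarrow> refl_pot q Z (int i) = Z i"
  by (simp add: refl_pot_def nat_mod_distrib)

lemma refl_pot_cases:
  assumes "q > 0"
  obtains i where "i < q div 2" "refl_pot q Z n = Z i" | i where "i < q div 2" "refl_pot q Z n = - Z i"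
  | "refl_pot q Z n = 0"
proof -
  define i where "i = nat (n mod int q)"
  have i: "i < q" using assms by (simp add: i_def nat_less_iff)
  have e: "refl_pot q Z n = (if i < q div 2 then Z i else if q - q div 2 \<le> i then - Z (q - 1 - i) else 0)"
    by (simp add: refl_pot_def i_def Let_def)
  consider "i < q div 2" | "\<not> i < q div 2" "q - q div 2 \<le> i" | "\<not> i < q div 2" "\<not> q - q div 2 \<le> i"
    by blast
  then show ?thesis
  proof cases
    case 1
    then show ?thesis using that(1)[of i] e by simp
  next
    case 2
    then have "q - 1 - i < q div 2" using i by linarith
    then show ?thesis using that(2)[of "q - 1 - i"] e 2 by simp
  next
    case 3
    then show ?thesis using that(3) e by simp
  qed
qed

lemma sum_refl_pot_power:
  assumes "q > 0" "k > 0"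
  shows "(\<Sum>r\<in>{0..<int q}. refl_pot q Z r ^ (2 * k)) = 2 * (\<Sum>i<q div 2. Z i ^ (2 * k))"
proof -
  define m where "m = q div 2"
  have "(\<Sum>r\<in>{0..<int q}. refl_pot q Z r ^ (2 * k)) = (\<Sum>i<q. refl_pot q Z (int i) ^ (2 * k))"
    by (rule sum.reindex_bij_witness[of _ int nat]) auto
  also have "\<dots> = (\<Sum>i<q. (if i < m then Z i ^ (2 * k) else 0) + (if q - m \<le> i then Z (q - 1 - i) ^ (2 * k) else 0))"
    using assms by (intro sum.cong refl) (auto simp: refl_pot_def m_def Let_def power_mult nat_mod_distrib zero_power)
  also have "\<dots> = (\<Sum>i<q. if i < m then Z i ^ (2 * k) else 0) + (\<Sum>i<q. if q - m \<le> i then Z (q - 1 - i) ^ (2 * k) else 0)"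
    by (rule sum.distrib)
  also have "(\<Sum>i<q. if q - m \<le> i then Z (q - 1 - i) ^ (2 * k) else 0) = (\<Sum>i<q. if i < m then Z i ^ (2 * k) else 0)"
    using assms by (intro sum.reindex_bij_witness[of _ "\<lambda>i. q - 1 - i" "\<lambda>i. q - 1 - i"]) (auto simp: m_def)
  also have "(\<Sum>i<q. if i < m then Z i ^ (2 * k) else 0) = (\<Sum>i<m. Z i ^ (2 * k))"
    by (rule sum.mono_neutral_cong_right) (auto simp: m_def)
  finally show ?thesis by (simp add: m_def)
qed

lemma mpoly_half: "Const (1 / 2) * (2 * f) = f"
proof -
  have "Const (1 / 2) * (2 * f) = Const (1 / 2 * of_nat 2) * f"
    by (simp only: Const_simps mult.assoc) simp
  then show ?thesis by simp
qed

section \<open>Discrete Fourier transform over one period\<close>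

context
  fixes q :: nat
  assumes q: "q > 0"
begin

definition ph :: "int \<Rightarrow> complex" where
  "ph x = cis (2 * pi * real_of_int x / real q)"

lemma ph_add: "ph (x + y) = ph x * ph y"
  by (simp add: ph_def cis_mult add_divide_distrib distrib_left)

lemma ph_0 [simp]: "ph 0 = 1"
  by (simp add: ph_def)

lemma ph_power: "ph x ^ n = ph (int n * x)"
  by (induction n) (simp_all add: ph_add distrib_right)

lemma ph_period: "ph (int q * k) = 1"
  using q cis_multiple_2pi[of "real_of_int k"] by (simp add: ph_def mult_ac)

lemma ph_eq_1: "ph x = 1 \<Longrightarrow> int q dvd x"
proof -
  assume "ph x = 1"
  then have "cos (2 * pi * real_of_int x / real q) = 1" by (metis cis.simps(1) ph_def one_complex.simps(1))
  then obtain k :: int where "2 * pi * real_of_int x / real q = of_int k * 2 * pi"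
    using cos_one_2pi_int by auto
  then have "real_of_int x = of_int (k * int q)" using q by (simp add: field_simps)
  then show "int q dvd x" by (metis dvd_triv_right of_int_eq_iff)
qed

lemma ph_orth: "(\<Sum>k\<in>{0..<int q}. ph (k * x)) = (if int q dvd x then of_nat q else 0)"
proof -
  have "(\<Sum>k\<in>{0..<int q}. ph (k * x)) = (\<Sum>i<q. ph x ^ i)"
    by (rule sum.reindex_bij_witness[of _ int nat]) (auto simp: ph_power)
  also have "\<dots> = (if int q dvd x then of_nat q else 0)"
  proof (cases "int q dvd x")
    case True
    then have "ph x = 1" using ph_period by auto
    then show ?thesis using True by simp
  next
    case False
    have "ph x ^ q = 1" by (simp add: ph_power ph_period)
    moreover have "ph x \<noteq> 1" using False ph_eq_1 by blast
    ultimately show ?thesis using False by (simp add: sum_gp_strict)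
  qed
  finally show ?thesis .
qed

context
  fixes v :: "int \<Rightarrow> mpoly"
  assumes per: "\<And>n. v (n + int q) = v n"
begin

definition four :: "int \<Rightarrow> mpoly" where
  "four k = (\<Sum>n\<in>{0..<int q}. Const (ph (k * n)) * v n)"

lemma four_period: "four (k + int q) = four k"
  by (simp add: four_def distrib_right ph_add ph_period)

text \<open>The product at opposite frequencies is the Fourier transform of the
  autocorrelation.\<close>

lemma four_mult_minus:
  "four k * four (- k) = (\<Sum>x\<in>{0..<int q}. Const (ph (- (k * x))) * corr q v x)"
proof -
  have "(\<Sum>x\<in>{0..<int q}. Const (ph (- (k * x))) * corr q v x)
     = (\<Sum>r\<in>{0..<int q}. \<Sum>x\<in>{0..<int q}. Const (ph (- (k * x))) * (v r * v (r + x)))"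
    unfolding corr_def sum_distrib_left by (rule sum.swap)
  also have "\<dots> = (\<Sum>r\<in>{0..<int q}. \<Sum>x\<in>{0..<int q}. Const (ph (k * r)) * v r * (Const (ph (- k * x)) * v x))"
  proof (rule sum.cong[OF refl])
    fix r assume "r \<in> {0..<int q}"
    have "(\<Sum>x\<in>{0..<int q}. Const (ph (k * r - k * (x + r))) * (v r * v (x + r)))
        = (\<Sum>x\<in>{0..<int q}. Const (ph (k * r - k * x)) * (v r * v x))"
    proof (rule period_sum_shift[of "\<lambda>x. Const (ph (k * r - k * x)) * (v r * v x)"])
      fix n
      have "ph (k * r - k * (n + int q)) = ph ((k * r - k * n) + int q * (- k))" by (simp add: algebra_simps)
      then show "Const (ph (k * r - k * (n + int q))) * (v r * v (n + int q)) = Const (ph (k * r - k * n)) * (v r * v n)"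
        by (simp only: ph_add ph_period per mult_1_right)
    qed (rule q)
    also have "\<dots> = (\<Sum>x\<in>{0..<int q}. Const (ph (k * r)) * v r * (Const (ph (- k * x)) * v x))"
      using ph_add[of "k * r" "- k * x" for x] by (intro sum.cong refl) (simp add: mult_ac)
    finally show "(\<Sum>x\<in>{0..<int q}. Const (ph (- (k * x))) * (v r * v (r + x))) = \<dots>"
      by (simp add: algebra_simps)
  qed
  also have "\<dots> = four k * four (- k)"
    unfolding four_def sum_product by simp
  finally show ?thesis by simp
qed

lemma four_inverse:
  assumes "n \<in> {0..<int q}"
  shows "(\<Sum>k\<in>{0..<int q}. Const (ph (- (k * n))) * four k) = of_nat q * v n"
proof -
  have tm: "Const (ph (- (k * n))) * (Const (ph (k * l)) * v l) = Const (ph (k * (l - n))) * v l" for k l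
  proof -
    have "k * (l - n) = - (k * n) + k * l" by (simp add: algebra_simps)
    then have "ph (k * (l - n)) = ph (- (k * n)) * ph (k * l)" by (simp only: ph_add)
    then show ?thesis by (simp add: mult.assoc)
  qed
  have "(\<Sum>k\<in>{0..<int q}. Const (ph (- (k * n))) * four k)
     = (\<Sum>k\<in>{0..<int q}. \<Sum>l\<in>{0..<int q}. Const (ph (k * (l - n))) * v l)"
    unfolding four_def sum_distrib_left tm ..
  also have "\<dots> = (\<Sum>l\<in>{0..<int q}. \<Sum>k\<in>{0..<int q}. Const (ph (k * (l - n))) * v l)"
    by (rule sum.swap)
  also have "\<dots> = (\<Sum>l\<in>{0..<int q}. (if int q dvd l - n then of_nat q else 0) * v l)"
    unfolding sum_distrib_right[symmetric] Const.hom_sum[symmetric] ph_orth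
    by (intro sum.cong refl) simp
  also have "\<dots> = (\<Sum>l\<in>{0..<int q}. if l = n then of_nat q * v l else 0)"
  proof (intro sum.cong refl)
    fix l assume "l \<in> {0..<int q}"
    then have "int q dvd l - n \<longleftrightarrow> l = n"
      using assms by (auto simp: mod_eq_dvd_iff[symmetric])
    then show "(if int q dvd l - n then of_nat q else 0) * v l = (if l = n then of_nat q * v l else 0)"
      by simp
  qed
  finally show ?thesis using assms by simp
qed

text \<open>The reflection reverses the frequency. The reflection centre is \<open>- 1 / 2\<close>
  rather than 0, which produces the phase \<open>ph k\<close>.\<close>

lemma four_minus:
  assumes "\<And>n. v (- 1 - n) = - v n"
  shows "four (- k) = - (Const (ph k) * four k)"
proof -
  have "four (- k) = (\<Sum>n\<in>{0..<int q}. Const (ph (- k * (- 1 - n))) * v (- 1 - n))"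
    unfolding four_def
  proof (rule period_sum_reflect[of "\<lambda>n. Const (ph (- k * n)) * v n", symmetric])
    fix n
    have "ph (- k * (n + int q)) = ph (- k * n + int q * (- k))" by (simp add: algebra_simps)
    then show "Const (ph (- k * (n + int q))) * v (n + int q) = Const (ph (- k * n)) * v n"
      by (simp only: ph_add ph_period per mult_1_right)
  qed (rule q)
  also have "\<dots> = (\<Sum>n\<in>{0..<int q}. - (Const (ph k) * (Const (ph (k * n)) * v n)))"
    using assms ph_add[of k "k * n" for n] by (intro sum.cong refl) (simp add: algebra_simps)
  finally show ?thesis by (simp add: four_def sum_negf sum_distrib_left)
qed

end

end

text \<open>The trace of degree two in length \<open>2 * \<rho> + 2\<close> involves only
  correlations at distances up to \<open>\<rho>\<close>, the last one with a positive coefficient.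
  This triangular system yields all distances below \<open>q div 2\<close>, and symmetry and
  periodicity their mirror images.\<close>

lemma corr_mem:
  fixes v :: "int \<Rightarrow> mpoly"
  assumes q: "q > 0" and per: "\<And>n. v (n + int q) = v n" and J: "is_ideal J"
    and sum0: "(\<Sum>r\<in>{0..<int q}. v r) = 0"
    and tr2: "\<And>k. 1 \<le> k \<Longrightarrow> k \<le> q div 2 \<Longrightarrow> trw q v (2 * k) 2 \<in> J"
  shows "corr q v x \<in> J"
proof -
  note corr_minus = corr_minus[of q v, OF q per]
  note corr_period = corr_period[of q v, OF q per]
  have of_nat_cancel: "f \<in> J" if "of_nat n * f \<in> J" "n > 0" for n f
  proof -
    have "f = Const (1 / of_nat n * of_nat n) * f" using that by simp
    also have "\<dots> = Const (1 / of_nat n) * (of_nat n * f)" by (simp only: Const_simps mult.assoc)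
    also have "\<dots> \<in> J" using is_idealD(3)[OF J] that by blast
    finally show ?thesis .
  qed
  have small: "corr q v (int \<rho>) \<in> J" if "\<rho> < q div 2" for \<rho>
    using that
  proof (induction \<rho> rule: less_induct)
    case (less \<rho>)
    define k where "k = 2 * \<rho> + 2"
    define S where "S = {-int k..int k} \<times> {-int k..int k}"
    define D where "D = {p \<in> S. \<bar>snd p - fst p\<bar> = int \<rho>}"
    have abs: "corr q v x = corr q v \<bar>x\<bar>" for x
      using corr_minus[of x] by (cases "x \<ge> 0") auto
    have "trw q v k 2 = (\<Sum>p\<in>S. of_nat (cnt2 k 0 (fst p) (snd p)) * corr q v (snd p - fst p))"
      unfolding trw_2[of q v, OF q per] S_def by (subst sum.cartesian_product) (simp add: case_prod_beta)
    also have "\<dots> = (\<Sum>p\<in>D. of_nat (cnt2 k 0 (fst p) (snd p)) * corr q v (snd p - fst p))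
       + (\<Sum>p\<in>S-D. of_nat (cnt2 k 0 (fst p) (snd p)) * corr q v (snd p - fst p))"
      by (subst sum.subset_diff[of D S]) (auto simp: D_def S_def add.commute)
    also have "(\<Sum>p\<in>D. of_nat (cnt2 k 0 (fst p) (snd p)) * corr q v (snd p - fst p))
       = of_nat (\<Sum>p\<in>D. cnt2 k 0 (fst p) (snd p)) * corr q v (int \<rho>)"
      unfolding of_nat_sum sum_distrib_right
    proof (intro sum.cong refl)
      fix p assume "p \<in> D"
      then have "corr q v (snd p - fst p) = corr q v (int \<rho>)" using abs[of "snd p - fst p"] by (simp add: D_def)
      then show "of_nat (cnt2 k 0 (fst p) (snd p)) * corr q v (snd p - fst p)
        = of_nat (cnt2 k 0 (fst p) (snd p)) * corr q v (int \<rho>)" by simp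
    qed
    finally have eq: "of_nat (\<Sum>p\<in>D. cnt2 k 0 (fst p) (snd p)) * corr q v (int \<rho>)
      = trw q v k 2 - (\<Sum>p\<in>S-D. of_nat (cnt2 k 0 (fst p) (snd p)) * corr q v (snd p - fst p))" by simp
    have "trw q v k 2 \<in> J" using tr2[of "\<rho> + 1"] less.prems by (simp add: k_def)
    moreover have "(\<Sum>p\<in>S-D. of_nat (cnt2 k 0 (fst p) (snd p)) * corr q v (snd p - fst p)) \<in> J"
    proof (rule is_ideal_sum[OF J])
      fix p assume p: "p \<in> S - D"
      show "of_nat (cnt2 k 0 (fst p) (snd p)) * corr q v (snd p - fst p) \<in> J"
      proof (cases "cnt2 k 0 (fst p) (snd p) = 0")
        case True
        then show ?thesis using is_idealD(1)[OF J] by simp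
      next
        case False
        then have "\<bar>fst p\<bar> + \<bar>snd p - fst p\<bar> + \<bar>0 - snd p\<bar> + 2 \<le> int k"
          using cnt2_support[of k 0 "fst p" "snd p"] by blast
        then have "\<bar>snd p - fst p\<bar> \<le> int \<rho>" by (simp add: k_def)
        then have lt: "\<bar>snd p - fst p\<bar> < int \<rho>" using p by (auto simp: D_def)
        then have "corr q v (int (nat \<bar>snd p - fst p\<bar>)) \<in> J"
          using less.prems by (intro less.IH) auto
        then have "corr q v (snd p - fst p) \<in> J" using abs[of "snd p - fst p"] by simp
        then show ?thesis by (rule is_idealD(3)[OF J])
      qed
    qed
    ultimately have "of_nat (\<Sum>p\<in>D. cnt2 k 0 (fst p) (snd p)) * corr q v (int \<rho>) \<in> J"
      unfolding eq by (rule is_idealD(6)[OF J])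
    moreover have "(\<Sum>p\<in>D. cnt2 k 0 (fst p) (snd p)) > 0"
    proof -
      have "(0, int \<rho>) \<in> D" "finite D" by (auto simp: D_def S_def k_def)
      moreover have "cnt2 k 0 (fst (0, int \<rho>)) (snd (0, int \<rho>)) > 0" using cnt2_pos[of \<rho>] by (simp add: k_def)
      ultimately show ?thesis by (meson sum_pos2 zero_le)
    qed
    ultimately show ?case by (rule of_nat_cancel)
  qed
  define m where "m = q div 2"
  have large: "corr q v (int \<rho>) \<in> J" if "\<rho> < q" "\<rho> > q - m" for \<rho>
  proof -
    have "corr q v (int \<rho>) = corr q v (- int \<rho> + int q)" by (simp only: corr_minus corr_period)
    also have "- int \<rho> + int q = int (q - \<rho>)" using that by simp
    also have "corr q v \<dots> \<in> J" by (rule small) (use that m_def in linarith)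
    finally show ?thesis .
  qed
  have mid: "corr q v (int \<rho>) = corr q v (int m)" if "m \<le> \<rho>" "\<rho> \<le> q - m" for \<rho>
  proof -
    have "\<rho> = m \<or> \<rho> = q - m" using that by (auto simp: m_def)
    moreover have "corr q v (int (q - m)) = corr q v (int m)"
    proof -
      have "corr q v (int m) = corr q v (- int m + int q)" by (simp only: corr_minus corr_period)
      also have "- int m + int q = int (q - m)" by (simp add: m_def)
      finally show ?thesis by simp
    qed
    ultimately show ?thesis by auto
  qed
  \<comment> \<open>The distances still missing lie between \<open>m\<close> and
    \<open>q - m\<close> and share one value. It follows from the others, since all correlations
    over a period sum to the square of the mean-free total, which is 0.\<close>
  have cm: "corr q v (int m) \<in> J"
  proof -
    have "(\<Sum>i<q. corr q v (int i)) = 0"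
    proof -
      have "(\<Sum>i<q. corr q v (int i)) = (\<Sum>x\<in>{0..<int q}. corr q v x)"
        by (rule sum.reindex_bij_witness[of _ nat int]) auto
      then show ?thesis using sum_corr[of q v, OF q per] sum0 by simp
    qed
    moreover have "(\<Sum>i<q. corr q v (int i))
      = (\<Sum>i\<in>{m..q-m} \<inter> {..<q}. corr q v (int i)) + (\<Sum>i\<in>{..<q} - {m..q-m}. corr q v (int i))"
      by (subst sum.Int_Diff[of _ _ "{m..q-m}"]) (auto simp: Int_commute)
    ultimately have "(\<Sum>i\<in>{m..q-m} \<inter> {..<q}. corr q v (int i)) = - (\<Sum>i\<in>{..<q} - {m..q-m}. corr q v (int i))"
      by (simp add: eq_neg_iff_add_eq_0)
    moreover have "(\<Sum>i\<in>{m..q-m} \<inter> {..<q}. corr q v (int i)) = of_nat (card ({m..q-m} \<inter> {..<q})) * corr q v (int m)"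
    proof -
      have "(\<Sum>i\<in>{m..q-m} \<inter> {..<q}. corr q v (int i)) = (\<Sum>i\<in>{m..q-m} \<inter> {..<q}. corr q v (int m))"
        by (intro sum.cong[OF refl] mid) auto
      then show ?thesis by simp
    qed
    moreover have "(\<Sum>i\<in>{..<q} - {m..q-m}. corr q v (int i)) \<in> J"
    proof (rule is_ideal_sum[OF J])
      fix i assume "i \<in> {..<q} - {m..q-m}"
      then consider "i < m" | "i < q" "i > q - m" by fastforce
      then show "corr q v (int i) \<in> J" by cases (use small large m_def in auto)
    qed
    ultimately have "of_nat (card ({m..q-m} \<inter> {..<q})) * corr q v (int m) \<in> J"
      using is_idealD(5)[OF J] by simp
    moreover have "m \<in> {m..q-m} \<inter> {..<q}" using q by (auto simp: m_def)
    then have "card ({m..q-m} \<inter> {..<q}) > 0" by (auto simp: card_gt_0_iff)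
    ultimately show ?thesis by (rule of_nat_cancel)
  qed
  have all: "corr q v (int \<rho>) \<in> J" if "\<rho> < q" for \<rho>
  proof -
    consider "\<rho> < m" | "m \<le> \<rho>" "\<rho> \<le> q - m" | "\<rho> > q - m" by linarith
    then show ?thesis
    proof cases
      case 1
      then show ?thesis by (intro small) (simp add: m_def)
    next
      case 2
      then show ?thesis using cm mid[OF 2] by (simp only:)
    next
      case 3
      then show ?thesis using that by (intro large)
    qed
  qed
  have "corr q v x = corr q v (x mod int q)"
    using period_mod[of "corr q v" q x] corr_period by simp
  also have "\<dots> = corr q v (int (nat (x mod int q)))" using q by simp
  also have "\<dots> \<in> J" using q by (intro all) (simp add: nat_less_iff)
  finally show ?thesis .
qed

text \<open>The reflection combined with the sign \<open>(-1) ^ n\<close> carries the operator to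
  its negative: hops change the parity of \<open>n\<close>, and the potential is odd. Hence the
  diagonal entries of an odd power at \<open>r\<close> and \<open>- 1 - r\<close> are
  opposite.\<close>

lemma trq_odd:
  fixes v :: "int \<Rightarrow> complex"
  assumes q: "q > 0" and per: "\<And>n. v (n + int q) = v n" and anti: "\<And>n. v (- 1 - n) = - v n" and "odd k"
  shows "trq q v k = 0"
proof -
  define R where "R u n = (if even n then u (- 1 - n) else - u (- 1 - n))" for u :: "int \<Rightarrow> complex" and n
  have step: "schr 1 1 v (R u) = (\<lambda>n. - R (schr 1 1 v u) n)" for u
  proof
    fix n
    have "u (- 1 - (n + 1)) = u ((- 1 - n) - 1)" "u (- 1 - (n - 1)) = u ((- 1 - n) + 1)"
      by (simp_all add: algebra_simps)
    moreover have "v n = - v (- 1 - n)" using anti[of n] by simp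
    ultimately show "schr 1 1 v (R u) n = - R (schr 1 1 v u) n"
      by (simp add: schr_def R_def)
  qed
  have neg: "schr 1 1 v (\<lambda>n. c * u n) = (\<lambda>n. c * schr 1 1 v u n)" for u c
    by (rule ext) (simp add: schr_def algebra_simps)
  have pow: "(schr 1 1 v ^^ k) (R u) = (\<lambda>n. (- 1) ^ k * R ((schr 1 1 v ^^ k) u) n)" for u k
  proof (induction k)
    case (Suc k)
    then show ?case by (simp add: neg step)
  qed simp
  have powc: "(schr 1 1 v ^^ k) (\<lambda>n. c * u n) = (\<lambda>n. c * (schr 1 1 v ^^ k) u n)" for u c
    by (induction k) (simp_all add: neg)
  define f where "f r = (schr 1 1 v ^^ k) (delta r) r" for r
  have f_neg: "f (- 1 - r) = - f r" for r
  proof -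
    define s where "s = (if even r then - 1 else 1 :: complex)"
    have "R (delta r) = (\<lambda>n. s * delta (- 1 - r) n)"
      by (rule ext) (auto simp: R_def delta_def s_def)
    then have "s * f (- 1 - r) = (schr 1 1 v ^^ k) (R (delta r)) (- 1 - r)"
      by (simp add: powc f_def)
    also have "\<dots> = - R ((schr 1 1 v ^^ k) (delta r)) (- 1 - r)"
      using \<open>odd k\<close> by (simp add: pow)
    also have "\<dots> = - s * f r" by (auto simp: R_def s_def f_def)
    finally have "s * (f (- 1 - r) + f r) = 0" by (simp add: distrib_left)
    then show ?thesis by (auto simp: s_def eq_neg_iff_add_eq_0 split: if_splits)
  qed
  have f_per: "f (r + int q) = f r" for r
  proof -
    have "(schr 1 1 v ^^ k) (delta (r + int q)) (n + int q) = (schr 1 1 v ^^ k) (delta r) n" for n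
    proof (induction k arbitrary: n)
      case (Suc k)
      have "(schr 1 1 v ^^ k) (delta (r + int q)) (n + int q + 1) = (schr 1 1 v ^^ k) (delta r) (n + 1)"
        "(schr 1 1 v ^^ k) (delta (r + int q)) (n + int q - 1) = (schr 1 1 v ^^ k) (delta r) (n - 1)"
        using Suc.IH[of "n + 1"] Suc.IH[of "n - 1"] by (simp_all add: algebra_simps)
      then show ?case using Suc.IH[of n]
        by (simp add: schr_def[of 1 1 v "(schr 1 1 v ^^ k) _"] per)
    qed (simp add: delta_def)
    then show ?thesis by (simp add: f_def)
  qed
  have T: "trq q v k = (\<Sum>r\<in>{0..<int q}. f r)" by (simp add: trq_def f_def)
  have "trq q v k = (\<Sum>r\<in>{0..<int q}. f (- 1 - r))"
    unfolding T using period_sum_reflect[of f q] f_per q by simp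
  also have "\<dots> = - trq q v k" by (simp add: f_neg T sum_negf)
  finally show ?thesis by simp
qed

lemma Const_2 [simp]: "Const 2 = 2"
  using Const_simps(7)[of 2] by simp

lemma trq_Const: "trq q (\<lambda>n. Const (v n)) k = Const (trq q v k)"
proof -
  have "(delta r :: int \<Rightarrow> mpoly) = (\<lambda>n. Const (delta r n))" for r by (rule ext) (simp add: delta_def)
  then show ?thesis unfolding trq_def Const.hom_sum by (simp add: schr_pow_Const)
qed

text \<open>Powers up to \<open>q\<close> are enough, since the operator on periodic functions is a
  matrix of size \<open>q\<close>. Oddness settles the odd powers, so that the even ones give as
  many equations as there are unknowns.\<close>

theorem nonzero_isospectral_1d:
  assumes q: "q \<ge> 4"
  shows "\<exists>v :: int \<Rightarrow> complex. (\<forall>n. v (n + int q) = v n) \<and> (\<exists>n. v n \<noteq> 0) \<and>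
    (\<forall>k\<le>q. trq q v k = trq q (\<lambda>_. 0) k)"
proof -
  define m where "m = q div 2"
  have m: "m \<ge> 2" and q0: "q > 0" using q by (auto simp: m_def)
  define V where "V = refl_pot q Var"
  have per: "V (n + int q) = V n" for n by (simp add: V_def refl_pot_period)
  have anti: "V (- 1 - n) = - V n" for n by (simp add: V_def refl_pot_reflect q0)
  have V_cases: "(\<exists>i<m. V n = Var i) \<or> (\<exists>i<m. V n = - Var i) \<or> V n = 0" for n
    using refl_pot_cases[OF q0, of Var n] unfolding V_def m_def by metis
  \<comment> \<open>Every unknown occurs on two sites, with opposite signs; the factor 1/2 makes the
    power sums of the squares monic.\<close>
  define P where "P k = Const (1 / 2) * (trq q V (2 * k) - trq q (\<lambda>_. 0) (2 * k))" for k
  have P_eq: "P k = Const (1 / 2) * (\<Sum>j=1..2*k. trw q V (2 * k) j)" for k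
    by (simp add: P_def trq_diff del: Const_simps)
  define I where "I = gen_ideal m (\<lambda>k. P (Suc k))"
  define J where "J = ideal_plus I (ideal_pow m Var 3)"
  have I: "is_ideal I" and J: "is_ideal J" by (auto simp: I_def J_def intro!: is_ideal_plus is_ideal_pow)
  have VM: "V n \<in> ideal_pow m Var 1" for n
  proof -
    have "Var i \<in> ideal_pow m Var 1" if "i < m" for i
      using ideal_pow_SucI[OF that, of 1 Var 0] by simp
    then show ?thesis
      using V_cases[of n] is_idealD(1,5)[OF is_ideal_pow[of m Var 1]] by auto
  qed

  have wV: "wle \<omega> W (V n)" if "\<And>i. i < m \<Longrightarrow> \<omega> i \<le> W" for \<omega> W n
    using V_cases[of n] by (auto intro!: wle_Var wle_uminus that)
  have wtrw: "wle \<omega> (j * W) (trw q V k j)" if "\<And>i. i < m \<Longrightarrow> \<omega> i \<le> W" for \<omega> W k j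
    unfolding trw_def using wV[OF that] by (intro wle_sum words_wle) (auto simp: delta_def)
  have P_vars: "vars_below m (P k)" for k
    unfolding P_eq using wtrw[of "\<lambda>i. if i < m then 0 else 1" 0 _ "2 * k"]
    by (intro vars_below_simps) (auto simp: vars_below_def)
  have P_top: "wle (\<lambda>i. 2 * m * m + i) ((2 * k - 1) * (2 * m * m + m)) (P k - (\<Sum>i<m. Var i ^ (2 * k)))"
    if k: "1 \<le> k" for k
  proof -
    have "trw q V (2 * k) (2 * k) = 2 * (\<Sum>i<m. Var i ^ (2 * k))"
      unfolding trw_def words_full V_def using sum_refl_pot_power[OF q0, of k Var] k
      by (simp add: delta_def m_def)
    moreover have "{1..2*k} = insert (2 * k) {1..2*k-1}" using k by auto
    ultimately have "(\<Sum>j=1..2*k. trw q V (2 * k) j) = 2 * (\<Sum>i<m. Var i ^ (2 * k)) + (\<Sum>j=1..2*k-1. trw q V (2 * k) j)"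
      using k by simp
    then have "P k - (\<Sum>i<m. Var i ^ (2 * k)) = Const (1 / 2) * (\<Sum>j=1..2*k-1. trw q V (2 * k) j)"
      unfolding P_eq by (simp only: distrib_left mpoly_half) simp
    moreover have "wle (\<lambda>i. 2 * m * m + i) (0 + (2 * k - 1) * (2 * m * m + m))
        (Const (1 / 2) * (\<Sum>j=1..2*k-1. trw q V (2 * k) j))"
    proof (intro wle_mult wle_Const wle_sum)
      fix j assume "j \<in> {1..2*k-1}"
      then have "j * (2 * m * m + m) \<le> (2 * k - 1) * (2 * m * m + m)" by (intro mult_le_mono1) auto
      with wtrw[of "\<lambda>i. 2 * m * m + i" "2 * m * m + m" j "2 * k"]
      show "wle (\<lambda>i. 2 * m * m + i) ((2 * k - 1) * (2 * m * m + m)) (trw q V (2 * k) j)"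
        by (auto intro: wle_mono)
    qed
    ultimately show ?thesis by (simp only: add_0)
  qed

  have sum0: "(\<Sum>r\<in>{0..<int q}. V r) = 0"
  proof -
    have "(\<Sum>r\<in>{0..<int q}. V r) = (\<Sum>r\<in>{0..<int q}. V (- 1 - r))"
      using period_sum_reflect[of V q] per q0 by simp
    also have "\<dots> = - (\<Sum>r\<in>{0..<int q}. V r)" by (simp add: anti sum_negf)
    finally have "2 * (\<Sum>r\<in>{0..<int q}. V r) = 0" by simp
    then show ?thesis using mpoly_half[of "\<Sum>r\<in>{0..<int q}. V r"] by simp
  qed
  have PI: "P k \<in> I" if "1 \<le> k" "k \<le> m" for k
    using gen_ideal_base[of "k - 1" m "\<lambda>k. P (Suc k)"] that by (simp add: I_def)
  have tr2: "trw q V (2 * k) 2 \<in> J" if k: "1 \<le> k" "k \<le> m" for k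
  proof -
    have "2 * P k = Const (2 * (1 / 2)) * (\<Sum>j=1..2*k. trw q V (2 * k) j)"
      unfolding P_eq by (simp only: Const_simps mult.assoc) simp
    then have "2 * P k = (\<Sum>j=1..2*k. trw q V (2 * k) j)" by simp
    also have "{1..2*k} = insert 1 (insert 2 {3..2*k})" using k by auto
    also have "(\<Sum>j\<in>\<dots>. trw q V (2 * k) j) = trw q V (2 * k) 1 + (trw q V (2 * k) 2 + (\<Sum>j=3..2*k. trw q V (2 * k) j))"
      by simp
    also have "trw q V (2 * k) 1 = 0" using trw_1[OF q0, of V "2 * k"] per sum0 by simp
    finally have "trw q V (2 * k) 2 = 2 * P k - (\<Sum>j=3..2*k. trw q V (2 * k) j)" by simp
    moreover have "2 * P k \<in> J"
      unfolding J_def by (rule is_idealD(3)[OF J[unfolded J_def]]) (intro ideal_plus_left is_ideal_pow PI k)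
    moreover have "(\<Sum>j=3..2*k. trw q V (2 * k) j) \<in> J"
    proof (rule is_ideal_sum[OF J])
      fix j assume j: "j \<in> {3..2*k}"
      have "trw q V (2 * k) j \<in> ideal_pow m Var j"
        unfolding trw_def by (intro is_ideal_sum is_ideal_pow words_ideal_pow VM)
      then have "trw q V (2 * k) j \<in> ideal_pow m Var 3" using ideal_pow_antimono[of 3 j m Var] j by auto
      then show "trw q V (2 * k) j \<in> J" unfolding J_def by (rule ideal_plus_right[OF I])
    qed
    ultimately show ?thesis using is_idealD(6)[OF J] by simp
  qed
  have corrJ: "corr q V x \<in> J" for x
    using tr2 by (intro corr_mem[OF q0 per J sum0]) (auto simp: m_def)

  define L where "L = four q V"
  have L_minus: "L (- k) = - (Const (ph q k) * L k)" for k
    unfolding L_def by (rule four_minus[of q V, OF q0 per anti])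
  \<comment> \<open>For an odd potential \<open>L (- k)\<close> is \<open>L k\<close> up to a
    constant factor of modulus 1. So the square of \<open>L k\<close> is a multiple of a Fourier
    coefficient of the autocorrelation, all of whose values lie in \<open>J\<close>.\<close>
  have L_sq: "L k * L k \<in> J" for k
  proof -
    have "L k = L (- (- k))" by simp
    also have "\<dots> = - (Const (ph q (- k)) * L (- k))" by (rule L_minus)
    finally have "L k * L k = - Const (ph q (- k)) * (L k * L (- k))" by (metis minus_mult_left mult.left_commute)
    also have "\<dots> \<in> J"
      unfolding L_def four_mult_minus[of q V, OF q0 per]
      by (intro is_idealD(3)[OF J] is_ideal_sum[OF J] corrJ)
    finally show ?thesis .
  qed
  \<comment> \<open>The frequencies 1 to \<open>m\<close> are enough as coordinates:
    \<open>L 0\<close> is the vanishing total, and the larger frequencies are mirror images.\<close>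
  define l where "l i = L (int i + 1)" for i
  have l1: "l i \<in> ideal_pow m Var 1" for i
    unfolding l_def L_def four_def[of q V, OF q0 per] by (intro is_ideal_sum is_ideal_pow is_idealD(3) VM)
  have L_mem: "L k \<in> ideal_pow m l 1" if k: "k \<in> {0..<int q}" for k
  proof -
    have lm: "L (int i) \<in> ideal_pow m l 1" if "1 \<le> i" "i \<le> m" for i
    proof -
      obtain i' where i': "i = Suc i'" using \<open>1 \<le> i\<close> by (cases i) auto
      have "l i' \<in> ideal_pow m l 1"
        using ideal_pow_SucI[of i' m 1 l 0] that i' by simp
      then show ?thesis by (simp add: i' l_def add.commute)
    qed
    consider "k = 0" | "1 \<le> k" "k \<le> int m" | "k > int m" using k by fastforce
    then show ?thesis
    proof cases
      case 1
      have "L 0 = 0" using sum0 by (simp add: L_def four_def[of q V, OF q0 per] ph_0[OF q0])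
      then show ?thesis using 1 is_idealD(1)[OF is_ideal_pow] by metis
    next
      case 2
      then show ?thesis using lm[of "nat k"] by (simp add: nat_le_iff)
    next
      case 3
      define k' where "k' = nat (int q - k)"
      have k': "1 \<le> k'" "k' \<le> m" "k = - int k' + int q" using 3 k by (auto simp: k'_def m_def)
      have "L k = L (- int k')" unfolding k'(3) L_def by (rule four_period[of q V, OF q0 per])
      also have "\<dots> = - (Const (ph q (int k')) * L (int k'))" by (rule L_minus)
      also have "\<dots> \<in> ideal_pow m l 1"
        by (intro is_idealD(5)[OF is_ideal_pow is_idealD(3)[OF is_ideal_pow]] lm k')
      finally show ?thesis .
    qed
  qed
  have l2: "Var i \<in> ideal_pow m l 1" if i: "i < m" for i
  proof -
    have iq: "int i \<in> {0..<int q}" using i by (auto simp: m_def)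
    have "V (int i) = Var i" using i by (simp add: V_def m_def refl_pot_small)
    then have e: "of_nat q * Var i = (\<Sum>k\<in>{0..<int q}. Const (ph q (- (k * int i))) * L k)"
      unfolding L_def using four_inverse[of q V, OF q0 per iq] by simp
    have "Var i = Const (1 / of_nat q * of_nat q) * Var i" using q0 by simp
    also have "\<dots> = Const (1 / of_nat q) * (of_nat q * Var i)" by (simp only: Const_simps mult.assoc)
    also have "\<dots> \<in> ideal_pow m l 1"
      unfolding e by (intro is_idealD(3)[OF is_ideal_pow] is_ideal_sum[OF is_ideal_pow] L_mem)
    finally show ?thesis .
  qed
  have sq: "l i * l i \<in> ideal_plus (gen_ideal m (\<lambda>k. P (Suc k))) (ideal_pow m Var 3)" for i
    using L_sq unfolding l_def J_def I_def .

  from exists_nonzero_common_zero[OF m P_vars P_top l1 l2 sq]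
  obtain \<mu> K where K: "is_ideal K" "1 \<notin> K" "\<And>k. 1 \<le> k \<Longrightarrow> k \<le> m \<Longrightarrow> P k \<in> K"
    "\<And>j. j < m \<Longrightarrow> Var j - Const (\<mu> j) \<in> K" "\<exists>j<m. \<mu> j \<noteq> 0" by blast
  define v where "v = refl_pot q \<mu>"
  have vper: "v (n + int q) = v n" for n by (simp add: v_def refl_pot_period)
  have vanti: "v (- 1 - n) = - v n" for n by (simp add: v_def refl_pot_reflect q0)
  have vV: "V n - Const (v n) \<in> K" for n
  proof -
    define i where "i = nat (n mod int q)"
    have i: "i < q" using q0 by (simp add: i_def nat_less_iff)
    have e: "refl_pot q Z n = (if i < m then Z i else if q - m \<le> i then - Z (q - 1 - i) else 0)" for Z :: "nat \<Rightarrow> 'b::comm_ring_1"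
      by (simp add: refl_pot_def i_def Let_def m_def)
    consider "i < m" | "\<not> i < m" "q - m \<le> i" | "\<not> i < m" "\<not> q - m \<le> i" by blast
    then show ?thesis
    proof cases
      case 1
      then show ?thesis using K(4) by (simp add: V_def v_def e)
    next
      case 2
      then have "q - 1 - i < m" using i by linarith
      then have "- (Var (q - 1 - i) - Const (\<mu> (q - 1 - i))) \<in> K" by (intro is_idealD(5)[OF K(1)] K(4))
      then show ?thesis using 2 by (simp add: V_def v_def e)
    next
      case 3
      then show ?thesis using is_idealD(1)[OF K(1)] by (simp add: V_def v_def e)
    qed
  qed
  have even_case: "trq q v (2 * k) = trq q (\<lambda>_. 0) (2 * k)" if k: "1 \<le> k" "k \<le> m" for k
  proof -
    have "trq q V (2 * k) - trq q (\<lambda>n. Const (v n)) (2 * k) \<in> K"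
      unfolding trq_def sum_subtractf[symmetric] by (intro is_ideal_sum K(1) schr_pow_cong_mod vV)
    moreover have "trq q V (2 * k) - trq q (\<lambda>_. 0) (2 * k) \<in> K"
    proof -
      have "2 * P k = Const (2 * (1 / 2)) * (trq q V (2 * k) - trq q (\<lambda>_. 0) (2 * k))"
        unfolding P_def by (simp only: Const_simps mult.assoc) simp
      then have "trq q V (2 * k) - trq q (\<lambda>_. 0) (2 * k) = 2 * P k" by simp
      then show ?thesis using is_idealD(3)[OF K(1) K(3)[OF k]] by simp
    qed
    ultimately have "(trq q V (2 * k) - trq q (\<lambda>_. 0) (2 * k)) - (trq q V (2 * k) - trq q (\<lambda>n. Const (v n)) (2 * k)) \<in> K"
      by (rule is_idealD(6)[OF K(1), rotated])
    moreover have "trq q (\<lambda>_. 0 :: mpoly) (2 * k) = Const (trq q (\<lambda>_. 0) (2 * k))"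
      using trq_Const[of q "\<lambda>_. 0" "2 * k"] by simp
    ultimately have mem: "Const (trq q v (2 * k) - trq q (\<lambda>_. 0) (2 * k)) \<in> K"
      by (simp add: trq_Const)
    define c where "c = trq q v (2 * k) - trq q (\<lambda>_. 0) (2 * k)"
    have "c = 0"
    proof (rule ccontr)
      assume "c \<noteq> 0"
      then have "Const (inverse c * c) = 1" by simp
      then have "1 = Const (inverse c) * Const c" by (simp only: Const_simps(4))
      then show False using is_idealD(3)[OF K(1) mem, of "Const (inverse c)"] K(2) by (simp only: c_def)
    qed
    then show ?thesis by (simp add: c_def)
  qed
  have "trq q v k = trq q (\<lambda>_. 0) k" if "k \<le> q" for k
  proof (cases "odd k")
    case True
    have "trq q (\<lambda>_. 0 :: complex) k = 0" by (rule trq_odd[OF q0 _ _ True]) auto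
    then show ?thesis using trq_odd[OF q0 vper vanti True] by simp
  next
    case False
    then obtain k' where k': "k = 2 * k'" by auto
    show ?thesis
    proof (cases "k' = 0")
      case False
      then show ?thesis using even_case[of k'] that k' by (auto simp: m_def)
    qed (simp add: k' trq_def)
  qed
  moreover have "\<exists>n. v n \<noteq> 0"
  proof -
    obtain j where "j < m" "\<mu> j \<noteq> 0" using K(5) by blast
    then have "v (int j) \<noteq> 0" by (simp add: v_def m_def refl_pot_small)
    then show ?thesis ..
  qed
  ultimately show ?thesis using vper by blast
qed

section \<open>Traces of powers of a matrix\<close>

definition mtr :: "'a::comm_monoid_add mat \<Rightarrow> 'a" where
  "mtr A = (\<Sum>i<dim_row A. A $$ (i, i))"

lemma mtr_mult_commute:
  fixes A B :: "'a::comm_ring_1 mat"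
  assumes "A \<in> carrier_mat n k" "B \<in> carrier_mat k n"
  shows "mtr (A * B) = mtr (B * A)"
proof -
  have "mtr (A * B) = (\<Sum>i<n. \<Sum>j<k. A $$ (i, j) * B $$ (j, i))"
    using assms by (auto simp: mtr_def scalar_prod_def atLeast0LessThan intro!: sum.cong)
  also have "\<dots> = (\<Sum>j<k. \<Sum>i<n. B $$ (j, i) * A $$ (i, j))"
    by (subst sum.swap) (simp add: mult.commute)
  also have "\<dots> = mtr (B * A)"
    using assms by (auto simp: mtr_def scalar_prod_def atLeast0LessThan intro!: sum.cong)
  finally show ?thesis .
qed

lemma upper_triangular_mult_diag:
  fixes A B :: "'a::comm_ring_1 mat"
  assumes "A \<in> carrier_mat n n" "B \<in> carrier_mat n n" "upper_triangular A" "upper_triangular B"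
  shows "upper_triangular (A * B)" "i < n \<Longrightarrow> (A * B) $$ (i, i) = A $$ (i, i) * B $$ (i, i)"
proof -
  have e: "(A * B) $$ (i, j) = (\<Sum>k<n. A $$ (i, k) * B $$ (k, j))" if "i < n" "j < n" for i j
    using assms that by (auto simp: scalar_prod_def atLeast0LessThan intro!: sum.cong)
  show "upper_triangular (A * B)"
  proof (rule upper_triangularI)
    fix i j assume "j < i" "i < dim_row (A * B)"
    then have ij: "i < n" "j < n" using assms by auto
    have "A $$ (i, k) * B $$ (k, j) = 0" if "k < n" for k
      using upper_triangularD[OF assms(3), of k i] upper_triangularD[OF assms(4), of j k] assms that ij \<open>j < i\<close>
      by (cases "k < i") auto
    then show "(A * B) $$ (i, j) = 0" using e[OF ij] by simp
  qed
  assume i: "i < n"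
  have "A $$ (i, k) * B $$ (k, i) = (if k = i then A $$ (i, i) * B $$ (i, i) else 0)" if "k < n" for k
    using upper_triangularD[OF assms(3), of k i] upper_triangularD[OF assms(4), of i k] assms that i
    by (cases k i rule: linorder_cases) auto
  then have "(\<Sum>k<n. A $$ (i, k) * B $$ (k, i)) = (\<Sum>k<n. if k = i then A $$ (i, i) * B $$ (i, i) else 0)"
    by (intro sum.cong) auto
  then show "(A * B) $$ (i, i) = A $$ (i, i) * B $$ (i, i)" using e[OF i i] i by simp
qed

lemma upper_triangular_pow_diag:
  fixes B :: "'a::comm_ring_1 mat"
  assumes "B \<in> carrier_mat n n" "upper_triangular B"
  shows "upper_triangular (B ^\<^sub>m k) \<and> (\<forall>i<n. (B ^\<^sub>m k) $$ (i, i) = (B $$ (i, i)) ^ k)"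
proof (induction k)
  case (Suc k)
  then show ?case
    using upper_triangular_mult_diag[of "B ^\<^sub>m k" n B] assms by (auto simp: mult.commute)
qed (use assms in auto)

text \<open>By Schur triangularisation and cyclicity of the trace the sum is read off the diagonal
  of a triangular power.\<close>

lemma mtr_pow_char_poly:
  fixes A :: "complex mat"
  assumes A: "A \<in> carrier_mat n n" and c: "char_poly A = (\<Prod>a\<leftarrow>as. [:- a, 1:])"
  shows "mtr (A ^\<^sub>m k) = (\<Sum>a\<leftarrow>as. a ^ k)"
proof -
  obtain B P Q where "schur_decomposition A as = (B, P, Q)" by (metis prod_cases3)
  from schur_decomposition[OF A c this]
  have sim: "similar_mat_wit A B P Q" and ut: "upper_triangular B" and d: "diag_mat B = as" by auto
  note w = similar_mat_witD2[OF A sim]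
  have "A ^\<^sub>m k = P * B ^\<^sub>m k * Q" by (rule similar_mat_wit_pow_id[OF sim])
  then have "mtr (A ^\<^sub>m k) = mtr (P * (B ^\<^sub>m k * Q))"
    using w by (subst assoc_mult_mat[symmetric, of _ n n _ n _ n]) auto
  also have "\<dots> = mtr (B ^\<^sub>m k * Q * P)"
    using w by (intro mtr_mult_commute[of _ n n]) auto
  also have "B ^\<^sub>m k * Q * P = B ^\<^sub>m k"
    using w by (subst assoc_mult_mat[of _ n n _ n _ n]) auto
  also have "mtr (B ^\<^sub>m k) = (\<Sum>i<n. (B $$ (i, i)) ^ k)"
    using upper_triangular_pow_diag[OF w(5) ut, of k] w(5) by (simp add: mtr_def)
  also have "\<dots> = (\<Sum>a\<leftarrow>as. a ^ k)"
    unfolding d[symmetric] diag_mat_def using w(5)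
    by (simp add: sum_list_distinct_conv_sum_set atLeast0LessThan comp_def)
  finally show ?thesis .
qed

lemma coeff_prod_reflect:
  fixes as :: "complex list"
  shows "degree (\<Prod>a\<leftarrow>as. [:- a, 1:]) = length as"
    "reflect_poly (\<Prod>a\<leftarrow>as. [:- a, 1:]) = (\<Prod>a\<leftarrow>as. [:1, - a:])"
proof -
  show "degree (\<Prod>a\<leftarrow>as. [:- a, 1:]) = length as"
  proof (induction as)
    case (Cons a as)
    have "(\<Prod>a\<leftarrow>as. [:- a, 1:]) \<noteq> (0 :: complex poly)" by (auto simp: prod_list_zero_iff)
    then show ?case
      using degree_mult_eq[of "[:- a, 1:]" "\<Prod>a\<leftarrow>as. [:- a, 1:]"] Cons by (simp del: mult_pCons_left)
  qed simp
  have "reflect_poly [:- a, 1:] = [:1, - a:]" for a :: complex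
    by (rule poly_eqI) (auto simp: coeff_reflect_poly coeff_pCons split: nat.split)
  then show "reflect_poly (\<Prod>a\<leftarrow>as. [:- a, 1:]) = (\<Prod>a\<leftarrow>as. [:1, - a:])"
    by (simp add: reflect_poly_prod_list comp_def)
qed

text \<open>Newton's identities as a logarithmic derivative; the factors are reversed to
  \<open>1 - a X\<close> so that each is an invertible power series.\<close>

lemma log_deriv_prod:
  fixes as :: "complex list"
  shows "fps_deriv (fps_of_poly (\<Prod>a\<leftarrow>as. [:1, - a:]))
     = - (fps_of_poly (\<Prod>a\<leftarrow>as. [:1, - a:]) * Abs_fps (\<lambda>k. \<Sum>a\<leftarrow>as. a ^ Suc k))"
proof (induction as)
  case (Cons a as)
  define E where "E = fps_of_poly (\<Prod>a\<leftarrow>as. [:1, - a:])"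
  define F where "F = fps_of_poly [:1, - a:]"
  define G where "G = Abs_fps (\<lambda>k. a ^ Suc k)"
  define S where "S = Abs_fps (\<lambda>k. \<Sum>a\<leftarrow>as. a ^ Suc k)"
  have F: "F = 1 - fps_const a * fps_X" by (simp add: F_def fps_of_poly_pCons algebra_simps)
  have FG: "F * G = fps_const a"
  proof (rule fps_ext)
    fix n show "fps_nth (F * G) n = fps_nth (fps_const a) n"
      by (cases n) (simp_all add: F left_diff_distrib G_def mult.assoc)
  qed
  have "fps_deriv (F * E) = - fps_const a * E + F * fps_deriv E"
    by (simp add: F)
  also have "fps_deriv E = - (E * S)" using Cons by (simp add: E_def S_def)
  also have "- fps_const a * E + F * - (E * S) = - ((F * E) * (G + S))"
    unfolding FG[symmetric] by (simp add: algebra_simps)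
  also have "G + S = Abs_fps (\<lambda>k. \<Sum>a\<leftarrow>a # as. a ^ Suc k)"
    by (rule fps_ext) (simp add: G_def S_def)
  also have "F * E = fps_of_poly (\<Prod>a\<leftarrow>a # as. [:1, - a:])"
    by (simp only: F_def E_def fps_of_poly_mult list.map prod_list.Cons)
  finally show ?case .
qed (simp add: fps_eq_iff)

text \<open>Comparing coefficients in the logarithmic derivative expresses \<open>Suc k\<close>
  times the coefficient of index \<open>Suc k\<close> by the earlier ones and the power sums; in
  characteristic 0 this determines it.\<close>

lemma power_sums_determine:
  fixes as bs :: "complex list"
  assumes len: "length as = n" "length bs = n"
    and eq: "\<And>k. 1 \<le> k \<Longrightarrow> k \<le> n \<Longrightarrow> (\<Sum>a\<leftarrow>as. a ^ k) = (\<Sum>b\<leftarrow>bs. b ^ k)"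
  shows "(\<Prod>a\<leftarrow>as. [:- a, 1:]) = (\<Prod>b\<leftarrow>bs. [:- b, 1:])"
proof -
  define e where "e as k = coeff (\<Prod>a\<leftarrow>as. [:1, - a:]) k" for as :: "complex list" and k
  have e0: "e as 0 = 1" for as by (induction as) (auto simp: e_def coeff_mult_0)
  have rec: "of_nat (Suc k) * e as (Suc k) = - (\<Sum>i=0..k. e as i * (\<Sum>a\<leftarrow>as. a ^ Suc (k - i)))" for as k
    using arg_cong[OF log_deriv_prod[of as], of "\<lambda>f. fps_nth f k"]
    by (simp add: fps_mult_nth e_def)
  have ee: "e as k = e bs k" if "k \<le> n" for k
    using that
  proof (induction k rule: less_induct)
    case (less k)
    show ?case
    proof (cases k)
      case (Suc j)
      have "(\<Sum>i=0..j. e as i * (\<Sum>a\<leftarrow>as. a ^ Suc (j - i))) = (\<Sum>i=0..j. e bs i * (\<Sum>a\<leftarrow>bs. a ^ Suc (j - i)))"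
      proof (intro sum.cong refl)
        fix i assume i: "i \<in> {0..j}"
        have "(\<Sum>a\<leftarrow>as. a ^ Suc (j - i)) = (\<Sum>b\<leftarrow>bs. b ^ Suc (j - i))"
          by (rule eq) (use i Suc less.prems in auto)
        moreover have "e as i = e bs i" using i Suc less by auto
        ultimately show "e as i * (\<Sum>a\<leftarrow>as. a ^ Suc (j - i)) = e bs i * (\<Sum>a\<leftarrow>bs. a ^ Suc (j - i))"
          by (simp only:)
      qed
      then have "of_nat (Suc j) * e as (Suc j) = of_nat (Suc j) * e bs (Suc j)"
        by (simp only: rec)
      then show ?thesis unfolding Suc by (simp del: of_nat_Suc)
    qed (simp add: e0)
  qed
  have co: "coeff (\<Prod>a\<leftarrow>as. [:- a, 1:]) i = (if i \<le> length as then e as (length as - i) else 0)" for as :: "complex list" and i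
    using coeff_prod_reflect[of as] coeff_reflect_poly[of "\<Prod>a\<leftarrow>as. [:- a, 1:]" "length as - i"]
    by (auto simp: e_def coeff_eq_0)
  show ?thesis
    by (rule poly_eqI) (simp add: co len ee)
qed

lemma char_poly_eqI_traces:
  fixes A B :: "complex mat"
  assumes "A \<in> carrier_mat n n" "B \<in> carrier_mat n n"
    and "\<And>k. 1 \<le> k \<Longrightarrow> k \<le> n \<Longrightarrow> mtr (A ^\<^sub>m k) = mtr (B ^\<^sub>m k)"
  shows "char_poly A = char_poly B"
proof -
  obtain as bs where "char_poly A = (\<Prod>a\<leftarrow>as. [:- a, 1:])" "length as = n"
    "char_poly B = (\<Prod>a\<leftarrow>bs. [:- a, 1:])" "length bs = n"
    using char_poly_factorized[OF assms(1)] char_poly_factorized[OF assms(2)] by metis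
  then show ?thesis
    using power_sums_determine[of as n bs] mtr_pow_char_poly assms by metis
qed

lemma traces_eqI_proots:
  fixes A B :: "complex mat"
  assumes "A \<in> carrier_mat n n" "B \<in> carrier_mat n n"
    and "proots (char_poly A) = proots (char_poly B)"
  shows "mtr (A ^\<^sub>m k) = mtr (B ^\<^sub>m k)"
proof -
  obtain as bs where c: "char_poly A = (\<Prod>a\<leftarrow>as. [:- a, 1:])" "char_poly B = (\<Prod>a\<leftarrow>bs. [:- a, 1:])"
    using char_poly_factorized[OF assms(1)] char_poly_factorized[OF assms(2)] by metis
  have pr: "proots (\<Prod>a\<leftarrow>as. [:- a, 1:]) = mset as" for as :: "complex list"
  proof (induction as)
    case (Cons a as)
    have "(\<Prod>a\<leftarrow>as. [:- a, 1:]) \<noteq> (0 :: complex poly)" by (auto simp: prod_list_zero_iff)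
    then show ?case
      using proots_mult[of "[:- a, 1:]" "\<Prod>a\<leftarrow>as. [:- a, 1:]"] Cons by (simp del: mult_pCons_left)
  qed simp
  have "mset as = mset bs" using assms(3) unfolding c pr .
  then have "(\<Sum>a\<leftarrow>as. a ^ k) = (\<Sum>a\<leftarrow>bs. a ^ k)"
    by (metis mset_map sum_mset_sum_list)
  then show ?thesis using mtr_pow_char_poly[OF assms(1) c(1)] mtr_pow_char_poly[OF assms(2) c(2)] by simp
qed

section \<open>Floquet matrices and hopping operators\<close>

definition sh :: "nat \<Rightarrow> int \<Rightarrow> (nat \<Rightarrow> int) \<Rightarrow> nat \<Rightarrow> int" where
  "sh i s n = n(i := n i + s)"

lemma sh_sh [simp]: "sh i s (sh i t n) = sh i (t + s) n"
  by (simp add: sh_def fun_eq_iff)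

lemma sh_0 [simp]: "sh i 0 n = n"
  by (simp add: sh_def)

lemma sh_commute: "sh i s (sh j t n) = sh j t (sh i s n)"
  by (auto simp: sh_def fun_eq_iff)

text \<open>The weights \<open>w i\<close> and \<open>inverse (w i)\<close> are what the boundary
  phases become after the gauge transformation. The set \<open>A\<close> of directions that hop is a
  parameter because directions are removed later while the potential still depends on them.\<close>

definition hopT :: "nat set \<Rightarrow> (nat \<Rightarrow> complex) \<Rightarrow> ((nat \<Rightarrow> int) \<Rightarrow> complex) \<Rightarrow>
    ((nat \<Rightarrow> int) \<Rightarrow> complex) \<Rightarrow> (nat \<Rightarrow> int) \<Rightarrow> complex" where
  "hopT A w V u n = (\<Sum>i\<in>A. w i * u (sh i 1 n) + inverse (w i) * u (sh i (-1) n)) + V n * u n"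

lemma hopT_sum:
  "hopT A w V (\<lambda>n. \<Sum>p\<in>S. c p * u p n) = (\<lambda>n. \<Sum>p\<in>S. c p * hopT A w V (u p) n)"
proof
  fix n
  have "hopT A w V (\<lambda>n. \<Sum>p\<in>S. c p * u p n) n
    = (\<Sum>i\<in>A. \<Sum>p\<in>S. c p * (w i * u p (sh i 1 n) + inverse (w i) * u p (sh i (-1) n))) + (\<Sum>p\<in>S. c p * (V n * u p n))"
    by (simp add: hopT_def sum_distrib_left sum.distrib algebra_simps)
  also have "\<dots> = (\<Sum>p\<in>S. c p * (\<Sum>i\<in>A. w i * u p (sh i 1 n) + inverse (w i) * u p (sh i (-1) n)) + c p * (V n * u p n))"
    unfolding sum_distrib_left by (subst sum.swap) (rule sum.distrib[symmetric])
  finally show "hopT A w V (\<lambda>n. \<Sum>p\<in>S. c p * u p n) n = (\<Sum>p\<in>S. c p * hopT A w V (u p) n)"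
    by (simp add: hopT_def distrib_left)
qed

lemma hopT_pow_sum:
  "(hopT A w V ^^ k) (\<lambda>n. \<Sum>p\<in>S. c p * u p n) = (\<lambda>n. \<Sum>p\<in>S. c p * (hopT A w V ^^ k) (u p) n)"
  by (induction k) (simp_all add: hopT_sum)

lemma digits_determine:
  fixes q :: "nat \<Rightarrow> nat"
  assumes "\<And>i. i < d \<Longrightarrow> (k div (\<Prod>j<i. q j)) mod q i = (l div (\<Prod>j<i. q j)) mod q i"
  shows "k mod (\<Prod>j<d. q j) = l mod (\<Prod>j<d. q j)"
  using assms
proof (induction d)
  case (Suc d)
  then show ?case by (simp add: mod_mult2_eq)
qed simp

lemma digits_exist:
  fixes q p :: "nat \<Rightarrow> nat"
  assumes "\<And>i. i < d \<Longrightarrow> p i < q i"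
  shows "\<exists>k < (\<Prod>j<d. q j). \<forall>i<d. (k div (\<Prod>j<i. q j)) mod q i = p i"
  using assms
proof (induction d)
  case (Suc d)
  then obtain k where k: "k < (\<Prod>j<d. q j)" "\<forall>i<d. (k div (\<Prod>j<i. q j)) mod q i = p i" by auto
  define Q where "Q = (\<Prod>j<d. q j)"
  have "k + Q * p d < Q * q d"
  proof -
    have "k + Q * p d < Q + Q * p d" using k(1) by (simp add: Q_def)
    also have "\<dots> = Q * Suc (p d)" by simp
    also have "\<dots> \<le> Q * q d" using Suc.prems[of d] by (intro mult_le_mono2) auto
    finally show ?thesis .
  qed
  moreover have "((k + Q * p d) div (\<Prod>j<i. q j)) mod q i = p i" if i: "i < Suc d" for i
  proof (cases "i = d")
    case True
    then show ?thesis using k(1) Suc.prems[of d] by (simp add: Q_def[symmetric])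
  next
    case False
    define P where "P = (\<Prod>j<i. q j)"
    define R where "R = (\<Prod>j=Suc i..<d. q j)"
    have "{..<d} = {..<Suc i} \<union> {Suc i..<d}" using i False by auto
    moreover have "prod q ({..<Suc i} \<union> {Suc i..<d}) = prod q {..<Suc i} * prod q {Suc i..<d}"
      by (rule prod.union_disjoint) auto
    ultimately have "Q = (\<Prod>j<Suc i. q j) * R" unfolding Q_def R_def by (simp only:)
    then have QP: "Q = P * (q i * R)" by (simp add: P_def)
    have "P > 0"
    proof -
      have "q j > 0" if "j < i" for j using Suc.prems[of j] that i by simp
      then show ?thesis by (auto simp: P_def intro!: prod_pos)
    qed
    then have "(k + Q * p d) div P = k div P + q i * R * p d"
      unfolding QP by (simp add: mult.assoc)
    then have "((k + Q * p d) div P) mod q i = (k div P) mod q i" by (simp add: mult.assoc)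
    then show ?thesis using k(2) i False by (simp add: P_def)
  qed
  ultimately show ?case by (intro exI[of _ "k + Q * p d"]) (auto simp: Q_def)
qed auto

locale torus =
  fixes d :: nat and q :: "nat \<Rightarrow> nat"
  assumes q_pos: "\<And>j. j < d \<Longrightarrow> q j > 0"
begin

definition red :: "(nat \<Rightarrow> int) \<Rightarrow> nat \<Rightarrow> int" where
  "red n = (\<lambda>i. if i < d then n i mod int (q i) else 0)"

definition box :: "(nat \<Rightarrow> int) set" where
  "box = {p. red p = p}"

text \<open>Invariance under \<open>red\<close> also makes \<open>u\<close> independent of the
  coordinates from \<open>d\<close> on, so periodic functions live on the finite set
  \<open>box\<close>.\<close>

definition per :: "((nat \<Rightarrow> int) \<Rightarrow> complex) \<Rightarrow> bool" where
  "per u \<longleftrightarrow> (\<forall>n. u (red n) = u n)"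

definition dl :: "(nat \<Rightarrow> int) \<Rightarrow> (nat \<Rightarrow> int) \<Rightarrow> complex" where
  "dl p n = (if red n = p then 1 else 0)"

definition Tr :: "(((nat \<Rightarrow> int) \<Rightarrow> complex) \<Rightarrow> (nat \<Rightarrow> int) \<Rightarrow> complex) \<Rightarrow> complex" where
  "Tr F = (\<Sum>p\<in>box. F (dl p) p)"

abbreviation pt :: "nat \<Rightarrow> nat \<Rightarrow> int" where
  "pt \<equiv> box_pt d q"

abbreviation Q :: nat where
  "Q \<equiv> num_pts d q"

lemma red_red [simp]: "red (red n) = red n"
  by (auto simp: red_def)

lemma red_in_box [simp]: "red n \<in> box"
  by (simp add: box_def)

lemma red_sh: "red (sh i s (red n)) = red (sh i s n)"
  by (auto simp: red_def sh_def fun_eq_iff mod_add_left_eq)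

lemma perD: "per u \<Longrightarrow> u (red n) = u n"
  by (simp add: per_def)

lemma per_cong: "per u \<Longrightarrow> red n = red m \<Longrightarrow> u n = u m"
  by (metis perD)

lemma per_sh: "per u \<Longrightarrow> per (\<lambda>n. u (sh i s n))"
  unfolding per_def by (metis red_sh)

lemma per_dl [simp]: "per (dl p)"
  by (simp add: per_def dl_def)

lemma per_hopT: "per V \<Longrightarrow> per u \<Longrightarrow> per (hopT A w V u)"
  using per_sh[of u] unfolding per_def hopT_def by simp

lemma per_hopT_pow: "per V \<Longrightarrow> per u \<Longrightarrow> per ((hopT A w V ^^ k) u)"
  by (induction k) (auto intro: per_hopT)

lemma bij_pt: "bij_betw pt {..<Q} box"
proof (rule bij_betwI')
  fix k l assume kl: "k \<in> {..<Q}" "l \<in> {..<Q}"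
  show "(pt k = pt l) = (k = l)"
  proof
    assume eq: "pt k = pt l"
    have "k mod (\<Prod>j<d. q j) = l mod (\<Prod>j<d. q j)"
    proof (rule digits_determine)
      fix i assume "i < d"
      then show "(k div (\<Prod>j<i. q j)) mod q i = (l div (\<Prod>j<i. q j)) mod q i"
        using fun_cong[OF eq, of i] by (simp add: box_pt_def)
    qed
    then show "k = l" using kl by (simp add: num_pts_def)
  qed simp
next
  fix k assume "k \<in> {..<Q}"
  then show "pt k \<in> box" by (auto simp: box_def red_def box_pt_def fun_eq_iff zmod_int)
next
  fix p assume p: "p \<in> box"
  then have pr: "\<And>i. p i = (if i < d then p i mod int (q i) else 0)" by (metis (mono_tags) box_def mem_Collect_eq red_def)
  have "nat (p i) < q i" if "i < d" for i
    using pr[of i] q_pos[OF that] that by (metis nat_less_iff of_nat_0_less_iff pos_mod_bound pos_mod_sign)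
  then obtain k where k: "k < (\<Prod>j<d. q j)" "\<forall>i<d. (k div (\<Prod>j<i. q j)) mod q i = nat (p i)"
    using digits_exist[of d "\<lambda>i. nat (p i)" q] by auto
  have "p = pt k"
  proof
    fix i show "p i = pt k i"
    proof (cases "i < d")
      case True
      have "0 \<le> p i mod int (q i)" using q_pos[OF True] by simp
      then have "0 \<le> p i" using pr[of i] True by simp
      then show ?thesis using k(2) True by (simp add: box_pt_def)
    next
      case False
      then show ?thesis using pr[of i] by (simp add: box_pt_def)
    qed
  qed
  then show "\<exists>x\<in>{..<Q}. p = pt x" using k(1) by (auto simp: num_pts_def)
qed

lemma finite_box [simp]: "finite box"
  using bij_betw_finite[OF bij_pt] by simp

lemma sum_box: "(\<Sum>p\<in>box. f p) = (\<Sum>k<Q. f (pt k))"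
  by (rule sum.reindex_bij_betw[OF bij_pt, symmetric])

lemma per_expand:
  assumes "per u"
  shows "u = (\<lambda>n. \<Sum>p\<in>box. u p * dl p n)"
proof
  fix n
  have "(\<Sum>p\<in>box. u p * dl p n) = (\<Sum>p\<in>box. if red n = p then u p else 0)"
    by (intro sum.cong) (auto simp: dl_def)
  then show "u n = (\<Sum>p\<in>box. u p * dl p n)" using perD[OF assms] by simp
qed

definition opmat :: "(((nat \<Rightarrow> int) \<Rightarrow> complex) \<Rightarrow> (nat \<Rightarrow> int) \<Rightarrow> complex) \<Rightarrow> complex mat" where
  "opmat F = mat Q Q (\<lambda>(a, b). F (dl (pt b)) (pt a))"

lemma opmat_pow:
  assumes "per V"
  shows "opmat (hopT A w V) ^\<^sub>m k = opmat (hopT A w V ^^ k)"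
proof (induction k)
  case 0
  have "pt a \<in> box" if "a < Q" for a using bij_pt that by (auto simp: bij_betw_def)
  then have "dl (pt b) (pt a) = (if a = b then 1 else 0)" if "a < Q" "b < Q" for a b
    using bij_pt that by (auto simp: dl_def box_def bij_betw_def inj_on_def)
  then show ?case by (intro eq_matI) (auto simp: opmat_def)
next
  case (Suc k)
  show ?case
  proof (rule eq_matI)
    fix a b assume "a < dim_row (opmat (hopT A w V ^^ Suc k))" "b < dim_col (opmat (hopT A w V ^^ Suc k))"
    then have ab: "a < Q" "b < Q" by (auto simp: opmat_def)
    define u where "u = hopT A w V (dl (pt b))"
    have "(opmat (hopT A w V) ^\<^sub>m Suc k) $$ (a, b) = (\<Sum>c<Q. (hopT A w V ^^ k) (dl (pt c)) (pt a) * u (pt c))"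
    proof -
      have "opmat (hopT A w V) ^\<^sub>m Suc k = opmat (hopT A w V ^^ k) * opmat (hopT A w V)" by (simp add: Suc)
      then show ?thesis
        using ab by (simp add: opmat_def scalar_prod_def u_def atLeast0LessThan)
    qed
    also have "\<dots> = (\<Sum>p\<in>box. u p * (hopT A w V ^^ k) (dl p) (pt a))"
      by (simp add: sum_box mult.commute)
    also have "\<dots> = (hopT A w V ^^ k) (\<lambda>n. \<Sum>p\<in>box. u p * dl p n) (pt a)"
      by (simp add: hopT_pow_sum)
    also have "(\<lambda>n. \<Sum>p\<in>box. u p * dl p n) = u"
      using per_expand[of u] per_hopT[OF assms per_dl] by (simp add: u_def)
    also have "(hopT A w V ^^ k) u (pt a) = opmat (hopT A w V ^^ Suc k) $$ (a, b)"
      using ab by (simp add: opmat_def u_def funpow_swap1)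
    finally show "(opmat (hopT A w V) ^\<^sub>m Suc k) $$ (a, b) = opmat (hopT A w V ^^ Suc k) $$ (a, b)" .
  qed (auto simp: opmat_def)
qed

lemma mtr_opmat: "mtr (opmat F) = Tr F"
  by (simp add: mtr_def opmat_def Tr_def sum_box)

definition gauge :: "(nat \<Rightarrow> complex) \<Rightarrow> (nat \<Rightarrow> int) \<Rightarrow> complex" where
  "gauge w n = (\<Prod>i<d. w i powi n i)"

lemma gauge_sh:
  assumes "i < d" "w i \<noteq> 0"
  shows "gauge w (sh i s n) = w i powi s * gauge w n"
proof -
  have "gauge w (sh i s n) = w i powi (n i + s) * (\<Prod>j\<in>{..<d}-{i}. w j powi n j)"
    unfolding gauge_def using assms by (subst prod.remove[of _ i]) (auto simp: sh_def intro!: prod.cong)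
  moreover have "gauge w n = w i powi n i * (\<Prod>j\<in>{..<d}-{i}. w j powi n j)"
    unfolding gauge_def using assms by (subst prod.remove[of _ i]) auto
  ultimately show ?thesis using assms by (simp add: power_int_add mult_ac)
qed

lemma gauge_nz: "(\<And>i. i < d \<Longrightarrow> w i \<noteq> 0) \<Longrightarrow> gauge w n \<noteq> 0"
  by (auto simp: gauge_def)

text \<open>With \<open>w i ^ q i\<close> as quasi-momentum, the Floquet extension of an indicator
  function is the plane wave \<open>gauge w\<close>, normalised at \<open>pt b\<close>, times the
  periodic delta. The Floquet matrix is therefore diagonally conjugate to the hopping
  operator.\<close>

lemma floquet_matrix_entry:
  assumes w: "\<And>i. i < d \<Longrightarrow> w i \<noteq> 0" and ab: "a < Q" "b < Q"
  shows "floquet_matrix d q V (\<lambda>i. w i ^ q i) $$ (a, b)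
    = gauge w (pt a) * inverse (gauge w (pt b)) * hopT {..<d} w (V \<circ> red) (dl (pt b)) (pt a)"
proof -
  define e where "e = floquet_ext d q (\<lambda>i. w i ^ q i) (\<lambda>c. if c = pt b then 1 else 0)"
  have e: "e m = gauge w m * inverse (gauge w (pt b)) * dl (pt b) m" for m
  proof (cases "red m = pt b")
    case True
    have *: "w i powi m i = (w i ^ q i) powi (m i div int (q i)) * w i powi (pt b i)" if "i < d" for i
    proof -
      have "pt b i = m i mod int (q i)" using True that by (metis red_def)
      then have "m i = int (q i) * (m i div int (q i)) + pt b i" by simp
      then have "w i powi m i = w i powi (int (q i) * (m i div int (q i))) * w i powi (pt b i)"
        using w[OF that] by (metis power_int_add)
      then show ?thesis by (simp add: power_int_mult)
    qed
    have "gauge w m = (\<Prod>i<d. (w i ^ q i) powi (m i div int (q i))) * gauge w (pt b)"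
      unfolding gauge_def prod.distrib[symmetric] by (rule prod.cong[OF refl], rule *) simp
    then show ?thesis using gauge_nz[of w "pt b"] w True
      by (simp add: e_def floquet_ext_def dl_def red_def)
  next
    case False
    then show ?thesis by (simp add: e_def floquet_ext_def dl_def red_def)
  qed
  have "pt a \<in> box" using bij_pt ab by (auto simp: bij_betw_def)
  then have ra: "red (pt a) = pt a" by (simp add: box_def)
  have sh: "(\<lambda>j. n j + unit_vec i j) = sh i 1 n" "(\<lambda>j. n j - unit_vec i j) = sh i (-1) n" for i n
    by (auto simp: sh_def unit_vec_def fun_eq_iff)
  have "disc_laplacian d e (pt a) = (\<Sum>i<d. e (sh i 1 (pt a)) + e (sh i (-1) (pt a)))"
    by (simp add: disc_laplacian_def sh)
  also have "\<dots> = (\<Sum>i<d. gauge w (pt a) * inverse (gauge w (pt b)) *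
      (w i * dl (pt b) (sh i 1 (pt a)) + inverse (w i) * dl (pt b) (sh i (-1) (pt a))))"
    using w by (intro sum.cong refl) (simp add: e gauge_sh algebra_simps power_int_minus)
  finally show ?thesis using ab
    by (simp add: floquet_matrix_def e_def[symmetric] Let_def hopT_def e ra sum_distrib_left distrib_left mult_ac)
qed

lemma mtr_floquet_pow:
  assumes w: "\<And>i. i < d \<Longrightarrow> w i \<noteq> 0"
  shows "mtr (floquet_matrix d q V (\<lambda>i. w i ^ q i) ^\<^sub>m k) = Tr (hopT {..<d} w (V \<circ> red) ^^ k)"
proof -
  define L where "L = floquet_matrix d q V (\<lambda>i. w i ^ q i)"
  define B where "B = opmat (hopT {..<d} w (V \<circ> red))"
  have L: "L \<in> carrier_mat Q Q" and B: "B \<in> carrier_mat Q Q"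
    by (auto simp: L_def B_def floquet_matrix_def opmat_def)
  have LB: "L $$ (a, b) = gauge w (pt a) * inverse (gauge w (pt b)) * B $$ (a, b)" if "a < Q" "b < Q" for a b
    using floquet_matrix_entry[OF w that] that by (simp add: L_def B_def opmat_def)
  have nz: "gauge w n \<noteq> 0" for n using gauge_nz w by blast
  have "(L ^\<^sub>m k) $$ (a, b) = gauge w (pt a) * inverse (gauge w (pt b)) * (B ^\<^sub>m k) $$ (a, b)"
    if "a < Q" "b < Q" for a b
    using that
  proof (induction k arbitrary: b)
    case 0
    then show ?case using L B nz by auto
  next
    case (Suc k)
    have "(L ^\<^sub>m Suc k) $$ (a, b) = (\<Sum>c<Q. (L ^\<^sub>m k) $$ (a, c) * L $$ (c, b))"
      using L Suc.prems pow_carrier_mat[OF L, of k]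
      by (auto simp: scalar_prod_def atLeast0LessThan intro!: sum.cong)
    also have "\<dots> = (\<Sum>c<Q. gauge w (pt a) * inverse (gauge w (pt b)) * ((B ^\<^sub>m k) $$ (a, c) * B $$ (c, b)))"
      using Suc nz by (intro sum.cong refl) (simp add: LB)
    also have "\<dots> = gauge w (pt a) * inverse (gauge w (pt b)) * (B ^\<^sub>m Suc k) $$ (a, b)"
      using B Suc.prems pow_carrier_mat[OF B, of k]
      by (auto simp: scalar_prod_def atLeast0LessThan sum_distrib_left intro!: sum.cong)
    finally show ?case .
  qed
  then have "mtr (L ^\<^sub>m k) = mtr (B ^\<^sub>m k)"
    using L B nz pow_carrier_mat[OF L, of k] pow_carrier_mat[OF B, of k] by (simp add: mtr_def)
  also have "B ^\<^sub>m k = opmat (hopT {..<d} w (V \<circ> red) ^^ k)"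
    unfolding B_def by (rule opmat_pow) (simp add: per_def)
  finally show ?thesis by (simp add: L_def mtr_opmat)
qed

lemma floquet_matrix_carrier: "floquet_matrix d q V z \<in> carrier_mat Q Q"
  by (simp add: floquet_matrix_def)

lemma isospectral_imp_traces:
  assumes "floquet_isospectral d q V V'" "\<And>i. i < d \<Longrightarrow> cmod (w i) = 1"
  shows "Tr (hopT {..<d} w (V \<circ> red) ^^ k) = Tr (hopT {..<d} w (V' \<circ> red) ^^ k)"
proof -
  have w: "w i \<noteq> 0" if "i < d" for i using assms(2)[OF that] by auto
  have "floquet_spectrum d q V (\<lambda>i. w i ^ q i) = floquet_spectrum d q V' (\<lambda>i. w i ^ q i)"
    using assms unfolding floquet_isospectral_def by (auto simp: norm_power)
  then show ?thesis
    using traces_eqI_proots[OF floquet_matrix_carrier floquet_matrix_carrier, of V "\<lambda>i. w i ^ q i" V' "\<lambda>i. w i ^ q i" k]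
    by (simp add: mtr_floquet_pow[OF w] floquet_spectrum_def)
qed

lemma traces_imp_isospectral:
  assumes "\<And>w k. (\<And>i. i < d \<Longrightarrow> cmod (w i) = 1) \<Longrightarrow>
    Tr (hopT {..<d} w (V \<circ> red) ^^ k) = Tr (hopT {..<d} w (V' \<circ> red) ^^ k)"
  shows "floquet_isospectral d q V V'"
  unfolding floquet_isospectral_def
proof (intro allI impI)
  fix z :: "nat \<Rightarrow> complex" assume z: "\<forall>i<d. cmod (z i) = 1"
  have "\<exists>x. i < d \<longrightarrow> x ^ q i = z i \<and> cmod x = 1" for i
  proof (cases "i < d")
    case True
    obtain x where x: "z i = x ^ q i" using exists_complex_root[of "q i" "z i"] q_pos[OF True] by auto
    then have "cmod x ^ q i = 1" using z True by (metis norm_power)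
    then have "cmod x = 1" using power_eq_imp_eq_base[of "cmod x" "q i" 1] q_pos[OF True] by simp
    then show ?thesis using x by auto
  qed simp
  then obtain w where w: "\<And>i. i < d \<Longrightarrow> w i ^ q i = z i \<and> cmod (w i) = 1" by metis
  have wz: "w i \<noteq> 0" if "i < d" for i using w[OF that] by auto
  have fz: "floquet_matrix d q U z = floquet_matrix d q U (\<lambda>i. w i ^ q i)" for U
  proof -
    have "floquet_ext d q z u m = floquet_ext d q (\<lambda>i. w i ^ q i) u m" for u m
      using w by (auto simp: floquet_ext_def intro!: prod.cong)
    then have "floquet_ext d q z = floquet_ext d q (\<lambda>i. w i ^ q i)" by blast
    then show ?thesis by (simp add: floquet_matrix_def)
  qed
  have "char_poly (floquet_matrix d q V z) = char_poly (floquet_matrix d q V' z)"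
    unfolding fz
    using assms[of w] w
    by (intro char_poly_eqI_traces[OF floquet_matrix_carrier floquet_matrix_carrier])
       (simp add: mtr_floquet_pow[OF wz])
  then show "floquet_spectrum d q V z = floquet_spectrum d q V' z"
    by (simp add: floquet_spectrum_def)
qed

end

section \<open>Averages of isospectral potentials\<close>

lemma infinite_unit_circle: "infinite {x :: complex. cmod x = 1}"
proof
  assume fin: "finite {x :: complex. cmod x = 1}"
  define n where "n = Suc (card {x :: complex. cmod x = 1})"
  have "{z :: complex. z ^ n = 1} \<subseteq> {x. cmod x = 1}"
  proof
    fix z :: complex assume "z \<in> {z. z ^ n = 1}"
    then have "cmod z ^ n = 1 ^ n" by (simp flip: norm_power)
    then show "z \<in> {x. cmod x = 1}" using power_eq_imp_eq_base[of "cmod z" n 1] by (simp add: n_def)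
  qed
  then have "card {z :: complex. z ^ n = 1} \<le> card {x :: complex. cmod x = 1}"
    using fin by (rule card_mono[rotated])
  then show False using card_roots_unity_eq[of n] by (simp add: n_def)
qed

lemma hopT_pow_laurent:
  assumes "finite A"
  shows "\<exists>p :: complex poly. \<forall>x. x \<noteq> 0 \<longrightarrow> x ^ k * (hopT A (w(i := x)) V ^^ k) u n = poly p x"
proof (induction k arbitrary: n)
  case 0
  show ?case by (intro exI[of _ "[:u n:]"]) simp
next
  case (Suc k)
  then obtain P where P: "\<And>n x. x \<noteq> 0 \<Longrightarrow> x ^ k * (hopT A (w(i := x)) V ^^ k) u n = poly (P n) x" by metis
  define R where "R = (\<Sum>j\<in>A. if j = i then [:0, 0, 1:] * P (sh j 1 n) + P (sh j (-1) n)
      else [:0, w j:] * P (sh j 1 n) + [:0, inverse (w j):] * P (sh j (-1) n)) + [:0, V n:] * P n"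
  have "x ^ Suc k * (hopT A (w(i := x)) V ^^ Suc k) u n = poly R x" if x: "x \<noteq> 0" for x
  proof -
    define f where "f = (hopT A (w(i := x)) V ^^ k) u"
    have "x ^ Suc k * (hopT A (w(i := x)) V ^^ Suc k) u n
      = (\<Sum>j\<in>A. x * ((w(i := x)) j) * (x ^ k * f (sh j 1 n)) + x * inverse ((w(i := x)) j) * (x ^ k * f (sh j (-1) n)))
        + x * V n * (x ^ k * f n)"
      by (simp add: hopT_def f_def[symmetric] sum_distrib_left algebra_simps)
    also have "\<dots> = poly R x"
      unfolding R_def poly_add poly_sum using x
      by (intro arg_cong2[of _ _ _ _ "(+)"] sum.cong refl) (auto simp: P f_def algebra_simps)
    finally show ?thesis .
  qed
  then show ?case by blast
qed

context torus
begin

lemma Tr_laurent: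
  assumes "finite A"
  shows "\<exists>p :: complex poly. \<forall>x. x \<noteq> 0 \<longrightarrow> x ^ k * Tr (hopT A (w(i := x)) V ^^ k) = poly p x"
proof -
  have "\<exists>P. \<forall>b. \<forall>x. x \<noteq> 0 \<longrightarrow> x ^ k * (hopT A (w(i := x)) V ^^ k) (dl b) b = poly (P b) x"
    using hopT_pow_laurent[OF assms] by (intro choice allI)
  then obtain P where "\<And>b x. x \<noteq> 0 \<Longrightarrow> x ^ k * (hopT A (w(i := x)) V ^^ k) (dl b) b = poly (P b) x"
    by blast
  then show ?thesis
    by (intro exI[of _ "\<Sum>b\<in>box. P b"]) (simp add: Tr_def sum_distrib_left poly_sum)
qed

text \<open>The trace is a Laurent polynomial in each weight, and the unit circle is infinite; so
  the identity is continued to all nonzero values, one weight after the other.\<close>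

lemma traces_extend:
  assumes "\<And>w. (\<And>i. i < d \<Longrightarrow> cmod (w i) = 1) \<Longrightarrow> Tr (hopT {..<d} w V ^^ k) = Tr (hopT {..<d} w V' ^^ k)"
    and "\<And>i. i < d \<Longrightarrow> w i \<noteq> 0"
  shows "Tr (hopT {..<d} w V ^^ k) = Tr (hopT {..<d} w V' ^^ k)"
proof -
  have "Tr (hopT {..<d} w V ^^ k) = Tr (hopT {..<d} w V' ^^ k)"
    if "j \<le> d" "\<And>i. i < d \<Longrightarrow> w i \<noteq> 0" "\<And>i. j \<le> i \<Longrightarrow> i < d \<Longrightarrow> cmod (w i) = 1" for j w
    using that
  proof (induction j arbitrary: w)
    case 0
    then show ?case using assms(1) by simp
  next
    case (Suc j)
    obtain p where p: "\<And>x. x \<noteq> 0 \<Longrightarrow> x ^ k * Tr (hopT {..<d} (w(j := x)) V ^^ k) = poly p x"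
      using Tr_laurent[of "{..<d}" k w j V] by auto
    obtain p' where p': "\<And>x. x \<noteq> 0 \<Longrightarrow> x ^ k * Tr (hopT {..<d} (w(j := x)) V' ^^ k) = poly p' x"
      using Tr_laurent[of "{..<d}" k w j V'] by auto
    have "poly (p - p') x = 0" if x: "cmod x = 1" for x
    proof -
      have x0: "x \<noteq> 0" using x by auto
      have "Tr (hopT {..<d} (w(j := x)) V ^^ k) = Tr (hopT {..<d} (w(j := x)) V' ^^ k)"
        using Suc.prems x x0 by (intro Suc.IH) auto
      then show ?thesis using p[OF x0] p'[OF x0] by simp
    qed
    then have "{x. cmod x = 1} \<subseteq> {x. poly (p - p') x = 0}" by auto
    then have "p - p' = 0" using infinite_unit_circle poly_roots_finite finite_subset by blast
    then have "w j ^ k * Tr (hopT {..<d} (w(j := w j)) V ^^ k) = w j ^ k * Tr (hopT {..<d} (w(j := w j)) V' ^^ k)"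
      using p[of "w j"] p'[of "w j"] Suc.prems by auto
    then show ?case using Suc.prems by auto
  qed
  from this[of d w] assms(2) show ?thesis by simp
qed

text \<open>The weights range over all nonzero complex numbers, not just the unit circle, because
  they will be sent to infinity or set to \<open>\<i>\<close>.\<close>

definition iso :: "nat set \<Rightarrow> ((nat \<Rightarrow> int) \<Rightarrow> complex) \<Rightarrow> bool" where
  "iso A V \<longleftrightarrow> (\<forall>w k. (\<forall>i. w i \<noteq> 0) \<longrightarrow> Tr (hopT A w V ^^ k) = Tr (hopT A w (\<lambda>_. 0) ^^ k))"

lemma isoD: "iso A V \<Longrightarrow> (\<And>i. w i \<noteq> 0) \<Longrightarrow> Tr (hopT A w V ^^ k) = Tr (hopT A w (\<lambda>_. 0) ^^ k)"
  unfolding iso_def by blast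

lemma isospectral_imp_iso:
  assumes "floquet_isospectral d q V (\<lambda>_. 0)"
  shows "iso {..<d} (V \<circ> red)"
  unfolding iso_def
proof (intro allI impI)
  fix w :: "nat \<Rightarrow> complex" and k assume w: "\<forall>i. w i \<noteq> 0"
  have z: "(\<lambda>_. 0 :: complex) \<circ> red = (\<lambda>_. 0)" by (simp add: comp_def)
  show "Tr (hopT {..<d} w (V \<circ> red) ^^ k) = Tr (hopT {..<d} w (\<lambda>_. 0) ^^ k)"
  proof (rule traces_extend)
    fix w' :: "nat \<Rightarrow> complex" assume w': "\<And>i. i < d \<Longrightarrow> cmod (w' i) = 1"
    show "Tr (hopT {..<d} w' (V \<circ> red) ^^ k) = Tr (hopT {..<d} w' (\<lambda>_. 0) ^^ k)"
      using isospectral_imp_traces[OF assms, of w' k, unfolded z] w' by simp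
  qed (use w in blast)
qed

definition avg :: "nat \<Rightarrow> ((nat \<Rightarrow> int) \<Rightarrow> complex) \<Rightarrow> (nat \<Rightarrow> int) \<Rightarrow> complex" where
  "avg i V n = (\<Sum>s<q i. V (sh i (int s) n)) / of_nat (q i)"

lemma sh_period: "i < d \<Longrightarrow> per u \<Longrightarrow> u (sh i (int (q i) + s) n) = u (sh i s n)"
  by (intro per_cong) (auto simp: red_def sh_def fun_eq_iff add.left_commute[of "n i"])

lemma avg_sh:
  assumes "i < d" "per V"
  shows "avg i V (sh i 1 n) = avg i V n"
proof -
  obtain m where m: "q i = Suc m" using q_pos[OF assms(1)] by (cases "q i") auto
  have "(\<Sum>s<q i. V (sh i (int s) (sh i 1 n))) = (\<Sum>s<m. V (sh i (int (Suc s)) n)) + V (sh i (int (q i) + 0) n)"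
    by (simp add: m add.commute)
  also have "V (sh i (int (q i) + 0) n) = V (sh i 0 n)" by (rule sh_period[OF assms])
  also have "(\<Sum>s<m. V (sh i (int (Suc s)) n)) + V (sh i 0 n) = (\<Sum>s<q i. V (sh i (int s) n))"
    unfolding m sum.lessThan_Suc_shift by simp
  finally show ?thesis by (simp add: avg_def)
qed

lemma avg_sh_int:
  assumes "i < d" "per V"
  shows "avg i V (sh i s n) = avg i V n"
proof -
  have pos: "avg i V (sh i (int k) n) = avg i V n" for k n
  proof (induction k)
    case (Suc k)
    have "sh i (int (Suc k)) n = sh i 1 (sh i (int k) n)" by (simp add: add.commute)
    then show ?case using avg_sh[OF assms, of "sh i (int k) n"] Suc by simp
  qed simp
  show ?thesis
  proof (cases "s \<ge> 0")
    case True
    then show ?thesis using pos[of "nat s" n] by simp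
  next
    case False
    then show ?thesis using pos[of "nat (- s)" "sh i s n"] by simp
  qed
qed

section \<open>The limit of an infinite weight in one direction\<close>

context
  fixes A :: "nat set" and i :: nat and w :: "nat \<Rightarrow> complex"
  assumes A: "finite A" "i \<in> A" "i < d" and w: "\<And>j. w j \<noteq> 0"
begin

text \<open>For \<open>\<epsilon> \<noteq> 0\<close> this is \<open>\<epsilon>\<close> times the
  hopping operator with weight \<open>inverse \<epsilon>\<close> in direction \<open>i\<close>.
  Written like this it also makes sense at \<open>\<epsilon> = 0\<close>, where it is the plain
  shift.\<close>

definition scaledT :: "((nat \<Rightarrow> int) \<Rightarrow> complex) \<Rightarrow> complex \<Rightarrow> ((nat \<Rightarrow> int) \<Rightarrow> complex) \<Rightarrow> (nat \<Rightarrow> int) \<Rightarrow> complex" where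
  "scaledT V \<epsilon> u n = u (sh i 1 n) + \<epsilon> * hopT (A - {i}) w V u n + \<epsilon> ^ 2 * u (sh i (-1) n)"

text \<open>The difference quotient at 0 of the \<open>q i\<close>-th power, since shifting by
  \<open>q i\<close> is the identity on periodic functions.\<close>

definition slope :: "((nat \<Rightarrow> int) \<Rightarrow> complex) \<Rightarrow> complex \<Rightarrow> ((nat \<Rightarrow> int) \<Rightarrow> complex) \<Rightarrow> (nat \<Rightarrow> int) \<Rightarrow> complex" where
  "slope V \<epsilon> u n = ((scaledT V \<epsilon> ^^ q i) u n - u n) / \<epsilon>"

lemma hopT_linear:
  "hopT B w V (\<lambda>n. a * f n + b * g n) = (\<lambda>n. a * hopT B w V f n + b * hopT B w V g n)"
  by (rule ext) (simp add: hopT_def sum_distrib_left sum.distrib algebra_simps)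

lemma scaledT_linear:
  "scaledT V \<epsilon> (\<lambda>n. a * f n + b * g n) = (\<lambda>n. a * scaledT V \<epsilon> f n + b * scaledT V \<epsilon> g n)"
  by (rule ext) (simp add: scaledT_def hopT_linear algebra_simps)

lemma scaledT_pow_linear:
  "(scaledT V \<epsilon> ^^ k) (\<lambda>n. a * f n + b * g n) = (\<lambda>n. a * (scaledT V \<epsilon> ^^ k) f n + b * (scaledT V \<epsilon> ^^ k) g n)"
  by (induction k) (simp_all add: scaledT_linear)

lemma scaledT_eq:
  assumes "\<epsilon> \<noteq> 0"
  shows "scaledT V \<epsilon> u = (\<lambda>n. \<epsilon> * hopT A (w(i := inverse \<epsilon>)) V u n)"
proof
  fix n
  have "hopT A (w(i := inverse \<epsilon>)) V u n = (inverse \<epsilon> * u (sh i 1 n) + \<epsilon> * u (sh i (-1) n))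
      + (\<Sum>j\<in>A-{i}. w j * u (sh j 1 n) + inverse (w j) * u (sh j (-1) n)) + V n * u n"
    unfolding hopT_def using A by (subst sum.remove[of A i]) auto
  then show "scaledT V \<epsilon> u n = \<epsilon> * hopT A (w(i := inverse \<epsilon>)) V u n"
    using assms by (simp add: scaledT_def hopT_def algebra_simps power2_eq_square)
qed

lemma scaledT_pow_eq:
  assumes "\<epsilon> \<noteq> 0"
  shows "(scaledT V \<epsilon> ^^ k) u = (\<lambda>n. \<epsilon> ^ k * (hopT A (w(i := inverse \<epsilon>)) V ^^ k) u n)"
proof (induction k)
  case (Suc k)
  have sm: "hopT A w' V (\<lambda>n. c * f n) = (\<lambda>n. c * hopT A w' V f n)" for c f w'
    by (rule ext) (simp add: hopT_def sum_distrib_left algebra_simps)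
  have "(scaledT V \<epsilon> ^^ Suc k) u = scaledT V \<epsilon> (\<lambda>n. \<epsilon> ^ k * (hopT A (w(i := inverse \<epsilon>)) V ^^ k) u n)"
    by (simp only: funpow.simps comp_def Suc)
  also have "\<dots> = (\<lambda>n. \<epsilon> * (\<epsilon> ^ k * hopT A (w(i := inverse \<epsilon>)) V ((hopT A (w(i := inverse \<epsilon>)) V ^^ k) u) n))"
    by (simp only: scaledT_eq[OF assms] sm)
  finally show ?case by (simp only: funpow.simps comp_def power_Suc mult.assoc)
qed simp

text \<open>\<open>slope\<close> is a polynomial in \<open>scaledT\<close>, so these traces are
  combinations of traces of powers of the hopping operator. The free exponent \<open>s\<close>
  absorbs the factors that the induction on \<open>r\<close> splits off.\<close>

lemma Tr_slope_indep:
  assumes "iso A V" "\<epsilon> \<noteq> 0"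
  shows "Tr (\<lambda>u. (scaledT V \<epsilon> ^^ s) ((slope V \<epsilon> ^^ r) u))
    = Tr (\<lambda>u. (scaledT (\<lambda>_. 0) \<epsilon> ^^ s) ((slope (\<lambda>_. 0) \<epsilon> ^^ r) u))"
proof (induction r arbitrary: s)
  case 0
  have "Tr (hopT A (w(i := inverse \<epsilon>)) V ^^ s) = Tr (hopT A (w(i := inverse \<epsilon>)) (\<lambda>_. 0) ^^ s)"
    using w assms(2) by (intro isoD[OF assms(1)]) auto
  then show ?case using assms(2) by (simp add: Tr_def scaledT_pow_eq flip: sum_distrib_left)
next
  case (Suc r)
  have "Tr (\<lambda>u. (scaledT V \<epsilon> ^^ s) ((slope V \<epsilon> ^^ Suc r) u))
    = inverse \<epsilon> * Tr (\<lambda>u. (scaledT V \<epsilon> ^^ (s + q i)) ((slope V \<epsilon> ^^ r) u))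
      + - inverse \<epsilon> * Tr (\<lambda>u. (scaledT V \<epsilon> ^^ s) ((slope V \<epsilon> ^^ r) u))" for V
  proof -
    have "slope V \<epsilon> f = (\<lambda>n. inverse \<epsilon> * (scaledT V \<epsilon> ^^ q i) f n + - inverse \<epsilon> * f n)" for f
      by (rule ext) (simp add: slope_def divide_inverse algebra_simps)
    then have "(scaledT V \<epsilon> ^^ s) ((slope V \<epsilon> ^^ Suc r) u) n
      = inverse \<epsilon> * (scaledT V \<epsilon> ^^ (s + q i)) ((slope V \<epsilon> ^^ r) u) n
        + - inverse \<epsilon> * (scaledT V \<epsilon> ^^ s) ((slope V \<epsilon> ^^ r) u) n" for u n
      by (simp only: scaledT_pow_linear funpow_add funpow.simps comp_def)
    then show ?thesis unfolding Tr_def by (simp only: sum.distrib sum_distrib_left)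
  qed
  then show ?case using Suc by simp
qed

lemma tendsto_hopT:
  assumes "\<And>n. ((\<lambda>\<epsilon>. u \<epsilon> n) \<longlongrightarrow> ul n) F"
  shows "((\<lambda>\<epsilon>. hopT B w V (u \<epsilon>) n) \<longlongrightarrow> hopT B w V ul n) F"
  unfolding hopT_def by (intro tendsto_intros assms)

lemma tendsto_scaledT:
  assumes "\<And>n. ((\<lambda>\<epsilon>. u \<epsilon> n) \<longlongrightarrow> ul n) (at 0)"
  shows "((\<lambda>\<epsilon>. scaledT V \<epsilon> (u \<epsilon>) n) \<longlongrightarrow> ul (sh i 1 n)) (at 0)"
proof -
  have "((\<lambda>\<epsilon>. scaledT V \<epsilon> (u \<epsilon>) n) \<longlongrightarrow> ul (sh i 1 n) + 0 * hopT (A - {i}) w V ul n + 0 ^ 2 * ul (sh i (-1) n)) (at 0)"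
    unfolding scaledT_def by (intro tendsto_intros tendsto_hopT assms)
  then show ?thesis by simp
qed

lemma tendsto_scaledT_pow:
  assumes "\<And>n. ((\<lambda>\<epsilon>. u \<epsilon> n) \<longlongrightarrow> ul n) (at 0)"
  shows "((\<lambda>\<epsilon>. (scaledT V \<epsilon> ^^ k) (u \<epsilon>) n) \<longlongrightarrow> ul (sh i (int k) n)) (at 0)"
proof (induction k arbitrary: n)
  case (Suc k)
  show ?case using tendsto_scaledT[where u = "\<lambda>\<epsilon>. (scaledT V \<epsilon> ^^ k) (u \<epsilon>)" and
      ul = "\<lambda>m. ul (sh i (int k) m)" and V = V and n = n, OF Suc] by (simp add: add.commute)
qed (use assms in auto)

text \<open>Product rule for a perturbation that does not commute with the shift: \<open>b\<close>
  is the position at which the first-order term stands. The argument \<open>u \<epsilon>\<close> may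
  vary with \<open>\<epsilon>\<close>, which allows iteration.\<close>

lemma tendsto_difference_quotient:
  assumes "\<And>n. ((\<lambda>\<epsilon>. u \<epsilon> n) \<longlongrightarrow> ul n) (at 0)"
  shows "((\<lambda>\<epsilon>. ((scaledT V \<epsilon> ^^ a) (u \<epsilon>) n - u \<epsilon> (sh i (int a) n)) / \<epsilon>) \<longlongrightarrow>
    (\<Sum>b<a. hopT (A - {i}) w V (\<lambda>m. ul (sh i (int b) m)) (sh i (int (a - Suc b)) n))) (at 0)"
proof (induction a arbitrary: n)
  case (Suc a)
  define D where "D \<epsilon> n = ((scaledT V \<epsilon> ^^ a) (u \<epsilon>) n - u \<epsilon> (sh i (int a) n)) / \<epsilon>" for \<epsilon> n
  define L where "L n = (\<Sum>b<a. hopT (A - {i}) w V (\<lambda>m. ul (sh i (int b) m)) (sh i (int (a - Suc b)) n))" for n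
  have DL: "((\<lambda>\<epsilon>. D \<epsilon> n) \<longlongrightarrow> L n) (at 0)" for n unfolding D_def L_def by (rule Suc)
  have eq: "((scaledT V \<epsilon> ^^ Suc a) (u \<epsilon>) n - u \<epsilon> (sh i (int (Suc a)) n)) / \<epsilon>
    = scaledT V \<epsilon> (D \<epsilon>) n + (hopT (A - {i}) w V (\<lambda>m. u \<epsilon> (sh i (int a) m)) n + \<epsilon> * u \<epsilon> (sh i (int a - 1) n))"
    if "\<epsilon> \<noteq> 0" for \<epsilon>
  proof -
    have "(scaledT V \<epsilon> ^^ a) (u \<epsilon>) = (\<lambda>n. \<epsilon> * D \<epsilon> n + 1 * u \<epsilon> (sh i (int a) n))"
      using that by (simp add: D_def fun_eq_iff)
    then have "(scaledT V \<epsilon> ^^ Suc a) (u \<epsilon>) n = \<epsilon> * scaledT V \<epsilon> (D \<epsilon>) n + 1 * scaledT V \<epsilon> (\<lambda>m. u \<epsilon> (sh i (int a) m)) n"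
      by (simp only: scaledT_linear funpow.simps comp_def)
    also have "scaledT V \<epsilon> (\<lambda>m. u \<epsilon> (sh i (int a) m)) n = u \<epsilon> (sh i (int (Suc a)) n)
      + \<epsilon> * (hopT (A - {i}) w V (\<lambda>m. u \<epsilon> (sh i (int a) m)) n + \<epsilon> * u \<epsilon> (sh i (int a - 1) n))"
      by (simp add: scaledT_def algebra_simps power2_eq_square)
    finally show ?thesis using that by (simp add: field_simps)
  qed
  have "((\<lambda>\<epsilon>. scaledT V \<epsilon> (D \<epsilon>) n + (hopT (A - {i}) w V (\<lambda>m. u \<epsilon> (sh i (int a) m)) n + \<epsilon> * u \<epsilon> (sh i (int a - 1) n)))
    \<longlongrightarrow> L (sh i 1 n) + (hopT (A - {i}) w V (\<lambda>m. ul (sh i (int a) m)) n + 0 * ul (sh i (int a - 1) n))) (at 0)"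
    by (intro tendsto_intros tendsto_scaledT tendsto_hopT DL assms)
  moreover have "L (sh i 1 n) + (hopT (A - {i}) w V (\<lambda>m. ul (sh i (int a) m)) n + 0 * ul (sh i (int a - 1) n))
    = (\<Sum>b<Suc a. hopT (A - {i}) w V (\<lambda>m. ul (sh i (int b) m)) (sh i (int (Suc a - Suc b)) n))"
  proof -
    have "int (a - Suc b) + 1 = int (Suc a - Suc b)" if "b < a" for b using that by simp
    then show ?thesis unfolding L_def by (simp add: add.commute)
  qed
  ultimately show ?case
    using eq by (subst tendsto_cong[OF eventually_mono[OF eventually_neq_at_within[of 0]]]) auto
qed simp

text \<open>The hops in the other directions commute with the shift and occur \<open>q i\<close>
  times unchanged, whereas the potential occurs once at each of its \<open>q i\<close> translates.
  The remaining shift by \<open>q i - 1\<close> is a shift by \<open>- 1\<close> on periodic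
  functions.\<close>

lemma tendsto_slope:
  assumes u: "\<And>n. ((\<lambda>\<epsilon>. u \<epsilon> n) \<longlongrightarrow> ul n) (at 0)" and per: "\<And>\<epsilon>. per (u \<epsilon>)" "per ul" "per V"
  shows "((\<lambda>\<epsilon>. slope V \<epsilon> (u \<epsilon>) n) \<longlongrightarrow> of_nat (q i) * hopT (A - {i}) w (avg i V) ul (sh i (-1) n)) (at 0)"
proof -
  have q1: "q i > 0" using q_pos A by simp
  have e: "(scaledT V \<epsilon> ^^ q i) (u \<epsilon>) n - u \<epsilon> (sh i (int (q i)) n) = (scaledT V \<epsilon> ^^ q i) (u \<epsilon>) n - u \<epsilon> n" for \<epsilon>
    using sh_period[OF A(3) per(1), of \<epsilon> 0 n] by simp
  have c: "ul (sh j s (sh i (int (q i) - 1) n)) = ul (sh j s (sh i (- 1) n))" for j s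
    using sh_period[OF A(3) per(2), of "-1" "sh j s n"] by (simp add: sh_commute[of i _ j])
  have c': "ul (sh i (int (q i) - 1) n) = ul (sh i (- 1) n)"
    using sh_period[OF A(3) per(2), of "-1" n] by simp
  have "(\<Sum>b<q i. hopT (A - {i}) w V (\<lambda>m. ul (sh i (int b) m)) (sh i (int (q i - Suc b)) n))
    = (\<Sum>b<q i. (\<Sum>j\<in>A-{i}. w j * ul (sh j 1 (sh i (-1) n)) + inverse (w j) * ul (sh j (-1) (sh i (-1) n)))
        + V (sh i (int (q i - Suc b)) n) * ul (sh i (-1) n))"
  proof (intro sum.cong refl)
    fix b assume "b \<in> {..<q i}"
    then have b: "int (q i - Suc b) + int b = int (q i) - 1" by simp
    have "ul (sh i (int b) (sh j s (sh i (int (q i - Suc b)) n))) = ul (sh j s (sh i (-1) n))" for j s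
      using c[of j s] by (simp add: sh_commute[of i _ j] b)
    moreover have "ul (sh i (int b) (sh i (int (q i - Suc b)) n)) = ul (sh i (-1) n)"
      using c' by (simp only: sh_sh b)
    ultimately show "hopT (A - {i}) w V (\<lambda>m. ul (sh i (int b) m)) (sh i (int (q i - Suc b)) n)
      = (\<Sum>j\<in>A-{i}. w j * ul (sh j 1 (sh i (-1) n)) + inverse (w j) * ul (sh j (-1) (sh i (-1) n)))
        + V (sh i (int (q i - Suc b)) n) * ul (sh i (-1) n)"
      by (simp only: hopT_def)
  qed
  also have "\<dots> = of_nat (q i) * (\<Sum>j\<in>A-{i}. w j * ul (sh j 1 (sh i (-1) n)) + inverse (w j) * ul (sh j (-1) (sh i (-1) n)))
     + (\<Sum>b<q i. V (sh i (int (q i - Suc b)) n)) * ul (sh i (-1) n)"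
    by (simp add: sum.distrib sum_distrib_right distrib_left)
  also have "(\<Sum>b<q i. V (sh i (int (q i - Suc b)) n)) = (\<Sum>b<q i. V (sh i (int b) n))"
    by (rule sum.nat_diff_reindex)
  also have "\<dots> = of_nat (q i) * avg i V (sh i (-1) n)"
    using q1 avg_sh_int[OF A(3) per(3), of "-1" n] by (simp add: avg_def)
  finally have lim: "(\<Sum>b<q i. hopT (A - {i}) w V (\<lambda>m. ul (sh i (int b) m)) (sh i (int (q i - Suc b)) n))
    = of_nat (q i) * hopT (A - {i}) w (avg i V) ul (sh i (-1) n)"
    by (simp only: hopT_def distrib_left mult.assoc)
  show ?thesis
    using tendsto_difference_quotient[where u = u and ul = ul and V = V and a = "q i" and n = n, OF u] unfolding lim slope_def by (simp only: e)
qed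

lemma per_avg:
  assumes "per V"
  shows "per (avg i V)"
  unfolding per_def avg_def using per_sh[OF assms] by (simp add: per_def)

lemma per_scaledT: "per V \<Longrightarrow> per u \<Longrightarrow> per (scaledT V \<epsilon> u)"
  using per_sh[of u i] per_hopT[of V u "A - {i}" w] unfolding per_def scaledT_def by simp

lemma per_scaledT_pow: "per V \<Longrightarrow> per u \<Longrightarrow> per ((scaledT V \<epsilon> ^^ k) u)"
  by (induction k) (auto intro: per_scaledT)

lemma per_slope:
  assumes "per V" "per u"
  shows "per (slope V \<epsilon> u)"
proof -
  have "per ((scaledT V \<epsilon> ^^ q i) u)" using assms by (rule per_scaledT_pow)
  then show ?thesis using assms(2) by (simp add: per_def slope_def)
qed

lemma per_slope_pow: "per V \<Longrightarrow> per u \<Longrightarrow> per ((slope V \<epsilon> ^^ k) u)"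
  by (induction k) (auto intro: per_slope)

lemma hopT_avg_shift:
  assumes "per V"
  shows "(hopT (A - {i}) w (avg i V) ^^ r) (\<lambda>n. u (sh i s n)) = (\<lambda>n. (hopT (A - {i}) w (avg i V) ^^ r) u (sh i s n))"
proof (induction r)
  case (Suc r)
  have "avg i V n = avg i V (sh i s n)" for n using avg_sh_int[OF A(3) assms] by simp
  then have "hopT (A - {i}) w (avg i V) (\<lambda>n. f (sh i s n)) = (\<lambda>n. hopT (A - {i}) w (avg i V) f (sh i s n))" for f
    by (intro ext) (simp add: hopT_def sh_commute[of i s])
  then show ?case by (simp add: Suc)
qed simp

lemma tendsto_slope_pow:
  assumes "per V" "per u"
  shows "((\<lambda>\<epsilon>. (slope V \<epsilon> ^^ r) u n) \<longlongrightarrow>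
    of_nat (q i) ^ r * (hopT (A - {i}) w (avg i V) ^^ r) u (sh i (- int r) n)) (at 0)"
proof (induction r arbitrary: n)
  case (Suc r)
  define K where "K = hopT (A - {i}) w (avg i V)"
  define ul where "ul n = of_nat (q i) ^ r * (K ^^ r) u (sh i (- int r) n)" for n
  have pu0: "per ul"
    using per_sh[OF per_hopT_pow[OF per_avg[OF assms(1)] assms(2), where A = "A - {i}" and w = w and k = r]]
    by (simp add: per_def ul_def K_def)
  have "((\<lambda>\<epsilon>. slope V \<epsilon> ((slope V \<epsilon> ^^ r) u) n) \<longlongrightarrow> of_nat (q i) * K ul (sh i (-1) n)) (at 0)"
    unfolding K_def
  proof (rule tendsto_slope)
    show "((\<lambda>\<epsilon>. (slope V \<epsilon> ^^ r) u n) \<longlongrightarrow> ul n) (at 0)" for n unfolding ul_def K_def by (rule Suc)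
  qed (use pu0 assms per_slope_pow in auto)
  moreover have "K ul (sh i (-1) n) = of_nat (q i) ^ r * (K ^^ Suc r) u (sh i (- int (Suc r)) n)"
  proof -
    have "ul = (\<lambda>n. of_nat (q i) ^ r * (K ^^ r) u (sh i (- int r) n) + 0 * ul n)" by (simp add: ul_def fun_eq_iff)
    then have "K ul = K (\<lambda>n. of_nat (q i) ^ r * (K ^^ r) u (sh i (- int r) n) + 0 * ul n)" by (rule arg_cong)
    also have "\<dots> = (\<lambda>n. of_nat (q i) ^ r * K (\<lambda>n. (K ^^ r) u (sh i (- int r) n)) n + 0 * K ul n)"
      unfolding K_def by (rule hopT_linear)
    finally have "K ul = (\<lambda>n. of_nat (q i) ^ r * K (\<lambda>n. (K ^^ r) u (sh i (- int r) n)) n)" by simp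
    moreover have "K (\<lambda>n. (K ^^ r) u (sh i (- int r) n)) = (\<lambda>n. K ((K ^^ r) u) (sh i (- int r) n))"
      using hopT_avg_shift[OF assms(1), of 1 "(K ^^ r) u" "- int r"] by (simp add: K_def)
    ultimately show ?thesis by (simp add: algebra_simps)
  qed
  ultimately show ?case by (simp add: K_def mult.assoc)
qed simp

text \<open>As many factors \<open>scaledT\<close> as \<open>slope\<close> cancel, in the limit, the
  backward shift by \<open>r\<close> that \<open>slope ^^ r\<close> leaves. The limits for
  \<open>V\<close> and for 0 agree because the traces agree for every nonzero
  \<open>\<epsilon>\<close>.\<close>

lemma Tr_avg:
  assumes "iso A V" "per V"
  shows "Tr (hopT (A - {i}) w (avg i V) ^^ r) = Tr (hopT (A - {i}) w (\<lambda>_. 0) ^^ r)"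
proof -
  have lim: "((\<lambda>\<epsilon>. Tr (\<lambda>u. (scaledT V \<epsilon> ^^ r) ((slope V \<epsilon> ^^ r) u))) \<longlongrightarrow>
      of_nat (q i) ^ r * Tr (hopT (A - {i}) w (avg i V) ^^ r)) (at 0)" if "per V" for V
  proof -
    have "((\<lambda>\<epsilon>. (scaledT V \<epsilon> ^^ r) ((slope V \<epsilon> ^^ r) (dl p)) p) \<longlongrightarrow>
      of_nat (q i) ^ r * (hopT (A - {i}) w (avg i V) ^^ r) (dl p) p) (at 0)" for p
    proof -
      have "((\<lambda>\<epsilon>. (scaledT V \<epsilon> ^^ r) ((slope V \<epsilon> ^^ r) (dl p)) p) \<longlongrightarrow>
        of_nat (q i) ^ r * (hopT (A - {i}) w (avg i V) ^^ r) (dl p) (sh i (- int r) (sh i (int r) p))) (at 0)"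
        by (rule tendsto_scaledT_pow) (rule tendsto_slope_pow[OF that per_dl])
      then show ?thesis by simp
    qed
    then show ?thesis unfolding Tr_def sum_distrib_left by (rule tendsto_sum)
  qed
  have z: "per (\<lambda>_. 0)" "avg i (\<lambda>_. 0) = (\<lambda>_. 0)" by (auto simp: per_def avg_def)
  have "((\<lambda>\<epsilon>. Tr (\<lambda>u. (scaledT V \<epsilon> ^^ r) ((slope V \<epsilon> ^^ r) u))) \<longlongrightarrow>
      of_nat (q i) ^ r * Tr (hopT (A - {i}) w (\<lambda>_. 0) ^^ r)) (at 0)"
    using lim[OF z(1)] Tr_slope_indep[OF assms(1)] unfolding z(2)
    by (subst tendsto_cong[OF eventually_mono[OF eventually_neq_at_within[of 0]]]) auto
  from tendsto_unique[OF _ lim[OF assms(2)] this]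
  show ?thesis using q_pos[OF A(3)] by auto
qed

end

text \<open>Letting the weight of direction \<open>i\<close> tend to infinity replaces the potential by its average over that
  direction: with \<open>U = \<epsilon> T = X + \<epsilon> Y + \<epsilon>^2 X^-1\<close>, the operator \<open>(U^q - 1) / \<epsilon>\<close> tends to \<open>q avg(Y) X^-1\<close>,
  and the traces of polynomials in \<open>U\<close> do not see the potential.\<close>

lemma iso_avg:
  assumes "iso A V" "per V" "finite A" "i \<in> A" "i < d"
  shows "iso (A - {i}) (avg i V)" "per (avg i V)"
  using Tr_avg[OF assms(3-5) _ assms(1,2)] per_avg[OF assms(3-5) _ assms(2), of "\<lambda>_. 1"] by (auto simp: iso_def)

end

section \<open>Periods at most three\<close>

text \<open>\<open>wdT A w V k h\<close> is the sum over all words of length \<open>k\<close> with exactly \<open>h\<close> hops (in contrast to \<open>words\<close>,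
  which counts the factors of the potential).\<close>

fun wdT :: "nat set \<Rightarrow> (nat \<Rightarrow> complex) \<Rightarrow> ((nat \<Rightarrow> int) \<Rightarrow> complex) \<Rightarrow> nat \<Rightarrow> nat \<Rightarrow>
    ((nat \<Rightarrow> int) \<Rightarrow> complex) \<Rightarrow> (nat \<Rightarrow> int) \<Rightarrow> complex" where
  "wdT A w V 0 h u n = (if h = 0 then u n else 0)"
| "wdT A w V (Suc k) h u n = V n * wdT A w V k h u n
     + (case h of 0 \<Rightarrow> 0 | Suc i \<Rightarrow> hopT A w (\<lambda>_. 0) (wdT A w V k i u) n)"

lemma wdT_eq_0: "k < h \<Longrightarrow> wdT A w V k h u n = 0"
proof (induction k arbitrary: h n)
  case (Suc k)
  then obtain i where i: "h = Suc i" by (cases h) auto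
  have "wdT A w V k i u = (\<lambda>_. 0)" using Suc i by (intro ext) auto
  then show ?case using Suc i by (simp add: hopT_def)
qed auto

lemma hopT_pow_words: "(hopT A w V ^^ k) u n = (\<Sum>h\<le>k. wdT A w V k h u n)"
proof (induction k arbitrary: n)
  case (Suc k)
  have "(\<Sum>h\<le>Suc k. wdT A w V (Suc k) h u n) = (\<Sum>h\<le>Suc k. V n * wdT A w V k h u n)
     + (\<Sum>h\<le>Suc k. case h of 0 \<Rightarrow> 0 | Suc i \<Rightarrow> hopT A w (\<lambda>_. 0) (wdT A w V k i u) n)"
    by (simp only: wdT.simps sum.distrib)
  also have "(\<Sum>h\<le>Suc k. case h of 0 \<Rightarrow> 0 | Suc i \<Rightarrow> hopT A w (\<lambda>_. 0) (wdT A w V k i u) n)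
    = (\<Sum>i\<le>k. hopT A w (\<lambda>_. 0) (wdT A w V k i u) n)"
    by (subst sum.atMost_Suc_shift) simp
  also have "\<dots> = hopT A w (\<lambda>_. 0) (\<lambda>n. \<Sum>i\<le>k. 1 * wdT A w V k i u n) n"
    unfolding hopT_sum by simp
  also have "(\<Sum>h\<le>Suc k. V n * wdT A w V k h u n) = V n * (\<Sum>h\<le>k. wdT A w V k h u n)"
    by (simp add: wdT_eq_0 sum_distrib_left)
  finally have "(\<Sum>h\<le>Suc k. wdT A w V (Suc k) h u n)
    = V n * (\<Sum>h\<le>k. wdT A w V k h u n) + hopT A w (\<lambda>_. 0) (\<lambda>n. \<Sum>i\<le>k. 1 * wdT A w V k i u n) n" .
  moreover have "(hopT A w V ^^ k) u = (\<lambda>n. \<Sum>h\<le>k. wdT A w V k h u n)" by (rule ext) (rule Suc)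
  ultimately have "(\<Sum>h\<le>Suc k. wdT A w V (Suc k) h u n)
    = V n * (hopT A w V ^^ k) u n + hopT A w (\<lambda>_. 0) ((hopT A w V ^^ k) u) n"
    by (simp only: mult_1_left)
  then show ?case by (simp add: hopT_def[of A w V "(hopT A w V ^^ k) u"] hopT_def[of A w "\<lambda>_. 0"])
qed simp

lemma wdT_full: "wdT A w V k k u = (hopT A w (\<lambda>_. 0) ^^ k) u"
proof (induction k)
  case (Suc k)
  then show ?case by (intro ext) (simp add: wdT_eq_0)
qed (simp add: fun_eq_iff)

lemma wdT_neg: "wdT A (\<lambda>i. - w i) V k h u n = (-1) ^ h * wdT A w V k h u n"
proof (induction k arbitrary: h n)
  case (Suc k)
  show ?case
  proof (cases h)
    case (Suc i)
    have "wdT A (\<lambda>i. - w i) V k i u = (\<lambda>n. (-1) ^ i * wdT A w V k i u n)" using Suc.IH by (intro ext)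
    moreover have "hopT A (\<lambda>i. - w i) (\<lambda>_. 0) (\<lambda>n. c * f n) n = - c * hopT A w (\<lambda>_. 0) f n" for c f
      by (simp add: hopT_def sum_distrib_left algebra_simps sum_negf sum_subtractf sum.distrib)
    ultimately have "hopT A (\<lambda>i. - w i) (\<lambda>_. 0) (wdT A (\<lambda>i. - w i) V k i u) n
      = (-1) ^ Suc i * hopT A w (\<lambda>_. 0) (wdT A w V k i u) n"
      by simp
    then show ?thesis using Suc.IH[of h n] Suc by (simp add: algebra_simps)
  qed (use Suc.IH[of 0 n] in simp)
qed auto

lemma wdT_0: "wdT A w V k 0 u n = V n ^ k * u n"
  by (induction k) auto

text \<open>Splits each word at its leftmost hop, which is preceded by \<open>a\<close> factors of
  the potential.\<close>

lemma wdT_Suc: "wdT A w V k (Suc h) u n = (\<Sum>a<k. V n ^ a * hopT A w (\<lambda>_. 0) (wdT A w V (k - Suc a) h u) n)"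
proof (induction k)
  case (Suc k)
  have "(\<Sum>a<Suc k. V n ^ a * hopT A w (\<lambda>_. 0) (wdT A w V (Suc k - Suc a) h u) n)
    = hopT A w (\<lambda>_. 0) (wdT A w V k h u) n
      + (\<Sum>a<k. V n ^ Suc a * hopT A w (\<lambda>_. 0) (wdT A w V (k - Suc a) h u) n)"
    by (subst sum.lessThan_Suc_shift) simp
  then show ?case by (simp add: Suc sum_distrib_left mult.assoc)
qed simp

lemma wdT_shift:
  assumes "\<And>n. V (sh i 1 n) = \<zeta> * V n" "h \<le> k"
  shows "wdT A w V k h u (sh i 1 n) = \<zeta> ^ (k - h) * wdT A w V k h (\<lambda>n. u (sh i 1 n)) n"
  using assms(2)
proof (induction k arbitrary: h n)
  case (Suc k)
  have 1: "V (sh i 1 n) * wdT A w V k h u (sh i 1 n) = \<zeta> ^ (Suc k - h) * (V n * wdT A w V k h (\<lambda>n. u (sh i 1 n)) n)"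
  proof (cases "h \<le> k")
    case True
    then show ?thesis using Suc.IH[of h n] by (simp add: assms(1) Suc_diff_le)
  qed (simp add: wdT_eq_0)
  have 2: "hopT A w (\<lambda>_. 0) (wdT A w V k h' u) (sh i 1 n)
    = \<zeta> ^ (k - h') * hopT A w (\<lambda>_. 0) (wdT A w V k h' (\<lambda>n. u (sh i 1 n))) n" if "h' \<le> k" for h'
    using Suc.IH[OF that]
    by (simp add: hopT_def sh_commute[of _ _ i] sum_distrib_left algebra_simps)
  show ?case
  proof (cases h)
    case 0
    then show ?thesis using 1 by simp
  next
    case (Suc h')
    then show ?thesis using 1 2[of h'] Suc.prems by (simp add: distrib_left)
  qed
qed auto

context torus
begin

lemma sum_box_sh:
  assumes "per f"
  shows "(\<Sum>p\<in>box. f (sh i s p)) = (\<Sum>p\<in>box. f p)"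
proof (rule sum.reindex_bij_witness[of _ "\<lambda>p. red (sh i (- s) p)" "\<lambda>p. red (sh i s p)"])
  fix p assume "p \<in> box"
  then have "red p = p" by (simp add: box_def)
  then show "red (sh i (- s) (red (sh i s p))) = p" "red (sh i s (red (sh i (- s) p))) = p"
    by (simp_all add: red_sh)
  show "f (red (sh i s p)) = f (sh i s p)" by (rule perD[OF assms])
qed auto

lemma shift_invariant_const:
  assumes "\<And>j n. j < d \<Longrightarrow> P (sh j 1 n) = P n" "\<And>n. P (red n) = P n"
  shows "P n = P m"
proof -
  have sh: "P (sh j s n) = P n" if j: "j < d" for j s n
  proof -
    have pos: "P (sh j (int k) n) = P n" for k n
    proof (induction k)
      case (Suc k)
      have "sh j (int (Suc k)) n = sh j 1 (sh j (int k) n)" by (simp add: add.commute)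
      then show ?case using assms(1)[OF j, of "sh j (int k) n"] Suc by simp
    qed simp
    show ?thesis
    proof (cases "s \<ge> 0")
      case True
      then show ?thesis using pos[of "nat s" n] by simp
    next
      case False
      then show ?thesis using pos[of "nat (- s)" "sh j s n"] by simp
    qed
  qed
  have zero: "P n = P (\<lambda>_. 0)" for n
  proof -
    have "P (\<lambda>i. if i < j then 0 else n i) = P n" if "j \<le> d" for j
      using that
    proof (induction j)
      case (Suc j)
      have "(\<lambda>i. if i < Suc j then 0 else n i) = sh j (- n j) (\<lambda>i. if i < j then 0 else n i)"
        by (auto simp: sh_def fun_eq_iff)
      then show ?case using sh[of j "- n j" "\<lambda>i. if i < j then 0 else n i"] Suc by simp
    qed simp
    then have "P n = P (\<lambda>i. if i < d then 0 else n i)" by simp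
    also have "\<dots> = P (red (\<lambda>i. if i < d then 0 else n i))" by (simp add: assms(2))
    also have "red (\<lambda>i. if i < d then 0 else n i) = (\<lambda>_. 0)" by (auto simp: red_def)
    finally show ?thesis .
  qed
  show ?thesis using zero[of n] zero[of m] by simp
qed

lemma card_box_pos: "card box > 0"
  by (metis card_gt_0_iff empty_iff finite_box red_in_box)

lemma const_sum_0:
  fixes f :: "(nat \<Rightarrow> int) \<Rightarrow> complex"
  assumes "\<And>j n. j < d \<Longrightarrow> f (sh j 1 n) = f n" "per f" "(\<Sum>p\<in>box. f p) = 0"
  shows "f n = 0"
proof -
  have "f p = f n" for p using shift_invariant_const[of f p n] assms by (auto simp: per_def)
  then have "(\<Sum>p\<in>box. f p) = (\<Sum>p\<in>box. f n)" by (intro sum.cong[OF refl])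
  then have "of_nat (card box) * f n = 0" using assms(3) by simp
  then show ?thesis using card_box_pos by auto
qed

lemma eig_sum_0:
  fixes f :: "(nat \<Rightarrow> int) \<Rightarrow> complex"
  assumes "\<And>n. f (sh i 1 n) = c * f n" "c \<noteq> 1" "per f"
  shows "(\<Sum>p\<in>box. f p) = 0"
proof -
  have "(\<Sum>p\<in>box. f p) = c * (\<Sum>p\<in>box. f p)"
    using sum_box_sh[OF assms(3), of i 1] by (simp add: assms(1) sum_distrib_left)
  then show ?thesis using assms(2) by simp
qed

lemma per_wdT: "per V \<Longrightarrow> per u \<Longrightarrow> per (wdT A w V k h u)"
proof (induction k arbitrary: h)
  case 0
  then show ?case by (auto simp: per_def)
next
  case (Suc k)
  have "per (hopT A w (\<lambda>_. 0) (wdT A w V k i u))" for i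
    by (intro per_hopT Suc.IH Suc.prems) (simp add: per_def)
  moreover have "per (wdT A w V k h u)" by (intro Suc.IH Suc.prems)
  ultimately show ?case using Suc.prems by (cases h) (auto simp: per_def)
qed

text \<open>Under the shift the diagonal entries of words with \<open>k - h\<close> factors of the
  potential are multiplied by \<open>\<zeta> ^ (k - h)\<close>; their sum over the torus vanishes
  unless this factor is 1.\<close>

lemma Tr_wdT_eq_0:
  assumes V: "\<And>n. V (sh i 1 n) = \<zeta> * V n" "per V" and h: "h \<le> k" "\<zeta> ^ (k - h) \<noteq> 1"
  shows "Tr (wdT A w V k h) = 0"
proof -
  define F where "F n = wdT A w V k h (dl (red n)) n" for n
  have perF: "per F"
    using perD[OF per_wdT[OF V(2) per_dl]] by (simp add: per_def F_def)
  have Fs: "F (sh i 1 n) = \<zeta> ^ (k - h) * F n" for n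
  proof -
    have "dl (red (sh i 1 n)) (sh i 1 m) = dl (red n) m" for m
    proof -
      have "red (sh i 1 m) = red (sh i 1 n) \<longleftrightarrow> red m = red n"
      proof
        assume "red (sh i 1 m) = red (sh i 1 n)"
        then have "red (sh i (-1) (red (sh i 1 m))) = red (sh i (-1) (red (sh i 1 n)))" by simp
        then show "red m = red n" by (simp add: red_sh)
      next
        assume "red m = red n"
        then show "red (sh i 1 m) = red (sh i 1 n)" by (metis red_sh)
      qed
      then show ?thesis by (simp add: dl_def)
    qed
    then show ?thesis unfolding F_def using wdT_shift[of V i \<zeta> h k A w "dl (red (sh i 1 n))" n, OF V(1) h(1)] by simp
  qed
  have "(\<Sum>p\<in>box. F p) = 0" by (rule eig_sum_0[OF Fs h(2) perF])
  then show ?thesis by (simp add: Tr_def F_def box_def)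
qed

text \<open>The term \<open>h = k\<close> is the trace for the zero potential and drops out. Adding
  the identities for \<open>w\<close> and \<open>- w\<close> removes the words with an odd number of
  hops.\<close>

lemma Tr_wdT_even:
  assumes "iso A V" "\<And>i. w i \<noteq> 0" "even k"
  shows "(\<Sum>h | h < k \<and> even h. Tr (wdT A w V k h)) = 0"
proof -
  have split: "Tr (hopT A w V ^^ k) = (\<Sum>h\<le>k. Tr (wdT A w V k h))" for w
    unfolding Tr_def hopT_pow_words by (rule sum.swap)
  have *: "(\<Sum>h<k. Tr (wdT A w V k h)) = 0" if "\<And>i. w i \<noteq> 0" for w
  proof -
    have "Tr (hopT A w V ^^ k) = Tr (wdT A w V k k)"
      using isoD[OF assms(1) that] by (simp add: Tr_def wdT_full)
    then show ?thesis using split[of w] by (simp add: lessThan_Suc_atMost[symmetric])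
  qed
  have neg: "Tr (wdT A (\<lambda>i. - w i) V k h) = (-1) ^ h * Tr (wdT A w V k h)" for h
    by (simp add: Tr_def wdT_neg sum_distrib_left)
  have "(\<Sum>h<k. (1 + (-1) ^ h) * Tr (wdT A w V k h)) = 0"
    using *[of w] *[of "\<lambda>i. - w i"] assms(2) by (simp add: neg distrib_right sum.distrib)
  also have "(\<Sum>h<k. (1 + (-1) ^ h) * Tr (wdT A w V k h)) = (\<Sum>h | h < k \<and> even h. 2 * Tr (wdT A w V k h))"
    by (intro sum.mono_neutral_cong_right) auto
  finally show ?thesis by (simp flip: sum_distrib_left)
qed

lemma Tr_wdT_0: "Tr (wdT A w V k 0) = (\<Sum>p\<in>box. V p ^ k)"
  unfolding Tr_def wdT_0 by (intro sum.cong) (auto simp: dl_def box_def)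

lemma even_below:
  "{h :: nat. h < 2 \<and> even h} = {0}" "{h :: nat. h < 6 \<and> even h} = {0, 2, 4}"
  "{h :: nat. h < 8 \<and> even h} = {0, 2, 4, 6}"
proof -
  have "{h. h < 2 * n \<and> even h} = (\<lambda>k. 2 * k) ` {..<n}" for n :: nat by (auto elim!: evenE)
  from this[of 1] this[of 3] this[of 4]
  show "{h :: nat. h < 2 \<and> even h} = {0}" "{h :: nat. h < 6 \<and> even h} = {0, 2, 4}"
    "{h :: nat. h < 8 \<and> even h} = {0, 2, 4, 6}" by (auto simp: lessThan_nat_numeral lessThan_Suc)
qed

lemma iso_sum_sq:
  assumes "iso A V"
  shows "(\<Sum>p\<in>box. V p * V p) = 0"
  using Tr_wdT_even[OF assms, of "\<lambda>_. 1" 2] by (simp add: even_below Tr_wdT_0 power2_eq_square)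

text \<open>Of the words with 2, 4, 6 or 8 factors of the potential only those with six survive, the
  other numbers not being divisible by 3. This leaves no hops in length 6 and two hops in length
  8.\<close>

lemma iso_eig:
  assumes "iso A V" "per V" "\<And>n. V (sh i 1 n) = \<zeta> * V n" and z: "\<zeta> ^ 3 = 1" "\<zeta> \<noteq> 1"
  shows "(\<Sum>p\<in>box. V p ^ 6) = 0" "Tr (wdT A (\<lambda>_. 1) V 8 2) = 0"
proof -
  have z2: "\<zeta> ^ 2 \<noteq> 1"
  proof
    assume "\<zeta> ^ 2 = 1"
    then have "\<zeta> ^ 3 = \<zeta>" by (simp add: power2_eq_square power3_eq_cube)
    then show False using z by simp
  qed
  have "\<zeta> ^ 4 = \<zeta> ^ 3 * \<zeta>" "\<zeta> ^ 8 = \<zeta> ^ 3 * \<zeta> ^ 3 * \<zeta> ^ 2" by (simp_all flip: power_add power_Suc2)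
  then have p: "\<zeta> ^ 2 \<noteq> 1" "\<zeta> ^ 4 \<noteq> 1" "\<zeta> ^ 8 \<noteq> 1" using z z2 by simp_all
  have t: "Tr (wdT A (\<lambda>_. 1) V k h) = 0" if "h \<le> k" "\<zeta> ^ (k - h) \<noteq> 1" for k h
    by (rule Tr_wdT_eq_0[OF assms(3) assms(2) that])
  show "(\<Sum>p\<in>box. V p ^ 6) = 0"
    using Tr_wdT_even[OF assms(1), of "\<lambda>_. 1" 6] t[of 2 6] t[of 4 6] p by (simp add: even_below Tr_wdT_0)
  show "Tr (wdT A (\<lambda>_. 1) V 8 2) = 0"
    using Tr_wdT_even[OF assms(1), of "\<lambda>_. 1" 8] t[of 0 8] t[of 4 8] t[of 6 8] p by (simp add: even_below)
qed

text \<open>Two hops cannot wind around a period 3, so they return only by cancelling.\<close>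

lemma dl_sh_sh:
  assumes "p \<in> box" "l < d" "q l = 3" "j < d" "q j = 3" "s \<in> {1, -1}" "t \<in> {1, -1}"
  shows "dl p (sh l s (sh j t p)) = (if l = j \<and> s = - t then 1 else 0)"
proof (cases "l = j \<and> s = - t")
  case True
  then show ?thesis using assms(1) by (simp add: dl_def box_def)
next
  case False
  have "red p l = p l" using assms(1) by (simp add: box_def)
  then have pl: "p l mod 3 = p l" using assms(2,3) by (simp add: red_def)
  have "red (sh l s (sh j t p)) \<noteq> p"
  proof
    assume "red (sh l s (sh j t p)) = p"
    then have "red (sh l s (sh j t p)) l = p l" by simp
    then have "(sh l s (sh j t p) l) mod 3 = p l" using assms(2,3) by (simp add: red_def)
    then have "(sh l s (sh j t p) l) mod 3 = p l mod 3" using pl by simp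
    then have "3 dvd (sh l s (sh j t p) l - p l)" unfolding mod_eq_dvd_iff .
    moreover have "sh l s (sh j t p) l - p l = (if l = j then s + t else s)" by (simp add: sh_def)
    ultimately have "3 dvd (if l = j then s + t else s)" by (simp only:)
    then show False using False assms(6,7) by (auto split: if_splits)
  qed
  then show ?thesis using False by (simp add: dl_def)
qed

text \<open>The words with six factors that hop once to a neighbour and back, for values
  \<open>x\<close> at the start and \<open>y\<close> at the neighbour: \<open>y ^ b\<close> is taken
  up between the hops, and the coefficient \<open>7 - b\<close> counts the ways to place the
  remaining factors before and after. It is the complete homogeneous polynomial of degree 6 in
  \<open>x\<close>, \<open>x\<close>, \<open>y\<close>.\<close>

definition hom6 :: "complex \<Rightarrow> complex \<Rightarrow> complex" where
  "hom6 x y = 7 * x ^ 6 + 6 * x ^ 5 * y + 5 * x ^ 4 * y ^ 2 + 4 * x ^ 3 * y ^ 3 + 3 * x ^ 2 * y ^ 4 + 2 * x * y ^ 5 + y ^ 6"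

lemma wdT_8_2:
  assumes p: "p \<in> box" and A: "finite A" "\<And>l. l \<in> A \<Longrightarrow> l < d \<and> q l = 3"
  shows "wdT A (\<lambda>_. 1) V 8 2 (dl p) p = (\<Sum>j\<in>A. hom6 (V p) (V (sh j 1 p)) + hom6 (V p) (V (sh j (-1) p)))"
proof -
  have hop: "hopT A (\<lambda>_. 1) (\<lambda>_. 0) (\<lambda>m. f m * dl p m) (sh j t p) = f p" if "j \<in> A" "t \<in> {1, -1}" for f j t
  proof -
    have "hopT A (\<lambda>_. 1) (\<lambda>_. 0) (\<lambda>m. f m * dl p m) (sh j t p)
      = (\<Sum>l\<in>A. if l = j then f p else 0)"
      unfolding hopT_def mult_zero_left add_0_right
    proof (rule sum.cong[OF refl])
      fix l assume l: "l \<in> A"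
      then show "1 * (f (sh l 1 (sh j t p)) * dl p (sh l 1 (sh j t p)))
        + inverse 1 * (f (sh l (-1) (sh j t p)) * dl p (sh l (-1) (sh j t p))) = (if l = j then f p else 0)"
        using dl_sh_sh[OF p, of l j 1 t] dl_sh_sh[OF p, of l j "-1" t] A(2)[of l] A(2)[of j] that
        by (cases "l = j") auto
    qed
    then show ?thesis using that A by simp
  qed
  have w0: "wdT A (\<lambda>_. 1) V k 0 (dl p) = (\<lambda>m. V m ^ k * dl p m)" for k by (intro ext wdT_0)
  define S where "S k j t = (\<Sum>b<k. V (sh j t p) ^ b * V p ^ (k - Suc b))" for k j t
  have w1: "wdT A (\<lambda>_. 1) V k (Suc 0) (dl p) (sh j t p) = S k j t" if "j \<in> A" "t \<in> {1, -1}" for k j t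
    using hop[OF that] unfolding wdT_Suc w0 S_def by simp
  have h: "hopT A (\<lambda>_. 1) (\<lambda>_. 0) (wdT A (\<lambda>_. 1) V k (Suc 0) (dl p)) p = (\<Sum>j\<in>A. S k j 1 + S k j (-1))" for k
    using w1 by (simp add: hopT_def)
  have "wdT A (\<lambda>_. 1) V 8 2 (dl p) p = (\<Sum>a<8. V p ^ a * (\<Sum>j\<in>A. S (8 - Suc a) j 1 + S (8 - Suc a) j (-1)))"
    unfolding numeral_2_eq_2 wdT_Suc[of A "\<lambda>_. 1" V 8 "Suc 0" "dl p" p] h ..
  also have "\<dots> = (\<Sum>a<8. \<Sum>j\<in>A. V p ^ a * S (8 - Suc a) j 1 + V p ^ a * S (8 - Suc a) j (-1))"
    by (simp only: sum_distrib_left distrib_left)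
  also have "\<dots> = (\<Sum>j\<in>A. \<Sum>a<8. V p ^ a * S (8 - Suc a) j 1 + V p ^ a * S (8 - Suc a) j (-1))"
    by (rule sum.swap)
  also have "\<dots> = (\<Sum>j\<in>A. (\<Sum>a<8. V p ^ a * S (8 - Suc a) j 1) + (\<Sum>a<8. V p ^ a * S (8 - Suc a) j (-1)))"
    by (simp only: sum.distrib)
  finally have eq: "wdT A (\<lambda>_. 1) V 8 2 (dl p) p = \<dots>" .
  have "(\<Sum>a<8. V p ^ a * S (8 - Suc a) j t) = hom6 (V p) (V (sh j t p))" for j t
    unfolding hom6_def S_def by (simp add: numeral_eq_Suc algebra_simps)
  then show ?thesis unfolding eq by simp
qed

text \<open>Up to sign \<open>s\<close> and \<open>r\<close> are the second and third elementary
  symmetric functions of three numbers with sum 0. The hypotheses become two independent linear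
  relations between \<open>s ^ 3\<close> and \<open>r ^ 2\<close>, and \<open>a\<close> is a root of
  \<open>X ^ 3 - s * X + r\<close>.\<close>

lemma sym6_eq_0:
  fixes a b c :: complex
  assumes c: "a + b + c = 0" and 1: "a ^ 6 + b ^ 6 + c ^ 6 = 0"
    and 2: "hom6 a b + hom6 a c + (hom6 b c + hom6 b a) + (hom6 c a + hom6 c b) = 0"
  shows "a = 0"
proof -
  define s where "s = a ^ 2 + a * b + b ^ 2"
  define r where "r = a * b * (a + b)"
  have c': "c = - a - b" using c by (metis add_diff_cancel_left' diff_0 add.commute diff_conv_add_uminus minus_add_distrib)
  have "a ^ 6 + b ^ 6 + c ^ 6 = 2 * s ^ 3 + 3 * r ^ 2"
    unfolding c' s_def r_def by (simp add: numeral_eq_Suc algebra_simps)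
  moreover have "hom6 a b + hom6 a c + (hom6 b c + hom6 b a) + (hom6 c a + hom6 c b) = 24 * (r ^ 2 + s ^ 3)"
    unfolding c' s_def r_def hom6_def by (simp add: numeral_eq_Suc algebra_simps)
  ultimately have "2 * s ^ 3 + 3 * r ^ 2 = 0" "24 * (r ^ 2 + s ^ 3) = 0" using 1 2 by (simp_all only:)
  then have "2 * s ^ 3 + 3 * r ^ 2 = 0" "r ^ 2 + s ^ 3 = 0" by (metis mult_eq_0_iff zero_neq_numeral)+
  moreover have "s ^ 3 = 3 * (r ^ 2 + s ^ 3) - (2 * s ^ 3 + 3 * r ^ 2)" by (simp add: algebra_simps)
  ultimately have "s ^ 3 = 0" "r ^ 2 = 0" by simp_all
  then have "r = 0" "s = 0" by simp_all
  moreover have "a ^ 3 = a * s - r" unfolding s_def r_def by (simp add: power2_eq_square power3_eq_cube algebra_simps)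
  ultimately show ?thesis by simp
qed

end

text \<open>For \<open>k \<ge> 1\<close> the complete homogeneous polynomial of degree
  \<open>k - 1\<close> in \<open>t\<close> and \<open>s\<close>; likewise \<open>walk_sum3\<close>
  is the one of degree \<open>k - 2\<close> in three arguments for \<open>k \<ge> 2\<close>. They
  arise when stretches of hops act by scalars that change at each factor of the potential.\<close>

fun walk_sum2 :: "complex \<Rightarrow> complex \<Rightarrow> nat \<Rightarrow> complex" where
  "walk_sum2 t s 0 = 0"
| "walk_sum2 t s (Suc k) = t * walk_sum2 t s k + s ^ k"

fun walk_sum3 :: "complex \<Rightarrow> complex \<Rightarrow> complex \<Rightarrow> nat \<Rightarrow> complex" where
  "walk_sum3 r t s 0 = 0"
| "walk_sum3 r t s (Suc k) = r * walk_sum3 r t s k + walk_sum2 t s k"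

section \<open>Eigenfunctions of the shifts\<close>

lemma cube_roots_of_unity:
  obtains x y :: complex where "x + y = - 1" "x * y = 1" "x ^ 2 = y" "y ^ 2 = x" "x \<noteq> 1" "y \<noteq> 1" "x \<noteq> y"
proof -
  define x where "x = Complex (- 1 / 2) (sqrt 3 / 2)"
  define y where "y = Complex (- 1 / 2) (- sqrt 3 / 2)"
  have *: "x + y = - 1" "x * y = 1" "x ^ 2 = y" "y ^ 2 = x" "x \<noteq> 1" "y \<noteq> 1" "x \<noteq> y"
    by (simp_all add: x_def y_def complex_eq_iff power2_eq_square)
  show thesis by (rule that[OF *])
qed

context torus
begin

text \<open>For period 3 and \<open>z ^ 3 = 1\<close> this is the projection to the eigenvalue
  \<open>z\<close> of the shift in direction \<open>i\<close>; \<open>z ^ 2\<close> stands for the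
  inverse of \<open>z\<close>.\<close>

definition pr :: "nat \<Rightarrow> complex \<Rightarrow> ((nat \<Rightarrow> int) \<Rightarrow> complex) \<Rightarrow> (nat \<Rightarrow> int) \<Rightarrow> complex" where
  "pr i z V n = (V n + z ^ 2 * V (sh i 1 n) + z * V (sh i 2 n)) / 3"

lemma sh_3:
  assumes "i < d" "q i = 3" "per V"
  shows "V (sh i 3 n) = V n" "V (sh i 4 n) = V (sh i 1 n)" "V (sh i (-1) n) = V (sh i 2 n)"
  using sh_period[OF assms(1,3), of 0 n] sh_period[OF assms(1,3), of 1 n] sh_period[OF assms(1,3), of "-1" n]
  by (simp_all add: assms(2))

lemma pr_eig:
  assumes "i < d" "q i = 3" "per V" "z ^ 3 = 1"
  shows "pr i z V (sh i 1 n) = z * pr i z V n"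
proof -
  have "z * pr i z V n = (z * V n + z ^ 3 * V (sh i 1 n) + z ^ 2 * V (sh i 2 n)) / 3"
    by (simp add: pr_def power2_eq_square power3_eq_cube algebra_simps)
  then show ?thesis using sh_3[OF assms(1-3), of n] by (simp add: pr_def assms(4))
qed

lemma pr_shift:
  assumes "\<And>n. V (sh k 1 n) = c * V n" "k \<noteq> i"
  shows "pr i z V (sh k 1 n) = c * pr i z V n"
proof -
  have "V (sh i s (sh k 1 n)) = c * V (sh i s n)" for s n
    unfolding sh_commute[of i s k] by (rule assms(1))
  then show ?thesis by (simp add: pr_def assms(1) algebra_simps)
qed

lemma per_pr: "per V \<Longrightarrow> per (pr i z V)"
  using per_sh[of V i] by (simp add: per_def pr_def)

lemma pr_zero_sum:
  assumes "\<And>n. V n + V (sh j 1 n) + V (sh j 2 n) = 0" "j \<noteq> i"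
  shows "pr i z V n + pr i z V (sh j 1 n) + pr i z V (sh j 2 n) = 0"
proof -
  have "pr i z V n + pr i z V (sh j 1 n) + pr i z V (sh j 2 n)
    = ((V n + V (sh j 1 n) + V (sh j 2 n))
      + z ^ 2 * (V (sh i 1 n) + V (sh j 1 (sh i 1 n)) + V (sh j 2 (sh i 1 n)))
      + z * (V (sh i 2 n) + V (sh j 1 (sh i 2 n)) + V (sh j 2 (sh i 2 n)))) / 3"
    by (simp add: pr_def sh_commute[of i _ j] algebra_simps add_divide_distrib)
  then show ?thesis by (simp only: assms(1)) simp
qed

lemma pr_sum:
  assumes "x + y = - 1" "x ^ 2 = y" "y ^ 2 = x"
  shows "V n = pr i 1 V n + pr i x V n + pr i y V n"
proof -
  have y: "y = - 1 - x" using assms(1) by (simp add: eq_diff_eq add.commute)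
  have "pr i 1 V n + pr i x V n + pr i y V n
    = ((3 * V n) + (1 + y + x) * V (sh i 1 n) + (1 + x + y) * V (sh i 2 n)) / 3"
    unfolding pr_def assms(2,3) by (simp add: algebra_simps add_divide_distrib)
  then show ?thesis by (simp add: y)
qed

lemma pr_zero_avg:
  assumes "x + y = - 1" "x ^ 2 = y" "y ^ 2 = x" "\<And>n. V n + V (sh i 1 n) + V (sh i 2 n) = 0"
  shows "V n = pr i x V n + pr i y V n"
  using pr_sum[OF assms(1-3), of V n i] assms(4)[of n] by (simp add: pr_def)

definition eigen :: "((nat \<Rightarrow> int) \<Rightarrow> complex) \<Rightarrow> bool" where
  "eigen f \<longleftrightarrow> per f \<and> (\<forall>k<d. \<exists>c. c \<noteq> 0 \<and> (\<forall>n. f (sh k 1 n) = c * f n))"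

text \<open>The eigenvalues are nonzero, so the set of zeros is invariant under all shifts: it is
  empty or everything.\<close>

lemma eigen_zero:
  assumes "eigen f" "f m = 0"
  shows "f n = 0"
proof -
  have "(f n = 0) = (f m = 0)"
  proof (rule shift_invariant_const[of "\<lambda>n. f n = 0"])
    fix j n assume "j < d"
    then obtain c where "c \<noteq> 0" "\<And>n. f (sh j 1 n) = c * f n" using assms(1) by (auto simp: eigen_def)
    then show "(f (sh j 1 n) = 0) = (f n = 0)" by simp
  qed (use assms(1) in \<open>simp add: eigen_def per_def\<close>)
  then show ?thesis using assms(2) by simp
qed

lemma per_mult: "per f \<Longrightarrow> per g \<Longrightarrow> per (\<lambda>n. f n * g n)"
  by (simp add: per_def)

text \<open>With inverse eigenvalues in every direction the product is constant, hence 0 because its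
  sum is; and a joint eigenfunction with one zero vanishes identically.\<close>

lemma eigen_product_zero:
  assumes f: "eigen f" and g: "eigen g" and sum: "(\<Sum>p\<in>box. f p * g p) = 0"
    and opp: "\<And>k. k < d \<Longrightarrow> \<exists>b c. b * c = 1 \<and> (\<forall>n. f (sh k 1 n) = b * f n) \<and> (\<forall>n. g (sh k 1 n) = c * g n)"
  shows "(\<forall>n. f n = 0) \<or> (\<forall>n. g n = 0)"
proof -
  have inv: "f (sh k 1 n) * g (sh k 1 n) = f n * g n" if k: "k < d" for k n
  proof -
    obtain b c where bc: "b * c = 1" "\<And>n. f (sh k 1 n) = b * f n" "\<And>n. g (sh k 1 n) = c * g n"
      using opp[OF k] by blast
    have "f (sh k 1 n) * g (sh k 1 n) = (b * c) * (f n * g n)" by (simp add: bc(2,3))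
    then show ?thesis by (simp add: bc(1))
  qed
  have "f n * g n = 0" for n
    by (rule const_sum_0[of "\<lambda>n. f n * g n", OF inv per_mult sum]) (use f g in \<open>auto simp: eigen_def\<close>)
  then show ?thesis using eigen_zero[OF f] eigen_zero[OF g] by (metis mult_eq_0_iff)
qed

text \<open>Describes the directions already settled: those that were averaged leave
  \<open>V\<close> invariant, and a period 2 with vanishing average makes \<open>V\<close>
  alternate.\<close>

definition signs :: "nat set \<Rightarrow> ((nat \<Rightarrow> int) \<Rightarrow> complex) \<Rightarrow> bool" where
  "signs A V \<longleftrightarrow> (\<forall>k<d. k \<notin> A \<longrightarrow> (\<exists>c. c ^ 2 = 1 \<and> (\<forall>n. V (sh k 1 n) = c * V n)))"

lemma iso_0_zero:
  assumes "iso {} V" "per V" "signs {} V"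
  shows "V n = 0"
proof -
  have "V n * V n = 0"
  proof (rule const_sum_0[of "\<lambda>n. V n * V n", OF _ per_mult[OF assms(2,2)] iso_sum_sq[OF assms(1)]])
    fix j n assume "j < d"
    then obtain c where c: "c ^ 2 = 1" "\<And>n. V (sh j 1 n) = c * V n" using assms(3) by (auto simp: signs_def)
    have "V (sh j 1 n) * V (sh j 1 n) = c ^ 2 * (V n * V n)" by (simp add: c(2) power2_eq_square)
    then show "V (sh j 1 n) * V (sh j 1 n) = V n * V n" by (simp add: c(1))
  qed
  then show ?thesis by simp
qed

lemma pow6: "(c :: complex) ^ 2 = 1 \<or> c ^ 3 = 1 \<Longrightarrow> c ^ 6 = 1"
proof -
  have "c ^ 6 = (c ^ 2) ^ 3" "c ^ 6 = (c ^ 3) ^ 2" by (simp_all flip: power_mult)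
  then show "c ^ 2 = 1 \<or> c ^ 3 = 1 \<Longrightarrow> c ^ 6 = 1" by (metis power_one)
qed

text \<open>The two eigenfunctions \<open>f\<close> and \<open>g\<close> have inverse eigenvalues
  along \<open>i\<close> and equal signs elsewhere, so the sum of squares of \<open>V\<close>
  reduces to twice their pairing. Hence one of them vanishes, \<open>V\<close> is a joint
  eigenfunction, and its sixth power is constant with sum 0.\<close>

lemma iso_1_zero:
  assumes i: "i < d" "q i = 3" and V: "iso {i} V" "per V" "signs {i} V"
    and avg: "\<And>n. V n + V (sh i 1 n) + V (sh i 2 n) = 0"
  shows "V n = 0"
proof -
  obtain x y :: complex where xy: "x + y = - 1" "x * y = 1" "x ^ 2 = y" "y ^ 2 = x" "x \<noteq> 1" "y \<noteq> 1"
    by (metis cube_roots_of_unity)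
  have c3: "x ^ 3 = 1" "y ^ 3 = 1"
    using xy by (simp_all add: power3_eq_cube power2_eq_square mult.assoc) (simp_all add: mult.commute)
  define f where "f = pr i x V"
  define g where "g = pr i y V"
  have fe: "f (sh i 1 n) = x * f n" and ge: "g (sh i 1 n) = y * g n" for n
    using pr_eig[OF i V(2) c3(1)] pr_eig[OF i V(2) c3(2)] by (simp_all add: f_def g_def)
  have pf: "per f" and pg: "per g" using per_pr[OF V(2)] by (simp_all add: f_def g_def)
  have Vfg: "V n = f n + g n" for n unfolding f_def g_def by (rule pr_zero_avg[OF xy(1,3,4) avg])
  have sg: "\<exists>c. c ^ 2 = 1 \<and> (\<forall>n. f (sh k 1 n) = c * f n) \<and> (\<forall>n. g (sh k 1 n) = c * g n)
      \<and> (\<forall>n. V (sh k 1 n) = c * V n)" if k: "k < d" "k \<noteq> i" for k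
  proof -
    obtain c where c: "c ^ 2 = 1" "\<And>n. V (sh k 1 n) = c * V n" using k V(3) by (auto simp: signs_def)
    then show ?thesis using pr_shift[of V k c i, OF c(2) k(2)] by (auto simp: f_def g_def)
  qed
  have xy0: "x \<noteq> 0" "y \<noteq> 0" using xy(2) by auto
  have ef: "eigen f" "eigen g"
  proof -
    have "\<exists>c. c \<noteq> 0 \<and> (\<forall>n. f (sh k 1 n) = c * f n)" "\<exists>c. c \<noteq> 0 \<and> (\<forall>n. g (sh k 1 n) = c * g n)" if "k < d" for k
      using sg[OF that] fe ge xy0 by (metis power2_eq_square zero_neq_one mult_zero_left)+
    then show "eigen f" "eigen g" using pf pg by (auto simp: eigen_def)
  qed
  have "(\<Sum>p\<in>box. f p * f p) = 0"
    by (rule eig_sum_0[of "\<lambda>n. f n * f n" i y, OF _ xy(6) per_mult[OF pf pf]])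
      (simp add: fe flip: xy(3) power2_eq_square, simp add: power2_eq_square)
  moreover have "(\<Sum>p\<in>box. g p * g p) = 0"
    by (rule eig_sum_0[of "\<lambda>n. g n * g n" i x, OF _ xy(5) per_mult[OF pg pg]])
      (simp add: ge flip: xy(4) power2_eq_square, simp add: power2_eq_square)
  moreover have "(\<Sum>p\<in>box. V p * V p) = (\<Sum>p\<in>box. f p * f p) + 2 * (\<Sum>p\<in>box. f p * g p) + (\<Sum>p\<in>box. g p * g p)"
    unfolding Vfg sum_distrib_left sum.distrib[symmetric] by (intro sum.cong refl) (simp add: algebra_simps)
  ultimately have "(\<Sum>p\<in>box. f p * g p) = 0" using iso_sum_sq[OF V(1)] by simp
  moreover have "\<exists>b c. b * c = 1 \<and> (\<forall>n. f (sh k 1 n) = b * f n) \<and> (\<forall>n. g (sh k 1 n) = c * g n)" if "k < d" for k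
    using sg[OF that] fe ge xy(2) by (metis power2_eq_square)
  ultimately have "(\<forall>n. f n = 0) \<or> (\<forall>n. g n = 0)" by (rule eigen_product_zero[OF ef])
  then obtain z where z: "z ^ 3 = 1" "z \<noteq> 1" "\<And>n. V (sh i 1 n) = z * V n"
    using Vfg fe ge c3 xy(5,6) by (metis add_0 add_0_right)
  have "V n ^ 6 = 0"
  proof (rule const_sum_0[of "\<lambda>n. V n ^ 6", OF _ _ iso_eig(1)[OF V(1,2) z(3,1,2)]])
    fix k n assume "k < d"
    then obtain c where "c ^ 6 = 1" "\<And>n. V (sh k 1 n) = c * V n" using sg[of k] z pow6 by metis
    then show "V (sh k 1 n) ^ 6 = V n ^ 6" by (simp add: power_mult_distrib)
  qed (use V(2) in \<open>simp add: per_def\<close>)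
  then show ?thesis by simp
qed

text \<open>Summing over the orbit along \<open>j\<close> gives a function invariant in every
  direction, hence constant, whose total is three times that of \<open>f\<close>.\<close>

lemma orbit_sum_0:
  fixes f :: "(nat \<Rightarrow> int) \<Rightarrow> complex"
  assumes j: "j < d" "q j = 3" and f: "per f" "(\<Sum>p\<in>box. f p) = 0"
    and inv: "\<And>k n. k < d \<Longrightarrow> k \<noteq> j \<Longrightarrow> f (sh k 1 n) = f n"
  shows "f n + f (sh j 1 n) + f (sh j 2 n) = 0"
proof (rule const_sum_0[of "\<lambda>n. f n + f (sh j 1 n) + f (sh j 2 n)"])
  fix k n assume k: "k < d"
  show "f (sh k 1 n) + f (sh j 1 (sh k 1 n)) + f (sh j 2 (sh k 1 n)) = f n + f (sh j 1 n) + f (sh j 2 n)"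
  proof (cases "k = j")
    case True
    then show ?thesis using sh_3(1)[OF j f(1), of n] by simp
  next
    case False
    then show ?thesis using inv[OF k] by (simp add: sh_commute[of j _ k])
  qed
next
  show "per (\<lambda>n. f n + f (sh j 1 n) + f (sh j 2 n))"
    using f(1) per_sh[OF f(1), of j] by (simp add: per_def)
  show "(\<Sum>p\<in>box. f p + f (sh j 1 p) + f (sh j 2 p)) = 0"
    using sum_box_sh[OF f(1), of j] f(2) by (simp add: sum.distrib)
qed

lemma hom6_scale: "hom6 (c * x) (c * y) = c ^ 6 * hom6 x y"
  unfolding hom6_def by (simp add: numeral_eq_Suc algebra_simps)

text \<open>Along \<open>i\<close> the neighbours of \<open>V\<close> are \<open>z\<close> and
  \<open>z ^ 2\<close> times \<open>V\<close>, so the hops in that direction contribute only a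
  multiple of the vanishing sum of \<open>V ^ 6\<close>. What remains is a condition along
  \<open>j\<close>, and the three values of \<open>V\<close> on an orbit satisfy the hypotheses of
  \<open>sym6_eq_0\<close>.\<close>

lemma iso_2_eig_zero:
  assumes ij: "i \<noteq> j" "i < d" "q i = 3" "j < d" "q j = 3" and V: "iso {i, j} V" "per V" "signs {i, j} V"
    and z: "z ^ 3 = 1" "z \<noteq> 1" "\<And>n. V (sh i 1 n) = z * V n"
    and avg: "\<And>n. V n + V (sh j 1 n) + V (sh j 2 n) = 0"
  shows "V n = 0"
proof -
  define F where "F n = V n ^ 6" for n
  define G where "G n = hom6 (V n) (V (sh j 1 n)) + hom6 (V n) (V (sh j 2 n))" for n
  note per_shj = per_sh[OF V(2), of j]
  have pF: "per F" using V(2) by (simp add: per_def F_def)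
  have pG: "per G" using V(2) per_shj[of 1] per_shj[of 2] unfolding per_def G_def by simp
  have sF: "(\<Sum>p\<in>box. F p) = 0" unfolding F_def by (rule iso_eig(1)[OF V(1,2) z(3,1,2)])
  have "Tr (wdT {i, j} (\<lambda>_. 1) V 8 2) = (\<Sum>p\<in>box. (hom6 1 z + hom6 1 (z ^ 2)) * F p + G p)"
    unfolding Tr_def
  proof (rule sum.cong[OF refl])
    fix p assume p: "p \<in> box"
    have "V (sh i 2 p) = V (sh i 1 (sh i 1 p))" by simp
    also have "\<dots> = z ^ 2 * V p" by (simp only: z(3) power2_eq_square mult.assoc)
    finally have "V (sh i 2 p) = z ^ 2 * V p" .
    then have h: "hom6 (V p) (V (sh i 2 p)) = V p ^ 6 * hom6 1 (z ^ 2)" "hom6 (V p) (V (sh i 1 p)) = V p ^ 6 * hom6 1 z"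
      using hom6_scale[of "V p" 1 "z ^ 2"] hom6_scale[of "V p" 1 z] by (simp_all add: z(3) mult.commute)
    have "wdT {i, j} (\<lambda>_. 1) V 8 2 (dl p) p
      = (\<Sum>l\<in>{i, j}. hom6 (V p) (V (sh l 1 p)) + hom6 (V p) (V (sh l (-1) p)))"
      by (rule wdT_8_2[OF p]) (use ij in auto)
    also have "\<dots> = (hom6 (V p) (V (sh i 1 p)) + hom6 (V p) (V (sh i 2 p)))
      + (hom6 (V p) (V (sh j 1 p)) + hom6 (V p) (V (sh j 2 p)))"
      using ij(1) sh_3(3)[OF ij(2,3) V(2), of p] sh_3(3)[OF ij(4,5) V(2), of p] by simp
    finally show "wdT {i, j} (\<lambda>_. 1) V 8 2 (dl p) p = (hom6 1 z + hom6 1 (z ^ 2)) * F p + G p"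
      unfolding h F_def G_def by (simp add: algebra_simps)
  qed
  then have "(\<Sum>p\<in>box. (hom6 1 z + hom6 1 (z ^ 2)) * F p + G p) = 0"
    using iso_eig(2)[OF V(1,2) z(3,1,2)] by simp
  then have sG: "(\<Sum>p\<in>box. G p) = 0" using sF by (simp add: sum.distrib flip: sum_distrib_left)
  have c: "\<exists>c. c ^ 6 = 1 \<and> (\<forall>n. V (sh k 1 n) = c * V n)" if "k < d" "k \<noteq> j" for k
    using V(3) z(1,3) that pow6 unfolding signs_def by (metis insertE singletonD)
  have invF: "F (sh k 1 n) = F n" and invG: "G (sh k 1 n) = G n" if k: "k < d" "k \<noteq> j" for k n
  proof -
    obtain c where c: "c ^ 6 = 1" "\<And>n. V (sh k 1 n) = c * V n" using c[OF k] by blast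
    show "F (sh k 1 n) = F n" by (simp add: F_def c power_mult_distrib)
    have "V (sh j s (sh k 1 n)) = c * V (sh j s n)" for s unfolding sh_commute[of j s k] by (rule c)
    then show "G (sh k 1 n) = G n" by (simp add: G_def c hom6_scale)
  qed
  show ?thesis
  proof (rule sym6_eq_0[OF avg])
    show "V n ^ 6 + V (sh j 1 n) ^ 6 + V (sh j 2 n) ^ 6 = 0"
      using orbit_sum_0[OF ij(4,5) pF sF invF] by (simp add: F_def)
    show "hom6 (V n) (V (sh j 1 n)) + hom6 (V n) (V (sh j 2 n))
      + (hom6 (V (sh j 1 n)) (V (sh j 2 n)) + hom6 (V (sh j 1 n)) (V n))
      + (hom6 (V (sh j 2 n)) (V n) + hom6 (V (sh j 2 n)) (V (sh j 1 n))) = 0"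
      using orbit_sum_0[OF ij(4,5) pG sG invG, of n] sh_3(1,2)[OF ij(4,5) V(2), of n] by (simp add: G_def)
  qed
qed

end

text \<open>With all weights equal to \<open>1 / \<epsilon>\<close>, the powers of \<open>\<epsilon> T\<close> are polynomials in \<open>\<epsilon>\<close>; \<open>ins1\<close> and \<open>ins2\<close> are the
  contributions to the coefficients of \<open>\<epsilon>\<close> and \<open>\<epsilon>^2\<close> of the walks with forward steps only.\<close>

fun fwd :: "nat \<Rightarrow> nat \<Rightarrow> nat \<Rightarrow> ((nat \<Rightarrow> int) \<Rightarrow> complex) \<Rightarrow> (nat \<Rightarrow> int) \<Rightarrow> complex" where
  "fwd i j 0 u n = u n"
| "fwd i j (Suc k) u n = fwd i j k u (sh i 1 n) + fwd i j k u (sh j 1 n)"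

fun ins1 :: "nat \<Rightarrow> nat \<Rightarrow> ((nat \<Rightarrow> int) \<Rightarrow> complex) \<Rightarrow> nat \<Rightarrow> ((nat \<Rightarrow> int) \<Rightarrow> complex) \<Rightarrow> (nat \<Rightarrow> int) \<Rightarrow> complex" where
  "ins1 i j g 0 u n = 0"
| "ins1 i j g (Suc k) u n = ins1 i j g k u (sh i 1 n) + ins1 i j g k u (sh j 1 n) + g n * fwd i j k u n"

fun ins2 :: "nat \<Rightarrow> nat \<Rightarrow> ((nat \<Rightarrow> int) \<Rightarrow> complex) \<Rightarrow> ((nat \<Rightarrow> int) \<Rightarrow> complex) \<Rightarrow> nat \<Rightarrow>
    ((nat \<Rightarrow> int) \<Rightarrow> complex) \<Rightarrow> (nat \<Rightarrow> int) \<Rightarrow> complex" where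
  "ins2 i j f g 0 u n = 0"
| "ins2 i j f g (Suc k) u n = ins2 i j f g k u (sh i 1 n) + ins2 i j f g k u (sh j 1 n) + f n * ins1 i j g k u n"

fun hop_poly :: "nat \<Rightarrow> nat \<Rightarrow> ((nat \<Rightarrow> int) \<Rightarrow> complex) \<Rightarrow> nat \<Rightarrow> ((nat \<Rightarrow> int) \<Rightarrow> complex) \<Rightarrow> (nat \<Rightarrow> int) \<Rightarrow> complex poly" where
  "hop_poly i j V 0 u n = [:u n:]"
| "hop_poly i j V (Suc k) u n = hop_poly i j V k u (sh i 1 n) + hop_poly i j V k u (sh j 1 n)
     + [:0, V n:] * hop_poly i j V k u n
     + [:0, 0, 1:] * (hop_poly i j V k u (sh i (-1) n) + hop_poly i j V k u (sh j (-1) n))"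

lemma poly_hop_poly:
  assumes "i \<noteq> j" "\<epsilon> \<noteq> 0"
  shows "poly (hop_poly i j V k u n) \<epsilon> = \<epsilon> ^ k * (hopT {i, j} (\<lambda>_. inverse \<epsilon>) V ^^ k) u n"
proof (induction k arbitrary: n)
  case (Suc k)
  then show ?case using assms by (simp add: hopT_def field_simps)
qed simp

text \<open>A factor of the potential costs one power of \<open>\<epsilon>\<close> and a backward
  hop two. At order two there are hence either two factors, or one backward hop and no factor; the
  latter part is the same for the zero potential.\<close>

lemma coeff_hop_poly:
  "coeff (hop_poly i j V k u n) 0 = fwd i j k u n"
  "coeff (hop_poly i j V k u n) (Suc 0) = ins1 i j V k u n"
  "coeff (hop_poly i j V k u n) (Suc (Suc 0)) = ins2 i j V V k u n + coeff (hop_poly i j (\<lambda>_. 0) k u n) (Suc (Suc 0))"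
proof -
  have 0: "coeff (hop_poly i j V k u n) 0 = fwd i j k u n" for V k n
    by (induction k arbitrary: n) simp_all
  have 1: "coeff (hop_poly i j V k u n) (Suc 0) = ins1 i j V k u n" for V k n
    by (induction k arbitrary: n) (simp_all add: 0)
  have 2: "coeff (hop_poly i j V k u n) (Suc (Suc 0))
      = ins2 i j V V k u n + coeff (hop_poly i j (\<lambda>_. 0) k u n) (Suc (Suc 0))" for k n
    by (induction k arbitrary: n) (simp_all add: 0 1 algebra_simps)
  show "coeff (hop_poly i j V k u n) 0 = fwd i j k u n"
    "coeff (hop_poly i j V k u n) (Suc 0) = ins1 i j V k u n"
    "coeff (hop_poly i j V k u n) (Suc (Suc 0)) = ins2 i j V V k u n + coeff (hop_poly i j (\<lambda>_. 0) k u n) (Suc (Suc 0))"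
    by (rule 0 1 2)+
qed

lemma ins2_sum: "ins2 i j f g k (\<lambda>n. \<Sum>s\<in>S. u s n) n = (\<Sum>s\<in>S. ins2 i j f g k (u s) n)"
proof -
  have 0: "fwd i j k (\<lambda>n. \<Sum>s\<in>S. u s n) n = (\<Sum>s\<in>S. fwd i j k (u s) n)" for k n
    by (induction k arbitrary: n) (simp_all add: sum.distrib)
  have 1: "ins1 i j g k (\<lambda>n. \<Sum>s\<in>S. u s n) n = (\<Sum>s\<in>S. ins1 i j g k (u s) n)" for k n
    by (induction k arbitrary: n) (simp_all add: 0 sum.distrib sum_distrib_left)
  show ?thesis by (induction k arbitrary: n) (simp_all add: 1 sum.distrib sum_distrib_left)
qed

lemma ins2_add:
  "ins2 i j (\<lambda>n. f n + f' n) g k u n = ins2 i j f g k u n + ins2 i j f' g k u n"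
  "ins2 i j f (\<lambda>n. g n + g' n) k u n = ins2 i j f g k u n + ins2 i j f g' k u n"
proof -
  show "ins2 i j (\<lambda>n. f n + f' n) g k u n = ins2 i j f g k u n + ins2 i j f' g k u n"
    by (induction k arbitrary: n) (simp_all add: algebra_simps)
  have "ins1 i j (\<lambda>n. g n + g' n) k u n = ins1 i j g k u n + ins1 i j g' k u n" for k n
    by (induction k arbitrary: n) (simp_all add: algebra_simps)
  then show "ins2 i j f (\<lambda>n. g n + g' n) k u n = ins2 i j f g k u n + ins2 i j f g' k u n"
    by (induction k arbitrary: n) (simp_all add: algebra_simps)
qed

text \<open>Each stretch of forward hops acts by a scalar: \<open>s1 + s2\<close> on
  \<open>u\<close>, \<open>b1 * s1 + b2 * s2\<close> on \<open>g * u\<close>, and the analogous sum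
  on \<open>f * g * u\<close>.\<close>

lemma ins2_eig:
  assumes u: "\<And>n. u (sh i 1 n) = s1 * u n" "\<And>n. u (sh j 1 n) = s2 * u n"
    and f: "\<And>n. f (sh i 1 n) = a1 * f n" "\<And>n. f (sh j 1 n) = a2 * f n"
    and g: "\<And>n. g (sh i 1 n) = b1 * g n" "\<And>n. g (sh j 1 n) = b2 * g n"
  shows "ins2 i j f g k u n
    = walk_sum3 (a1 * b1 * s1 + a2 * b2 * s2) (b1 * s1 + b2 * s2) (s1 + s2) k * (f n * g n * u n)"
proof -
  have 0: "fwd i j k u n = (s1 + s2) ^ k * u n" for k n
    by (induction k arbitrary: n) (simp_all add: u algebra_simps)
  have 1: "ins1 i j g k u n = walk_sum2 (b1 * s1 + b2 * s2) (s1 + s2) k * (g n * u n)" for k n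
    by (induction k arbitrary: n) (simp_all add: 0 u g algebra_simps)
  show ?thesis
    by (induction k arbitrary: n) (simp_all add: 1 u f g algebra_simps)
qed

context torus
begin

lemma walk_sum3_hom6: "walk_sum3 s t s 8 = hom6 s t"
  unfolding hom6_def by (simp add: numeral_eq_Suc algebra_simps)

lemma Tr_ins2_zero:
  assumes "i \<noteq> j" "iso {i, j} V"
  shows "Tr (ins2 i j V V k) = 0"
proof -
  define P where "P V = (\<Sum>p\<in>box. hop_poly i j V k (dl p) p)" for V
  have P: "poly (P V) \<epsilon> = \<epsilon> ^ k * Tr (hopT {i, j} (\<lambda>_. inverse \<epsilon>) V ^^ k)" if "\<epsilon> \<noteq> 0" for \<epsilon> V
    by (simp add: P_def poly_sum poly_hop_poly[OF assms(1) that] Tr_def sum_distrib_left)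
  have "poly (P V - P (\<lambda>_. 0)) \<epsilon> = 0" if "\<epsilon> \<noteq> 0" for \<epsilon>
    using isoD[OF assms(2), of "\<lambda>_. inverse \<epsilon>" k] that by (simp add: P)
  then have "- {0} \<subseteq> {\<epsilon>. poly (P V - P (\<lambda>_. 0)) \<epsilon> = 0}" by auto
  moreover have "infinite (- {0 :: complex})" by (simp add: infinite_UNIV_char_0 Compl_eq_Diff_UNIV)
  ultimately have "P V - P (\<lambda>_. 0) = 0" using poly_roots_finite finite_subset by blast
  then have "coeff (P V) 2 = coeff (P (\<lambda>_. 0)) 2" by simp
  then show ?thesis
    unfolding P_def coeff_sum numeral_2_eq_2 coeff_hop_poly(3)[of i j V] by (simp add: sum.distrib Tr_def)
qed

lemma dl_sh_sh_3:
  assumes p: "p \<in> box" and ij: "i \<noteq> j" "i < d" "q i = 3" "j < d" "q j = 3" and ab: "a \<in> {0, 1, 2}" "b \<in> {0, 1, 2}"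
  shows "dl p (sh j b (sh i a p)) = (if a = 0 \<and> b = 0 then 1 else 0)"
proof (cases "a = 0 \<and> b = 0")
  case True
  then show ?thesis using p by (simp add: dl_def box_def)
next
  case False
  have "red (sh j b (sh i a p)) \<noteq> p"
  proof
    assume *: "red (sh j b (sh i a p)) = p"
    have "red p = p" using p by (simp add: box_def)
    then have **: "p l mod 3 = p l" if "l < d" "q l = 3" for l using that by (metis red_def of_nat_numeral)
    have "(p i + a) mod 3 = p i mod 3" "(p j + b) mod 3 = p j mod 3"
      using fun_cong[OF *, of i] fun_cong[OF *, of j] ij **[of i] **[of j] by (simp_all add: red_def sh_def)
    then have "3 dvd a" "3 dvd b" by (simp_all add: mod_eq_dvd_iff)
    then show False using False ab by auto
  qed
  then show ?thesis using False by (simp add: dl_def)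
qed

text \<open>\<open>dl p\<close> is a sum of nine joint eigenfunctions of the shifts along
  \<open>i\<close> and \<open>j\<close>, each with the value 1/9 at \<open>p\<close>. So the trace
  is the mean of nine scalars times the pairing of \<open>f\<close> and \<open>g\<close>.\<close>

lemma Tr_ins2_eig:
  assumes ij: "i \<noteq> j" "i < d" "q i = 3" "j < d" "q j = 3"
    and xy: "x + y = - 1" "x ^ 2 = y" "y ^ 2 = x" "x ^ 3 = 1" "y ^ 3 = 1" "x \<noteq> 1" "y \<noteq> 1" "x \<noteq> y"
    and f: "\<And>n. f (sh i 1 n) = a1 * f n" "\<And>n. f (sh j 1 n) = a2 * f n"
    and g: "\<And>n. g (sh i 1 n) = b1 * g n" "\<And>n. g (sh j 1 n) = b2 * g n"
  shows "Tr (ins2 i j f g 8) = (\<Sum>s2\<in>{1, x, y}. \<Sum>s1\<in>{1, x, y}.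
    walk_sum3 (a1 * b1 * s1 + a2 * b2 * s2) (b1 * s1 + b2 * s2) (s1 + s2) 8) / 9 * (\<Sum>p\<in>box. f p * g p)"
proof -
  define S where "S = {1, x, y}"
  have S3: "s ^ 3 = 1" if "s \<in> S" for s using that xy by (auto simp: S_def)
  have sumS: "u n = (\<Sum>s\<in>S. pr l s u n)" for u l n
    using pr_sum[OF xy(1-3), of u n l] xy(6-8) by (simp add: S_def add.assoc)
  define c where "c s1 s2 = walk_sum3 (a1 * b1 * s1 + a2 * b2 * s2) (b1 * s1 + b2 * s2) (s1 + s2) 8" for s1 s2
  have "ins2 i j f g 8 (dl p) p = (\<Sum>s2\<in>S. \<Sum>s1\<in>S. c s1 s2) / 9 * (f p * g p)" if p: "p \<in> box" for p
  proof -
    define u where "u s1 s2 = pr i s1 (pr j s2 (dl p))" for s1 s2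
    have "dl p n = (\<Sum>s2\<in>S. \<Sum>s1\<in>S. u s1 s2 n)" for n
      unfolding u_def sumS[of "dl p" n j] by (intro sum.cong[OF refl] sumS)
    then have "dl p = (\<lambda>n. \<Sum>s2\<in>S. \<Sum>s1\<in>S. u s1 s2 n)" by (rule ext)
    then have "ins2 i j f g 8 (dl p) p = ins2 i j f g 8 (\<lambda>n. \<Sum>s2\<in>S. \<Sum>s1\<in>S. u s1 s2 n) p" by (rule arg_cong)
    also have "\<dots> = (\<Sum>s2\<in>S. \<Sum>s1\<in>S. ins2 i j f g 8 (u s1 s2) p)" by (simp only: ins2_sum)
    also have "\<dots> = (\<Sum>s2\<in>S. \<Sum>s1\<in>S. c s1 s2 / 9 * (f p * g p))"
    proof (intro sum.cong refl)
      fix s1 s2 assume s: "s2 \<in> S" "s1 \<in> S"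
      have "u s1 s2 (sh i 1 n) = s1 * u s1 s2 n" for n
        unfolding u_def by (rule pr_eig[OF ij(2,3) per_pr[OF per_dl] S3[OF s(2)]])
      moreover have "u s1 s2 (sh j 1 n) = s2 * u s1 s2 n" for n
        unfolding u_def by (rule pr_shift[of "pr j s2 (dl p)" j s2 i, OF pr_eig[OF ij(4,5) per_dl S3[OF s(1)]]]) (use ij in simp)
      ultimately have "ins2 i j f g 8 (u s1 s2) p = c s1 s2 * (f p * g p * u s1 s2 p)"
        unfolding c_def using f g by (rule ins2_eig)
      moreover have "u s1 s2 p = 1 / 9"
        using dl_sh_sh_3[OF p ij, of 0 0] dl_sh_sh_3[OF p ij, of 0 1] dl_sh_sh_3[OF p ij, of 0 2]
          dl_sh_sh_3[OF p ij, of 1 0] dl_sh_sh_3[OF p ij, of 1 1] dl_sh_sh_3[OF p ij, of 1 2]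
          dl_sh_sh_3[OF p ij, of 2 0] dl_sh_sh_3[OF p ij, of 2 1] dl_sh_sh_3[OF p ij, of 2 2]
        by (simp add: u_def pr_def)
      ultimately show "ins2 i j f g 8 (u s1 s2) p = c s1 s2 / 9 * (f p * g p)" by simp
    qed
    finally show ?thesis by (simp add: sum_distrib_right sum_divide_distrib)
  qed
  then show ?thesis unfolding Tr_def c_def S_def sum_distrib_left by (intro sum.cong refl)
qed

text \<open>Sums of cube roots of unity are such roots up to a factor \<open>- 1\<close> or 2, and
  scaling both arguments of \<open>hom6\<close> by a sixth root of unity changes nothing. Only the
  values 313, 31 and 28 occur in the mixed sums; 198 is the sum of the nine sixth powers of
  \<open>s1 + s2\<close>, namely 3 * 64 + 6.\<close>

lemma hom6_sums:
  assumes xy: "x + y = - 1" "x * y = 1" "x ^ 2 = y" "y ^ 2 = x" "x ^ 3 = 1" "y ^ 3 = 1" "x \<noteq> 1" "y \<noteq> 1" "x \<noteq> y"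
  shows "(\<Sum>s2\<in>{1, x, y}. \<Sum>s1\<in>{1, x, y}. hom6 (s1 + s2) (x * s1 + x * s2))
      + (\<Sum>s2\<in>{1, x, y}. \<Sum>s1\<in>{1, x, y}. hom6 (s1 + s2) (y * s1 + y * s2)) = 1584"
    "(\<Sum>s2\<in>{1, x, y}. \<Sum>s1\<in>{1, x, y}. hom6 (s1 + s2) (x * s1 + y * s2)) = 1116"
    "(\<Sum>s2\<in>{1, x, y}. \<Sum>s1\<in>{1, x, y}. hom6 (s1 + s2) (y * s1 + x * s2)) = 1116"
proof -
  have x6: "x ^ 6 = 1" "y ^ 6 = 1" using pow6 xy by simp_all
  have sums: "1 + x = - y" "x + 1 = - y" "1 + y = - x" "y + 1 = - x" "y + x = - 1" "x + x = 2 * x" "y + y = 2 * y"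
    using xy(1) by (simp_all add: eq_neg_iff_add_eq_0 add_ac)
  have prods: "x * x = y" "y * y = x" "y * x = 1" using xy by (simp_all add: power2_eq_square mult.commute)
  have h1: "hom6 2 (- 1) = 313" "hom6 (- 1) 2 = 31" "hom6 (- 1) (- 1) = 28" by (simp_all add: hom6_def)
  have h: "hom6 (2 * c) (- c) = 313" "hom6 (- c) (2 * c) = 31" "hom6 (- c) (- c) = 28" if c: "c ^ 6 = 1" for c
  proof -
    have "hom6 (2 * c) (- c) = c ^ 6 * hom6 2 (- 1)" "hom6 (- c) (2 * c) = c ^ 6 * hom6 (- 1) 2"
      "hom6 (- c) (- c) = c ^ 6 * hom6 (- 1) (- 1)"
      using hom6_scale[of c 2 "- 1"] hom6_scale[of c "- 1" 2] hom6_scale[of c "- 1" "- 1"] by (simp_all add: mult.commute)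
    then show "hom6 (2 * c) (- c) = 313" "hom6 (- c) (2 * c) = 31" "hom6 (- c) (- c) = 28" by (simp_all only: c h1 mult_1_left)
  qed
  have dist: "1 \<noteq> x" "1 \<noteq> y" using xy by auto
  note simps = sums prods xy(1,2,7-9) dist h[OF x6(1)] h[OF x6(2)] h1
  have two: "(1 :: complex) + 1 = 2" by simp
  show "(\<Sum>s2\<in>{1, x, y}. \<Sum>s1\<in>{1, x, y}. hom6 (s1 + s2) (x * s1 + y * s2)) = 1116"
    "(\<Sum>s2\<in>{1, x, y}. \<Sum>s1\<in>{1, x, y}. hom6 (s1 + s2) (y * s1 + x * s2)) = 1116"
    by (simp_all add: simps)
  have z: "(\<Sum>s2\<in>{1, x, y}. \<Sum>s1\<in>{1, x, y}. hom6 (s1 + s2) (z * s1 + z * s2)) = 198 * hom6 1 z" for z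
  proof -
    have "hom6 (s1 + s2) (z * s1 + z * s2) = (s1 + s2) ^ 6 * hom6 1 z" for s1 s2
      using hom6_scale[of "s1 + s2" 1 z] by (simp add: algebra_simps)
    then show ?thesis by (simp add: simps x6 power_mult_distrib)
  qed
  have p: "z ^ 5 = z ^ 3 * z ^ 2" "z ^ 4 = z ^ 3 * z" "z ^ 6 = z ^ 3 * z ^ 3" for z :: complex
    by (simp_all flip: power_add power_Suc2)
  have "hom6 1 x + hom6 1 y = 24 + 16 * (x + y)" unfolding hom6_def p xy(3-6) by simp
  then have "198 * (hom6 1 x + hom6 1 y) = 1584" unfolding xy(1) by simp
  then show "(\<Sum>s2\<in>{1, x, y}. \<Sum>s1\<in>{1, x, y}. hom6 (s1 + s2) (x * s1 + x * s2))
      + (\<Sum>s2\<in>{1, x, y}. \<Sum>s1\<in>{1, x, y}. hom6 (s1 + s2) (y * s1 + y * s2)) = 1584"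
    unfolding z by simp
qed

text \<open>Of the four parts \<open>e a b\<close> only those with inverse eigenvalues in both
  directions pair nontrivially, which leaves the two unknown pairings \<open>\<beta>\<close> and
  \<open>\<gamma>\<close>. Two linear relations make both 0, so each opposite pair has a vanishing
  member; the two parts left share an eigenvalue along \<open>i\<close> or along
  \<open>j\<close>.\<close>

lemma iso_2_zero:
  assumes ij: "i \<noteq> j" "i < d" "q i = 3" "j < d" "q j = 3" and V: "iso {i, j} V" "per V" "signs {i, j} V"
    and avg: "\<And>n. V n + V (sh i 1 n) + V (sh i 2 n) = 0" "\<And>n. V n + V (sh j 1 n) + V (sh j 2 n) = 0"
  shows "V n = 0"
proof -
  obtain x y :: complex where xy: "x + y = - 1" "x * y = 1" "x ^ 2 = y" "y ^ 2 = x" "x \<noteq> 1" "y \<noteq> 1" "x \<noteq> y"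
    by (rule cube_roots_of_unity)
  have c3: "x ^ 3 = 1" "y ^ 3 = 1"
    using xy by (simp_all add: power3_eq_cube power2_eq_square mult.assoc) (simp_all add: mult.commute)
  have prods: "x * x = y" "y * y = x" "y * x = 1" using xy by (simp_all add: power2_eq_square mult.commute)
  define e where "e a b = pr i a (pr j b V)" for a b
  have pe: "per (e a b)" for a b unfolding e_def by (intro per_pr V)
  have ei: "e a b (sh i 1 n) = a * e a b n" if "a ^ 3 = 1" for a b n
    unfolding e_def by (rule pr_eig[OF ij(2,3) per_pr[OF V(2)] that])
  have ej: "e a b (sh j 1 n) = b * e a b n" if "b ^ 3 = 1" for a b n
    unfolding e_def by (rule pr_shift[of "pr j b V" j b i, OF pr_eig[OF ij(4,5) V(2) that]]) (use ij in simp)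
  have ek: "\<exists>c. c ^ 2 = 1 \<and> (\<forall>a b n. e a b (sh k 1 n) = c * e a b n)" if k: "k < d" "k \<noteq> i" "k \<noteq> j" for k
  proof -
    obtain c where c: "c ^ 2 = 1" "\<And>n. V (sh k 1 n) = c * V n" using k V(3) by (auto simp: signs_def)
    have "e a b (sh k 1 n) = c * e a b n" for a b n
      unfolding e_def by (rule pr_shift[of "pr j b V" k c i, OF pr_shift[of V k c j, OF c(2) k(3)] k(2)])
    then show ?thesis using c(1) by blast
  qed
  have Vj: "V n = pr j x V n + pr j y V n" for n by (rule pr_zero_avg[OF xy(1,3,4) avg(2)])
  have Vi: "pr j b V n = e x b n + e y b n" for b n
    unfolding e_def by (rule pr_zero_avg[OF xy(1,3,4) pr_zero_sum[OF avg(1)]]) (use ij in simp)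
  have Ve: "V n = (e x x n + e y x n) + (e x y n + e y y n)" for n using Vj Vi by simp
  then have V': "V = (\<lambda>n. (e x x n + e y x n) + (e x y n + e y y n))" by blast
  define B where "B f g = (\<Sum>p\<in>box. f p * g p)" for f g :: "(nat \<Rightarrow> int) \<Rightarrow> complex"
  \<comment> \<open>Length 8 means six forward hops. With three hops the coefficients of
    \<open>\<beta>\<close> and \<open>\<gamma>\<close> coincide, which would only repeat the
    relation from the sum of squares.\<close>
  define W where "W f g = Tr (ins2 i j f g 8)" for f g
  have B_add: "B (\<lambda>n. f n + f' n) g = B f g + B f' g" "B f (\<lambda>n. g n + g' n) = B f g + B f g'" for f f' g g'
    by (simp_all add: B_def distrib_left distrib_right sum.distrib)
  have W_add: "W (\<lambda>n. f n + f' n) g = W f g + W f' g" "W f (\<lambda>n. g n + g' n) = W f g + W f g'" for f f' g g'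
    by (simp_all add: W_def Tr_def ins2_add sum.distrib)
  have B_comm: "B f g = B g f" for f g by (simp add: B_def mult.commute)
  have Bn: "B (e a1 a2) (e b1 b2) = 0"
    if "a1 ^ 3 = 1" "a2 ^ 3 = 1" "b1 ^ 3 = 1" "b2 ^ 3 = 1" "a1 * b1 \<noteq> 1 \<or> a2 * b2 \<noteq> 1" for a1 a2 b1 b2
    using that(5)
  proof
    assume *: "a1 * b1 \<noteq> 1"
    show ?thesis unfolding B_def
      by (rule eig_sum_0[of "\<lambda>n. e a1 a2 n * e b1 b2 n" i "a1 * b1", OF _ * per_mult[OF pe pe]]) (simp add: ei that)
  next
    assume *: "a2 * b2 \<noteq> 1"
    show ?thesis unfolding B_def
      by (rule eig_sum_0[of "\<lambda>n. e a1 a2 n * e b1 b2 n" j "a2 * b2", OF _ * per_mult[OF pe pe]]) (simp add: ej that)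
  qed
  have WB: "W (e a1 a2) (e b1 b2) = (\<Sum>s2\<in>{1, x, y}. \<Sum>s1\<in>{1, x, y}.
      walk_sum3 (a1 * b1 * s1 + a2 * b2 * s2) (b1 * s1 + b2 * s2) (s1 + s2) 8) / 9 * B (e a1 a2) (e b1 b2)"
    if "a1 ^ 3 = 1" "a2 ^ 3 = 1" "b1 ^ 3 = 1" "b2 ^ 3 = 1" for a1 a2 b1 b2
    unfolding W_def B_def by (rule Tr_ins2_eig[of i j x y "e a1 a2" a1 a2 "e b1 b2" b1 b2, OF ij xy(1,3,4) c3 xy(5-7) ei[OF that(1)] ej[OF that(2)] ei[OF that(3)] ej[OF that(4)]])
  have Wn: "W (e a1 a2) (e b1 b2) = 0"
    if "a1 ^ 3 = 1" "a2 ^ 3 = 1" "b1 ^ 3 = 1" "b2 ^ 3 = 1" "a1 * b1 \<noteq> 1 \<or> a2 * b2 \<noteq> 1" for a1 a2 b1 b2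
    unfolding WB[OF that(1-4)] Bn[OF that] by (rule mult_zero_right)
  define H where "H z1 z2 = (\<Sum>s2\<in>{1, x, y}. \<Sum>s1\<in>{1, x, y}. hom6 (s1 + s2) (z1 * s1 + z2 * s2))" for z1 z2
  have Wo: "W (e a1 a2) (e b1 b2) = H b1 b2 / 9 * B (e a1 a2) (e b1 b2)"
    if "a1 ^ 3 = 1" "a2 ^ 3 = 1" "b1 ^ 3 = 1" "b2 ^ 3 = 1" "a1 * b1 = 1" "a2 * b2 = 1" for a1 a2 b1 b2
    unfolding WB[OF that(1-4)] that(5,6) H_def mult_1_left walk_sum3_hom6 ..
  have H: "H x x + H y y = 1584" "H x y = 1116" "H y x = 1116"
    unfolding H_def by (rule hom6_sums[OF xy(1-4) c3 xy(5-7)])+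
  define \<beta> where "\<beta> = B (e x x) (e y y)"
  define \<gamma> where "\<gamma> = B (e x y) (e y x)"
  have "B V V = 2 * \<beta> + 2 * \<gamma>"
    unfolding V' B_add \<beta>_def \<gamma>_def
    using Bn c3 prods xy B_comm[of "e y y" "e x x"] B_comm[of "e y x" "e x y"] by simp
  moreover have "B V V = 0" unfolding B_def by (rule iso_sum_sq[OF V(1)])
  ultimately have "2 * (\<beta> + \<gamma>) = 0" by (simp only: distrib_left)
  then have 1: "\<beta> + \<gamma> = 0" by (metis mult_eq_0_iff zero_neq_numeral)
  have "W V V = (W (e x x) (e y y) + W (e y y) (e x x)) + (W (e x y) (e y x) + W (e y x) (e x y))"
    unfolding V' W_add using Wn c3 prods xy by simp
  also have "\<dots> = (H x x + H y y) / 9 * \<beta> + (H x y + H y x) / 9 * \<gamma>"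
    unfolding Wo[OF c3(1) c3(1) c3(2) c3(2) xy(2) xy(2)] Wo[OF c3(2) c3(2) c3(1) c3(1) prods(3) prods(3)]
      Wo[OF c3(1) c3(2) c3(2) c3(1) xy(2) prods(3)] Wo[OF c3(2) c3(1) c3(1) c3(2) prods(3) xy(2)]
      B_comm[of "e y y" "e x x"] B_comm[of "e y x" "e x y"] \<beta>_def \<gamma>_def
    by (simp add: algebra_simps add_divide_distrib)
  \<comment> \<open>Here 176 is 1584 / 9 and 248 is 2 * 1116 / 9.\<close>
  finally have "176 * \<beta> + 248 * \<gamma> = 0" using Tr_ins2_zero[OF ij(1) V(1), of 8] by (simp add: H W_def)
  moreover have "72 * \<gamma> = (176 * \<beta> + 248 * \<gamma>) - 176 * (\<beta> + \<gamma>)" by (simp add: algebra_simps)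
  ultimately have "\<gamma> = 0" using 1 by simp
  then have "\<beta> = 0" using 1 by simp
  have nz: "a \<noteq> 0" if "a ^ 3 = 1" for a :: complex using that by auto
  have ee: "eigen (e a b)" if ab: "a ^ 3 = 1" "b ^ 3 = 1" for a b
  proof -
    have "\<exists>c. c \<noteq> 0 \<and> (\<forall>n. e a b (sh k 1 n) = c * e a b n)" if k: "k < d" for k
    proof -
      consider "k = i" | "k = j" | "k \<noteq> i" "k \<noteq> j" by blast
      then show ?thesis
      proof cases
        case 1
        then show ?thesis using ei[OF ab(1)] nz[OF ab(1)] by blast
      next
        case 2
        then show ?thesis using ej[OF ab(2)] nz[OF ab(2)] by blast
      next
        case 3
        then obtain c where "c ^ 2 = 1" "\<And>n. e a b (sh k 1 n) = c * e a b n" using ek[OF k] by blast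
        then show ?thesis by (intro exI[of _ c]) auto
      qed
    qed
    then show ?thesis using pe by (simp add: eigen_def)
  qed
  have zero: "(\<forall>n. e a1 a2 n = 0) \<or> (\<forall>n. e b1 b2 n = 0)"
    if h: "a1 ^ 3 = 1" "a2 ^ 3 = 1" "b1 ^ 3 = 1" "b2 ^ 3 = 1" "a1 * b1 = 1" "a2 * b2 = 1" "B (e a1 a2) (e b1 b2) = 0" for a1 a2 b1 b2
  proof (rule eigen_product_zero[OF ee[OF h(1,2)] ee[OF h(3,4)] h(7)[unfolded B_def]])
    fix k assume k: "k < d"
    consider "k = i" | "k = j" | "k \<noteq> i" "k \<noteq> j" by blast
    then show "\<exists>b c. b * c = 1 \<and> (\<forall>n. e a1 a2 (sh k 1 n) = b * e a1 a2 n) \<and> (\<forall>n. e b1 b2 (sh k 1 n) = c * e b1 b2 n)"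
    proof cases
      case 1
      then show ?thesis using ei h by blast
    next
      case 2
      then show ?thesis using ej h by blast
    next
      case 3
      then show ?thesis using ek[OF k] by (metis power2_eq_square)
    qed
  qed
  have fin_i: "V n = 0" if "z ^ 3 = 1" "z \<noteq> 1" "\<And>n. V (sh i 1 n) = z * V n" for z
    by (rule iso_2_eig_zero[OF ij V that avg(2)])
  have fin_j: "V n = 0" if "z ^ 3 = 1" "z \<noteq> 1" "\<And>n. V (sh j 1 n) = z * V n" for z
    by (rule iso_2_eig_zero[OF ij(1)[symmetric] ij(4,5,2,3) _ V(2) _ that avg(1)])
      (use V in \<open>simp_all add: insert_commute\<close>)
  have "(\<forall>n. e x x n = 0) \<or> (\<forall>n. e y y n = 0)" "(\<forall>n. e x y n = 0) \<or> (\<forall>n. e y x n = 0)"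
    using zero[OF c3(1) c3(1) c3(2) c3(2) xy(2) xy(2)] zero[OF c3(1) c3(2) c3(2) c3(1) xy(2) prods(3)]
      \<open>\<beta> = 0\<close> \<open>\<gamma> = 0\<close> unfolding \<beta>_def \<gamma>_def by simp_all
  then consider "\<And>n. e x x n = 0" "\<And>n. e x y n = 0" | "\<And>n. e x x n = 0" "\<And>n. e y x n = 0"
    | "\<And>n. e y y n = 0" "\<And>n. e x y n = 0" | "\<And>n. e y y n = 0" "\<And>n. e y x n = 0"
    by blast
  then show ?thesis
  proof cases
    case 1
    then show ?thesis by (intro fin_i[OF c3(2) xy(6)]) (simp add: Ve ei c3 distrib_left)
  next
    case 2
    then show ?thesis by (intro fin_j[OF c3(2) xy(6)]) (simp add: Ve ej c3 distrib_left)
  next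
    case 3
    then show ?thesis by (intro fin_j[OF c3(1) xy(5)]) (simp add: Ve ej c3 distrib_left)
  next
    case 4
    then show ?thesis by (intro fin_i[OF c3(1) xy(5)]) (simp add: Ve ei c3 distrib_left)
  qed
qed

section \<open>Induction over the hopping directions\<close>

lemma iso_restrict:
  assumes "iso A V" "per V" "finite A" "B \<subseteq> A" and two: "\<And>l. l \<in> A - B \<Longrightarrow> l < d \<and> q l = 2"
  shows "iso B V"
  unfolding iso_def
proof (intro allI impI)
  fix w :: "nat \<Rightarrow> complex" and k assume w: "\<forall>i. w i \<noteq> 0"
  define w' where "w' l = (if l \<in> B then w l else \<i>)" for l
  have hop: "hopT A w' U u n = hopT B w U u n" if u: "per u" for U u n
  proof -
    have "(\<Sum>l\<in>A. w' l * u (sh l 1 n) + inverse (w' l) * u (sh l (-1) n))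
      = (\<Sum>l\<in>B. w l * u (sh l 1 n) + inverse (w l) * u (sh l (-1) n))"
    proof (rule sum.mono_neutral_cong_right)
      show "\<forall>l\<in>A - B. w' l * u (sh l 1 n) + inverse (w' l) * u (sh l (-1) n) = 0"
      proof
        fix l assume l: "l \<in> A - B"
        then have "u (sh l (-1) n) = u (sh l 1 n)" using two[OF l] sh_period[OF _ u, of l "-1" n] by simp
        then show "w' l * u (sh l 1 n) + inverse (w' l) * u (sh l (-1) n) = 0" using l by (simp add: w'_def)
      qed
    qed (use assms in \<open>auto simp: w'_def\<close>)
    then show ?thesis by (simp add: hopT_def)
  qed
  have pow: "(hopT A w' U ^^ k) u = (hopT B w U ^^ k) u" if U: "per U" "per u" for U u k
  proof (induction k)
    case (Suc k)
    show ?case using hop[OF per_hopT_pow[OF U, where A = B and w = w and k = k]] by (simp add: Suc fun_eq_iff)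
  qed simp
  have "per (\<lambda>_. 0)" by (simp add: per_def)
  then show "Tr (hopT B w V ^^ k) = Tr (hopT B w (\<lambda>_. 0) ^^ k)"
    using isoD[OF assms(1), of w' k] w pow[OF assms(2) per_dl] pow[OF _ per_dl, of "\<lambda>_. 0"]
    by (simp add: Tr_def w'_def)
qed

text \<open>Averaging over a direction of \<open>A\<close> gives an isospectral potential with one
  hopping direction less, which vanishes by induction. So \<open>V\<close> has average 0 along each
  direction of \<open>A\<close>: a period 1 finishes at once, a period 2 contributes only a sign,
  and at most two directions of period 3 are left.\<close>

lemma iso_zero:
  assumes q3: "\<And>j. j < d \<Longrightarrow> q j \<le> 3" "card {j. j < d \<and> q j = 3} \<le> 2"
    and "A \<subseteq> {..<d}" "iso A V" "per V" "\<And>j n. j < d \<Longrightarrow> j \<notin> A \<Longrightarrow> V (sh j 1 n) = V n"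
  shows "V n = 0"
  using assms(3-)
proof (induction "card A" arbitrary: A V n rule: less_induct)
  case less
  have fin: "finite A" using less.prems(1) finite_subset by blast
  have avg: "avg i V n = 0" if i: "i \<in> A" for i n
  proof (rule less.hyps)
    show "card (A - {i}) < card A" using fin i by (metis card_Diff1_less)
    have id: "i < d" using i less.prems(1) by auto
    show "iso (A - {i}) (avg i V)" "per (avg i V)" using iso_avg[OF less.prems(2,3) fin i id] by auto
    fix j n assume j: "j < d" "j \<notin> A - {i}"
    show "avg i V (sh j 1 n) = avg i V n"
    proof (cases "j = i")
      case True
      then show ?thesis using avg_sh[OF id less.prems(3)] by simp
    next
      case False
      then show ?thesis using less.prems(4)[of j] j by (simp add: avg_def sh_commute[of i _ j])
    qed
  qed (use less.prems(1) in auto)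
  have sum0: "(\<Sum>s<q i. V (sh i (int s) n)) = 0" if "i \<in> A" for i n
    using avg[OF that, of n] q_pos[of i] that less.prems(1) by (auto simp: avg_def)
  show ?case
  proof (cases "\<exists>i\<in>A. q i = 1")
    case True
    then obtain i where "i \<in> A" "q i = 1" by blast
    then show ?thesis using sum0[of i n] by simp
  next
    case False
    define B where "B = {i \<in> A. q i = 3}"
    have q2: "l < d \<and> q l = 2" if l: "l \<in> A - B" for l
    proof -
      have ld: "l < d" using l less.prems(1) by auto
      have "q l \<noteq> 1" "q l \<noteq> 3" using l False by (auto simp: B_def)
      then show ?thesis using q_pos[OF ld] q3(1)[OF ld] ld by auto
    qed
    have isoB: "iso B V" by (rule iso_restrict[OF less.prems(2,3) fin _ q2]) (auto simp: B_def)
    have sg: "signs B V"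
      unfolding signs_def
    proof (intro allI impI)
      fix k assume k: "k < d" "k \<notin> B"
      show "\<exists>c. c ^ 2 = 1 \<and> (\<forall>n. V (sh k 1 n) = c * V n)"
      proof (cases "k \<in> A")
        case True
        then have "q k = 2" using q2[of k] k by simp
        then have "V n + V (sh k 1 n) = 0" for n using sum0[OF True, of n] by (simp add: numeral_2_eq_2)
        then have "V (sh k 1 n) = - 1 * V n" for n by (simp add: eq_neg_iff_add_eq_0 add.commute)
        then show ?thesis by (intro exI[of _ "- 1"]) simp
      next
        case False
        then show ?thesis using less.prems(4)[OF k(1)] by (intro exI[of _ 1]) simp
      qed
    qed
    have B: "l < d" "q l = 3" "V n + V (sh l 1 n) + V (sh l 2 n) = 0" if "l \<in> B" for l n
      using that less.prems(1) sum0[of l n] by (auto simp: B_def numeral_3_eq_3)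
    have "B \<subseteq> {j. j < d \<and> q j = 3}" using B by auto
    then have "card B \<le> 2" using q3(2) card_mono[of "{j. j < d \<and> q j = 3}" B] by auto
    then consider "card B = 0" | "card B = 1" | "card B = 2" by linarith
    then show ?thesis
    proof cases
      case 1
      then have "B = {}" using fin by (simp add: B_def)
      then show ?thesis using iso_0_zero isoB less.prems(3) sg by simp
    next
      case 2
      then obtain i where "B = {i}" by (rule card_1_singletonE)
      then show ?thesis using iso_1_zero[of i V n] B[of i] isoB less.prems(3) sg by simp
    next
      case 3
      then obtain i j where "B = {i, j}" "i \<noteq> j" by (auto simp: card_2_iff)
      then show ?thesis using iso_2_zero[of i j V n] B[of i] B[of j] isoB less.prems(3) sg by simp
    qed
  qed
qed

lemma isospectral_zero:
  assumes q3: "\<And>j. j < d \<Longrightarrow> q j \<le> 3" "card {j. j < d \<and> q j = 3} \<le> 2"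
    and V: "is_periodic d q V" "floquet_isospectral d q V (\<lambda>_. 0)" and n: "n \<in> lattice_pts d"
  shows "V n = 0"
proof -
  have "V (red n) = 0"
    using iso_zero[OF q3 order_refl isospectral_imp_iso[OF V(2)], of n] by (simp add: per_def)
  define m where "m i = red n i - n i" for i
  have "m \<in> period_lattice d q"
    using n by (auto simp: period_lattice_def lattice_pts_def m_def red_def mod_eq_dvd_iff[symmetric])
  then have "V (\<lambda>i. n i + m i) = V n" using V(1) n by (auto simp: is_periodic_def)
  moreover have "(\<lambda>i. n i + m i) = red n" by (simp add: m_def)
  ultimately show ?thesis using \<open>V (red n) = 0\<close> by simp
qed

end

section \<open>Potentials depending on one coordinate\<close>

definition dper :: "nat \<Rightarrow> int \<Rightarrow> int \<Rightarrow> complex" where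
  "dper q r n = (if n mod int q = r then 1 else 0)"

text \<open>The full trace on the circle of \<open>q\<close> sites, including the walks that wind
  around it; \<open>trq\<close> leaves those out.\<close>

definition ptr :: "nat \<Rightarrow> complex \<Rightarrow> (int \<Rightarrow> complex) \<Rightarrow> nat \<Rightarrow> complex" where
  "ptr q w v k = (\<Sum>r\<in>{0..<int q}. (schr w (inverse w) v ^^ k) (dper q r) r)"

lemma words_0_indep: "words a b v k 0 u n = words a b (\<lambda>_. 0) k 0 u n"
  by (induction k arbitrary: n) simp_all

text \<open>A closed walk of length at most \<open>q\<close> containing a factor of the potential has fewer than \<open>q\<close> hops, so it
  cannot wind around the period and does not see the weight \<open>w\<close>.\<close>

lemma ptr_eq:
  assumes "w \<noteq> 0" "k \<le> q"
  shows "ptr q w v k = (\<Sum>r\<in>{0..<int q}. words w (inverse w) (\<lambda>_. 0) k 0 (dper q r) r)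
    + (trq q v k - trq q (\<lambda>_. 0) k)"
proof -
  have *: "words w (inverse w) v k j (dper q r) r = words 1 1 v k j (delta r) r"
    if j: "1 \<le> j" and r: "r \<in> {0..<int q}" for j r
  proof -
    have "words w (inverse w) v k j (dper q r) r = words w (inverse w) v k j (delta r) r"
    proof (rule words_cong)
      fix x assume "\<bar>x - r\<bar> \<le> int k - int j"
      then have lt: "\<bar>x - r\<bar> < int q" using assms(2) j by linarith
      show "dper q r x = delta r x"
      proof (cases "x = r")
        case True
        then show ?thesis using r by (simp add: dper_def delta_def)
      next
        case False
        have "x mod int q \<noteq> r"
        proof
          assume "x mod int q = r"
          then have "x mod int q = r mod int q" using r by simp
          then have "int q dvd x - r" by (simp add: mod_eq_dvd_iff)
          then show False using lt False dvd_imp_le_int[of "x - r" "int q"] by simp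
        qed
        then show ?thesis using False by (simp add: dper_def delta_def)
      qed
    qed
    then show ?thesis by (simp add: words_gauge[OF assms(1)])
  qed
  have "ptr q w v k = (\<Sum>r\<in>{0..<int q}. words w (inverse w) v k 0 (dper q r) r
      + (\<Sum>j=1..k. words w (inverse w) v k j (dper q r) r))"
  proof -
    have "{..k} = insert 0 {1..k}" by auto
    then show ?thesis by (simp add: ptr_def schr_pow)
  qed
  also have "\<dots> = (\<Sum>r\<in>{0..<int q}. words w (inverse w) (\<lambda>_. 0) k 0 (dper q r) r
      + (\<Sum>j=1..k. words 1 1 v k j (delta r) r))"
    using * by (intro sum.cong refl arg_cong2[of _ _ _ _ "(+)"] words_0_indep) auto
  also have "\<dots> = (\<Sum>r\<in>{0..<int q}. words w (inverse w) (\<lambda>_. 0) k 0 (dper q r) r) + (\<Sum>j=1..k. trw q v k j)"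
    unfolding sum.distrib trw_def by (subst (2) sum.swap) (rule refl)
  finally show ?thesis by (simp only: trq_diff)
qed

context torus
begin

lemma box_iff: "p \<in> box \<longleftrightarrow> (\<forall>i<d. 0 \<le> p i \<and> p i < int (q i)) \<and> (\<forall>i\<ge>d. p i = 0)"
proof
  assume "p \<in> box"
  then have p: "red p = p" by (simp add: box_def)
  have "0 \<le> p i \<and> p i < int (q i)" if "i < d" for i
    using fun_cong[OF p, of i] q_pos[OF that] that by (metis of_nat_0_less_iff pos_mod_bound pos_mod_sign red_def)
  moreover have "p i = 0" if "i \<ge> d" for i using fun_cong[OF p, of i] that by (simp add: red_def)
  ultimately show "(\<forall>i<d. 0 \<le> p i \<and> p i < int (q i)) \<and> (\<forall>i\<ge>d. p i = 0)" by blast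
next
  assume *: "(\<forall>i<d. 0 \<le> p i \<and> p i < int (q i)) \<and> (\<forall>i\<ge>d. p i = 0)"
  have "red p = p"
  proof
    fix i show "red p i = p i" using * by (cases "i < d") (simp_all add: red_def)
  qed
  then show "p \<in> box" by (simp add: box_def)
qed

lemma sum_box_fibre:
  fixes h :: "int \<Rightarrow> complex"
  assumes "j < d"
  shows "(\<Sum>p\<in>box. h (p j) * g (p(j := 0))) = (\<Sum>r\<in>{0..<int (q j)}. h r) * (\<Sum>p | p \<in> box \<and> p j = 0. g p)"
proof -
  have "(\<Sum>p\<in>box. h (p j) * g (p(j := 0))) = (\<Sum>(r, p)\<in>{0..<int (q j)} \<times> {p \<in> box. p j = 0}. h r * g p)"
    by (rule sum.reindex_bij_witness[of _ "\<lambda>(r, p). p(j := r)" "\<lambda>p. (p j, p(j := 0))"])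
      (use assms q_pos in \<open>auto simp: box_iff fun_upd_idem\<close>)
  then show ?thesis by (simp add: sum_product sum.cartesian_product)
qed

end

text \<open>Beyond length \<open>q\<close> winding walks do meet the potential. But the traces up to
  \<open>q\<close> already determine the characteristic polynomial of the \<open>q\<close> by
  \<open>q\<close> matrix, here that of a one-dimensional torus, and with it all further
  traces.\<close>

lemma ptr_eqI:
  assumes q: "q > 0" and w: "w \<noteq> 0" and v: "\<And>n. v (n + int q) = v n"
    and tr: "\<And>k. k \<le> q \<Longrightarrow> trq q v k = trq q (\<lambda>_. 0) k"
  shows "ptr q w v k = ptr q w (\<lambda>_. 0) k"
proof -
  interpret T: torus "Suc 0" "\<lambda>_. q" by unfold_locales (rule q)
  define H where "H v = hopT {0} (\<lambda>_. w) (\<lambda>n. v (n 0))" for v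
  have H: "H v (\<lambda>n. f (n 0)) = (\<lambda>n. schr w (inverse w) v f (n 0))" for v f
    by (rule ext) (simp add: H_def hopT_def schr_def sh_def)
  have pow: "(H v ^^ k) (\<lambda>n. f (n 0)) = (\<lambda>n. (schr w (inverse w) v ^^ k) f (n 0))" for v f k
    by (induction k) (simp_all add: H)
  have dl: "T.dl p = (\<lambda>n. dper q (p 0) (n 0))" if "p \<in> T.box" for p
  proof
    fix n
    have "T.red n = p \<longleftrightarrow> n 0 mod int q = p 0"
      using that by (auto simp: T.box_iff T.red_def fun_eq_iff)
    then show "T.dl p n = dper q (p 0) (n 0)" by (simp add: T.dl_def dper_def)
  qed
  have Tr: "T.Tr (H v ^^ k) = ptr q w v k" for v k
  proof -
    have "T.Tr (H v ^^ k) = (\<Sum>p\<in>T.box. (schr w (inverse w) v ^^ k) (dper q (p 0)) (p 0) * 1)"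
      unfolding T.Tr_def by (rule sum.cong) (simp_all add: dl pow)
    also have "\<dots> = ptr q w v k * (\<Sum>p | p \<in> T.box \<and> p 0 = 0. 1)"
      unfolding ptr_def by (rule T.sum_box_fibre) simp
    also have "{p. p \<in> T.box \<and> p 0 = 0} = {\<lambda>_. 0}"
    proof -
      have "p = (\<lambda>_. 0)" if p: "p \<in> T.box" "p 0 = 0" for p
      proof
        fix i show "p i = 0" using p by (cases "i = 0") (auto simp: T.box_iff)
      qed
      then show ?thesis using q by (auto simp: T.box_iff)
    qed
    finally show ?thesis by simp
  qed
  have mtr: "mtr (T.opmat (H v) ^\<^sub>m k) = ptr q w v k" if "\<And>n. v (n + int q) = v n" for v k
  proof -
    have "T.per (\<lambda>n. v (n 0))" using period_mod[of v q, OF that] by (simp add: T.per_def T.red_def)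
    then have "T.opmat (H v) ^\<^sub>m k = T.opmat (H v ^^ k)" unfolding H_def by (rule T.opmat_pow)
    then show ?thesis by (simp add: T.mtr_opmat Tr)
  qed
  have C: "T.opmat (H v) \<in> carrier_mat q q" for v by (simp add: T.opmat_def num_pts_def)
  have "char_poly (T.opmat (H v)) = char_poly (T.opmat (H (\<lambda>_. 0)))"
  proof (rule char_poly_eqI_traces[OF C C])
    fix k assume "k \<le> q"
    then show "mtr (T.opmat (H v) ^\<^sub>m k) = mtr (T.opmat (H (\<lambda>_. 0)) ^\<^sub>m k)"
      using mtr[of v k, OF v] mtr[of "\<lambda>_. 0" k] ptr_eq[OF w, of k q v] ptr_eq[OF w, of k q "\<lambda>_. 0"] tr by simp
  qed
  then have "mtr (T.opmat (H v) ^\<^sub>m k) = mtr (T.opmat (H (\<lambda>_. 0)) ^\<^sub>m k)"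
    by (intro traces_eqI_proots[OF C C]) simp
  then show ?thesis using mtr[of v k, OF v] mtr[of "\<lambda>_. 0" k] by simp
qed

context torus
begin

lemma hopT_pow_add: "(hopT A w V ^^ k) (\<lambda>n. f n + g n) = (\<lambda>n. (hopT A w V ^^ k) f n + (hopT A w V ^^ k) g n)"
proof (induction k)
  case (Suc k)
  show ?case
    unfolding funpow.simps comp_apply Suc by (rule ext) (simp add: hopT_def sum.distrib algebra_simps)
qed simp

lemma hopT_separated:
  assumes "j < d" "\<And>s n. x (sh j s n) = x n"
  shows "hopT {..<d} w (\<lambda>n. v (n j)) (\<lambda>n. y (n j) * x n)
    = (\<lambda>n. schr (w j) (inverse (w j)) v y (n j) * x n + y (n j) * hopT ({..<d} - {j}) w (\<lambda>_. 0) x n)"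
proof
  fix n
  have "(\<Sum>i\<in>{..<d} - {j}. w i * (y (sh i 1 n j) * x (sh i 1 n)) + inverse (w i) * (y (sh i (-1) n j) * x (sh i (-1) n)))
    = y (n j) * (\<Sum>i\<in>{..<d} - {j}. w i * x (sh i 1 n) + inverse (w i) * x (sh i (-1) n))"
    unfolding sum_distrib_left by (rule sum.cong) (auto simp: sh_def algebra_simps)
  moreover have "sh j s n j = n j + s" for s by (simp add: sh_def)
  ultimately show "hopT {..<d} w (\<lambda>n. v (n j)) (\<lambda>n. y (n j) * x n) n
    = schr (w j) (inverse (w j)) v y (n j) * x n + y (n j) * hopT ({..<d} - {j}) w (\<lambda>_. 0) x n"
    using assms unfolding hopT_def by (subst sum.remove[of _ j]) (simp_all add: schr_def algebra_simps)
qed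

text \<open>On a function of \<open>n j\<close> times a function of the other coordinates the
  operator obeys the product rule. Its traces thus combine those of the one-dimensional operator
  \<open>S v\<close> with those of the free operator \<open>D\<close>, and only the former see
  \<open>v\<close>.\<close>

lemma Tr_separated:
  assumes j: "j < d" and ptr: "\<And>a. ptr (q j) (w j) v a = ptr (q j) (w j) (\<lambda>_. 0) a"
  shows "Tr (hopT {..<d} w (\<lambda>n. v (n j)) ^^ k) = Tr (hopT {..<d} w (\<lambda>_. 0) ^^ k)"
proof -
  define D where "D = hopT ({..<d} - {j}) w (\<lambda>_. 0)"
  define S where "S v = schr (w j) (inverse (w j)) v" for v
  define H where "H v = hopT {..<d} w (\<lambda>n. v (n j))" for v
  define x where "x p n = (if red (n(j := 0)) = p(j := 0) then 1 else 0 :: complex)" for p n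
  have xinv: "(D ^^ b) (x p) (sh j s n) = (D ^^ b) (x p) n" for b p s n
  proof (induction b arbitrary: n)
    case 0
    have "(sh j s n)(j := 0) = n(j := 0)" by (simp add: sh_def)
    then show ?case by (simp add: x_def)
  next
    case (Suc b)
    have "(D ^^ Suc b) (x p) m
      = (\<Sum>i\<in>{..<d} - {j}. w i * (D ^^ b) (x p) (sh i 1 m) + inverse (w i) * (D ^^ b) (x p) (sh i (-1) m))" for m
      by (simp add: D_def hopT_def)
    then show ?case by (simp only: sh_commute[of _ _ j] Suc)
  qed
  \<comment> \<open>Interpolates between the full trace at \<open>a = b = 0\<close> and the
    separated traces at \<open>k = 0\<close>: each application of \<open>H\<close> is traded for one
    of \<open>S\<close> or one of \<open>D\<close>.\<close>
  define G where "G v k a b = (\<Sum>p\<in>box. (H v ^^ k) (\<lambda>n. (S v ^^ a) (dper (q j) (p j)) (n j) * (D ^^ b) (x p) n) p)"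
    for v k a b
  have "dl p = (\<lambda>n. dper (q j) (p j) (n j) * x p n)" if "p \<in> box" for p
  proof
    fix n
    have "red n = p \<longleftrightarrow> n j mod int (q j) = p j \<and> red (n(j := 0)) = p(j := 0)"
    proof -
      have "red (n(j := 0)) = (red n)(j := 0)" by (auto simp: red_def)
      moreover have "red n j = n j mod int (q j)" using j by (simp add: red_def)
      ultimately show ?thesis by (metis fun_upd_triv fun_upd_upd)
    qed
    then show "dl p n = dper (q j) (p j) (n j) * x p n" by (simp add: dl_def dper_def x_def)
  qed
  then have Tr: "Tr (H v ^^ k) = G v k 0 0" for v k unfolding Tr_def G_def by (intro sum.cong) simp_all
  have base: "G v 0 a b = ptr (q j) (w j) v a * (\<Sum>p | p \<in> box \<and> p j = 0. (D ^^ b) (x p) p)" for v a b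
  proof -
    have "(D ^^ b) (x p) p = (D ^^ b) (x (p(j := 0))) (p(j := 0))" for p
    proof -
      have "x (p(j := 0)) = x p" by (rule ext) (simp add: x_def)
      moreover have "p = sh j (p j) (p(j := 0))" by (simp add: sh_def)
      ultimately show ?thesis using xinv[of b p "p j" "p(j := 0)"] by metis
    qed
    then have "G v 0 a b = (\<Sum>p\<in>box. (S v ^^ a) (dper (q j) (p j)) (p j) * (D ^^ b) (x (p(j := 0))) (p(j := 0)))"
      by (simp add: G_def)
    also have "\<dots> = ptr (q j) (w j) v a * (\<Sum>p | p \<in> box \<and> p j = 0. (D ^^ b) (x p) p)"
      unfolding ptr_def S_def by (rule sum_box_fibre[OF j, of "\<lambda>r. (schr (w j) (inverse (w j)) v ^^ a) (dper (q j) r) r"])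
    finally show ?thesis .
  qed
  have step: "G v (Suc k) a b = G v k (Suc a) b + G v k a (Suc b)" for v k a b
    unfolding G_def sum.distrib[symmetric]
  proof (rule sum.cong[OF refl])
    fix p
    have "H v (\<lambda>n. (S v ^^ a) (dper (q j) (p j)) (n j) * (D ^^ b) (x p) n)
      = (\<lambda>n. (S v ^^ Suc a) (dper (q j) (p j)) (n j) * (D ^^ b) (x p) n
        + (S v ^^ a) (dper (q j) (p j)) (n j) * (D ^^ Suc b) (x p) n)"
      using hopT_separated[of j "(D ^^ b) (x p)" w v "(S v ^^ a) (dper (q j) (p j))", OF j xinv]
      by (simp add: H_def S_def D_def)
    then show "(H v ^^ Suc k) (\<lambda>n. (S v ^^ a) (dper (q j) (p j)) (n j) * (D ^^ b) (x p) n) p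
      = (H v ^^ k) (\<lambda>n. (S v ^^ Suc a) (dper (q j) (p j)) (n j) * (D ^^ b) (x p) n) p
        + (H v ^^ k) (\<lambda>n. (S v ^^ a) (dper (q j) (p j)) (n j) * (D ^^ Suc b) (x p) n) p"
      unfolding funpow_Suc_right comp_apply by (simp only: H_def hopT_pow_add)
  qed
  have "G v k a b = G (\<lambda>_. 0) k a b" for k a b
    by (induction k arbitrary: a b) (simp_all add: base step ptr)
  then show ?thesis using Tr[where v = v and k = k] Tr[where v = "\<lambda>_. 0" and k = k] by (simp add: H_def)
qed

lemma nonzero_isospectral:
  assumes j: "j < d" "q j > 3"
  shows "\<exists>V. is_periodic d q V \<and> (\<exists>n\<in>lattice_pts d. V n \<noteq> 0) \<and> floquet_isospectral d q V (\<lambda>_. 0)"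
proof -
  obtain v :: "int \<Rightarrow> complex" and r where v: "\<And>n. v (n + int (q j)) = v n" "v r \<noteq> 0"
    "\<And>k. k \<le> q j \<Longrightarrow> trq (q j) v k = trq (q j) (\<lambda>_. 0) k"
    using nonzero_isospectral_1d[of "q j"] j(2) by auto
  have vmod: "v (n mod int (q j)) = v n" for n by (rule period_mod[of v "q j", OF v(1)])
  have "is_periodic d q (\<lambda>n. v (n j))"
    unfolding is_periodic_def
  proof (intro ballI)
    fix n m assume "m \<in> period_lattice d q"
    then have "int (q j) dvd m j" using j by (auto simp: period_lattice_def)
    then have "(n j + m j) mod int (q j) = n j mod int (q j)" by (auto elim!: dvdE)
    then show "v (n j + m j) = v (n j)" by (metis vmod)
  qed
  moreover have "(\<lambda>i. if i = j then r else 0) \<in> lattice_pts d" using j by (simp add: lattice_pts_def)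
  then have "\<exists>n\<in>lattice_pts d. v (n j) \<noteq> 0" using v(2) by (intro bexI[of _ "\<lambda>i. if i = j then r else 0"]) simp_all
  moreover have "floquet_isospectral d q (\<lambda>n. v (n j)) (\<lambda>_. 0)"
  proof (rule traces_imp_isospectral)
    fix w :: "nat \<Rightarrow> complex" and k assume "\<And>i. i < d \<Longrightarrow> cmod (w i) = 1"
    then have "w j \<noteq> 0" using j by fastforce
    have "(\<lambda>n. v (n j)) \<circ> red = (\<lambda>n. v (n j))" using j vmod by (auto simp: red_def)
    then show "Tr (hopT {..<d} w ((\<lambda>n. v (n j)) \<circ> red) ^^ k) = Tr (hopT {..<d} w ((\<lambda>_. 0) \<circ> red) ^^ k)"
      using Tr_separated[of j w v k, OF j(1) ptr_eqI[OF q_pos[OF j(1)] \<open>w j \<noteq> 0\<close> v(1,3)]] by (simp add: comp_def)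
  qed
  ultimately show ?thesis by blast
qed

end

theorem theoremC:
  fixes d :: nat and q :: "nat \<Rightarrow> nat"
  assumes "d \<ge> 1" and "\<forall>j<d. q j > 0"
  shows "((\<exists>j<d. q j > 3) \<longrightarrow>
            (\<exists>V. is_periodic d q V \<and> (\<exists>n \<in> lattice_pts d. V n \<noteq> 0) \<and>
                 floquet_isospectral d q V (\<lambda>_. 0)))
       \<and> (((\<forall>j<d. q j \<le> 3) \<and> card {j. j < d \<and> q j = 3} \<le> 2) \<longrightarrow>
            (\<forall>V. is_periodic d q V \<and> floquet_isospectral d q V (\<lambda>_. 0) \<longrightarrow>
                 (\<forall>n \<in> lattice_pts d. V n = 0)))"
proof -
  interpret torus d q by unfold_locales (use assms(2) in blast)
  show ?thesis
  proof (intro conjI impI allI ballI)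
    assume "\<exists>j<d. q j > 3"
    then show "\<exists>V. is_periodic d q V \<and> (\<exists>n\<in>lattice_pts d. V n \<noteq> 0) \<and> floquet_isospectral d q V (\<lambda>_. 0)"
      using nonzero_isospectral by blast
  next
    fix V n assume "(\<forall>j<d. q j \<le> 3) \<and> card {j. j < d \<and> q j = 3} \<le> 2"
      "is_periodic d q V \<and> floquet_isospectral d q V (\<lambda>_. 0)" "n \<in> lattice_pts d"
    then show "V n = 0" by (intro isospectral_zero) auto
  qed
qed

end
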